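(* Let $F$ be a natural bundle on $\mathcal{M}f_n$, $M$ an $n$-dimensional smooth manifold, $G$ a Lie group, $P$ a principal $G$-bundle over $M$, $N$ a manifold with a smooth left $G$-action, $V$ a $G$-module, and $\omega\colon TN\to V$ a $G$-equivariant $1$-form. Let $\widetilde X$ be a $G$-invariant vector field on $P$, lying over the vector field $X$ on $M$, and let $h\colon F(M)\to P\times_G N$ be a fiber bundle map over $M$. Then for all $x\in M$, $p\in P_x$ and $y\in F(M)_x$ $$\pounds^{\omega}_{\widetilde X}h(y)=\left[\,p,\ \omega\left(\left.\frac{d}{dt}\right|_{t=0}(\Phi^t_{\widetilde X}p)\backslash h\big(\Phi^t_{\mathcal F(X)}(y)\big)\right)\right]\in P\times_G V .$$
   Context: All manifolds and maps are smooth. $\Phi^t_X$ denotes the (local) flow of a vector field $X$, defined at time $t$ on the open set $U^X_t$. Natural bundles. $\mathcal{M}f_n$ is the category of $n$-dimensional manifolds with local diffeomorphisms as morphisms. A natural bundle on $\mathcal{M}f_n$ is a functor $F$ from $\mathcal{M}f_n$ to smooth manifolds together with a natural transformation $p_M\colon F(M)\to M$ such that each $p_M$ is a fiber bundle and, for each morphism $f\colon M\to M'$, $F(f)$ covers $f$ and is a fiberwise diffeomorphism. For a vector field $X$ on $M$, its canonical lift $\mathcal F(X)$ is the unique vector field on $F(M)$ whose flow satisfies $U^{\mathcal F(X)}_t=\mathrm{Im}\,F(\iota_t)$ and $\Phi^t_{\mathcal F(X)}\circ F(\iota_t)=F(\iota_{-t})\circ F(\Phi^t_X)$, where $\iota_t\colon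 U^X_t\hookrightarrow M$ is the inclusion and $\Phi^t_X\colon U^X_t\to U^X_{-t}$. Associated bundles. $P\times_G N=(P\times N)/G$ for the action $(p,y)g=(pg,g^{-1}y)$; classes are written $[p,y]$. For $p,p'$ in the same fiber of $P$, $p\backslash p'\in G$ is defined by $p(p\backslash p')=p'$; for $p\in P_x$ and $z\in (P\times_G N)_x$, $p\backslash z\in N$ is the unique element with $z=[p,p\backslash z]$. Darboux-Lie derivative. Let $\widetilde X_N$ be the vector field on $P\times_G N$ with flow $[p,y]\mapsto[\Phi^t_{\widetilde X}p,y]$. For a bundle map $h\colon F(M)\to P\times_G N$ over $\mathrm{id}_M$ set $\tilde{\pounds}_{\widetilde X}h(y)=T_yh(\mathcal F(X)_y)-(\widetilde X_N)_{h(y)}$, a vertical tangent vector of $P\times_G N$. Let $\nu$ be the isomorphism from the vertical bundle of $P\times_G N$ to $P\times_G TN$ given by $\left.\frac{d}{dt}\right|_{0}[\gamma_P(t),\gamma_N(t)]\mapsto\big[\gamma_P(0),\left.\frac{d}{dt}\right|_{0}(\gamma_P(0)\backslash\gamma_P(t))\gamma_N(t)\big]$ ($\gamma_P$ a vertical curve in $P$, $\gamma_N$ a curve in $N$), and $\mathrm{id}\times_G\omega\colon P\times_G TN\to P\times_G V$, $[p,Y]\mapsto[p,\omega(Y)]$. The Darboux-Lie derivative of $h$ along $\widetilde X$ with respect to $\omega$ is $\pounds^\omega_{\widetilde X}h=(\mathrm{id}\times_G\omega)\circ\nu\circ\tilde{\pounds}_{\widetilde X}h\colon F(M)\to P\times_G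 V$. *)

theory Defs
  imports "HOL-Analysis.Analysis" "HOL-Algebra.Group"
begin

section \<open>Model spaces and smoothness\<close>

text \<open>
  Finite-dimensional Euclidean spaces. In contrast to \<^class>\<open>euclidean_space\<close> the orthonormal
  basis may be empty, so that 0-dimensional manifolds (discrete groups \<open>G\<close>, for instance) are
  covered. Completeness follows from the other axioms; it is included only to have
  \<^class>\<open>banach\<close> as a superclass.
\<close>

class model_space = real_inner + banach +
  assumes finite_orthonormal_basis:
    "\<exists>B. finite B \<and> (\<forall>b\<in>B. \<forall>b'\<in>B. inner b b' = (if b = b' then 1 else 0))
       \<and> (\<forall>x. x = (\<Sum>b\<in>B. inner x b *\<^sub>R b))"

instance euclidean_space \<subseteq> model_space
proof
  show "\<exists>B::'a set. finite B \<and> (\<forall>b\<in>B. \<forall>b'\<in>B. inner b b' = (if b = b' then 1 else 0))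
       \<and> (\<forall>x. x = (\<Sum>b\<in>B. inner x b *\<^sub>R b))"
    by (rule exI[of _ Basis]) (auto simp: inner_Basis euclidean_representation)
qed

instance prod :: (model_space, model_space) model_space
proof
  obtain B :: "'a set" where B: "finite B"
    "\<forall>b\<in>B. \<forall>b'\<in>B. inner b b' = (if b = b' then 1 else 0)"
    "\<And>x. x = (\<Sum>b\<in>B. inner x b *\<^sub>R b)"
    using finite_orthonormal_basis[where 'a = 'a] by blast
  obtain C :: "'b set" where C: "finite C"
    "\<forall>b\<in>C. \<forall>b'\<in>C. inner b b' = (if b = b' then 1 else 0)"
    "\<And>x. x = (\<Sum>b\<in>C. inner x b *\<^sub>R b)"
    using finite_orthonormal_basis[where 'a = 'b] by blast
  let ?B = "(\<lambda>b. (b, 0)) ` B :: ('a \<times> 'b) set" and ?C = "(\<lambda>c. (0, c)) ` C :: ('a \<times> 'b) set"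
  have n0: "0 \<notin> B" "0 \<notin> C" using B(2) C(2) by force+
  have disj: "?B \<inter> ?C = {}" using n0 by auto
  have "x = (\<Sum>b\<in>?B \<union> ?C. inner x b *\<^sub>R b)" for x :: "'a \<times> 'b"
  proof -
    have "(\<Sum>b\<in>?B \<union> ?C. inner x b *\<^sub>R b)
        = (\<Sum>b\<in>?B. inner x b *\<^sub>R b) + (\<Sum>b\<in>?C. inner x b *\<^sub>R b)"
      using B(1) C(1) disj by (intro sum.union_disjoint) auto
    also have "\<dots> = (\<Sum>b\<in>B. (inner (fst x) b *\<^sub>R b, 0)) + (\<Sum>c\<in>C. (0, inner (snd x) c *\<^sub>R c))"
      by (auto simp: sum.reindex inj_on_def inner_prod_def)
    also have "\<dots> = (\<Sum>b\<in>B. inner (fst x) b *\<^sub>R b, \<Sum>c\<in>C. inner (snd x) c *\<^sub>R c)"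
      by (simp add: prod_eq_iff fst_sum snd_sum)
    also have "\<dots> = x"
      using B(3)[of "fst x"] C(3)[of "snd x"] by simp
    finally show ?thesis by simp
  qed
  moreover have "\<forall>b\<in>?B \<union> ?C. \<forall>b'\<in>?B \<union> ?C. inner b b' = (if b = b' then 1 else 0)"
  proof (intro ballI)
    fix b b' assume "b \<in> ?B \<union> ?C" "b' \<in> ?B \<union> ?C"
    then show "inner b b' = (if b = b' then 1 else 0)"
      using B(2) C(2) n0 by (elim UnE imageE) (simp_all, metis+)
  qed
  moreover have "finite (?B \<union> ?C)" using B(1) C(1) by simp
  ultimately show "\<exists>B::('a \<times> 'b) set. finite B
      \<and> (\<forall>b\<in>B. \<forall>b'\<in>B. inner b b' = (if b = b' then 1 else 0))
      \<and> (\<forall>x. x = (\<Sum>b\<in>B. inner x b *\<^sub>R b))"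
    by blast
qed

primrec Ck_on :: "nat \<Rightarrow> ('a::real_normed_vector \<Rightarrow> 'b::real_normed_vector) \<Rightarrow> 'a set \<Rightarrow> bool" where
  "Ck_on 0 f S \<longleftrightarrow> continuous_on S f"
| "Ck_on (Suc k) f S \<longleftrightarrow> (\<forall>x\<in>S. f differentiable at x) \<and>
     (\<forall>v. Ck_on k (\<lambda>x. frechet_derivative f (at x) v) S)"

text \<open>Only used for open \<open>S\<close>.\<close>

definition smooth_on :: "('a::real_normed_vector \<Rightarrow> 'b::real_normed_vector) \<Rightarrow> 'a set \<Rightarrow> bool" where
  "smooth_on f S \<longleftrightarrow> (\<forall>k. Ck_on k f S)"


section \<open>Manifolds\<close>

text \<open>
  A manifold is given by an atlas; its underlying set is the union of the chart domains and its
  topology is the one generated by the charts. The dimension is the dimension of the model space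
  \<open>'e\<close>. The values of a chart outside its domain are irrelevant.
\<close>

type_synonym ('a, 'e) chart = "'a set \<times> ('a \<Rightarrow> 'e)"
type_synonym ('a, 'e) atlas = "('a, 'e) chart set"

definition points :: "('a, 'e) atlas \<Rightarrow> 'a set" where
  "points A = \<Union>(fst ` A)"

definition mtop :: "('a, 'e::model_space) atlas \<Rightarrow> 'a topology" where
  "mtop A = topology_generated_by {U \<inter> \<phi> -` V | U \<phi> V. (U, \<phi>) \<in> A \<and> open V}"

definition second_countable_space :: "'a topology \<Rightarrow> bool" where
  "second_countable_space T \<longleftrightarrow> (\<exists>\<B>. countable \<B> \<and> (\<forall>V\<in>\<B>. openin T V) \<and>
     (\<forall>U x. openin T U \<and> x \<in> U \<longrightarrow> (\<exists>V\<in>\<B>. x \<in> V \<and> V \<subseteq> U)))"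

definition manifold :: "('a, 'e::model_space) atlas \<Rightarrow> bool" where
  "manifold A \<longleftrightarrow>
     (\<forall>(U, \<phi>)\<in>A. inj_on \<phi> U \<and> open (\<phi> ` U)) \<and>
     (\<forall>(U, \<phi>)\<in>A. \<forall>(W, \<psi>)\<in>A.
        open (\<phi> ` (U \<inter> W)) \<and> smooth_on (\<psi> \<circ> inv_into U \<phi>) (\<phi> ` (U \<inter> W))) \<and>
     Hausdorff_space (mtop A) \<and> second_countable_space (mtop A)"

definition smooth_map ::
  "('a, 'e::model_space) atlas \<Rightarrow> ('b, 'f::model_space) atlas \<Rightarrow> ('a \<Rightarrow> 'b) \<Rightarrow> bool" where
  "smooth_map A B f \<longleftrightarrow> continuous_map (mtop A) (mtop B) f \<and>
     (\<forall>(U, \<phi>)\<in>A. \<forall>(W, \<psi>)\<in>B. smooth_on (\<psi> \<circ> f \<circ> inv_into U \<phi>) (\<phi> ` (U \<inter> f -` W)))"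

definition diffeo ::
  "('a, 'e::model_space) atlas \<Rightarrow> ('b, 'f::model_space) atlas \<Rightarrow> ('a \<Rightarrow> 'b) \<Rightarrow> bool" where
  "diffeo A B f \<longleftrightarrow> bij_betw f (points A) (points B) \<and>
     smooth_map A B f \<and> smooth_map B A (inv_into (points A) f)"

definition restrict_atlas :: "('a, 'e) atlas \<Rightarrow> 'a set \<Rightarrow> ('a, 'e) atlas" where
  "restrict_atlas A S = (\<lambda>(U, \<phi>). (U \<inter> S, \<phi>)) ` A"

definition prod_atlas :: "('a, 'e) atlas \<Rightarrow> ('b, 'f) atlas \<Rightarrow> ('a \<times> 'b, 'e \<times> 'f) atlas" where
  "prod_atlas A B = {(U \<times> W, map_prod \<phi> \<psi>) | U \<phi> W \<psi>. (U, \<phi>) \<in> A \<and> (W, \<psi>) \<in> B}"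

definition std_atlas :: "('e, 'e) atlas" where
  "std_atlas = {(UNIV, \<lambda>v. v)}"

definition interval_atlas :: "real \<Rightarrow> (real, real) atlas" where
  "interval_atlas \<epsilon> = {({-\<epsilon><..<\<epsilon>}, \<lambda>t. t)}"

definition local_diffeo ::
  "('a, 'e::model_space) atlas \<Rightarrow> ('b, 'f::model_space) atlas \<Rightarrow> ('a \<Rightarrow> 'b) \<Rightarrow> bool" where
  "local_diffeo A B f \<longleftrightarrow> smooth_map A B f \<and>
     (\<forall>x\<in>points A. \<exists>S. x \<in> S \<and> openin (mtop A) S \<and> openin (mtop B) (f ` S) \<and>
        diffeo (restrict_atlas A S) (restrict_atlas B (f ` S)) f)"


section \<open>Tangent vectors, vector fields, flows\<close>

text \<open>
  A tangent vector at \<open>x\<close> is a pair \<open>(x, v)\<close>, where \<open>v\<close> in the model space is its coordinate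
  vector in the chart \<open>chart_at A x\<close>, chosen once and for all for each point \<open>x\<close>.
  Thus \<open>TA = points A \<times> UNIV\<close>, with the usual linear structure on the fibres.
  A vector field is given by its second component \<open>X\<close>.
\<close>

definition chart_at :: "('a, 'e) atlas \<Rightarrow> 'a \<Rightarrow> ('a, 'e) chart" where
  "chart_at A x = (SOME c. c \<in> A \<and> x \<in> fst c)"

definition tangent_map ::
  "('a, 'e::model_space) atlas \<Rightarrow> ('b, 'f::model_space) atlas \<Rightarrow> ('a \<Rightarrow> 'b) \<Rightarrow> 'a \<times> 'e \<Rightarrow> 'b \<times> 'f" where
  "tangent_map A B f = (\<lambda>(x, v). (f x,
     let (U, \<phi>) = chart_at A x; (W, \<psi>) = chart_at B (f x)
     in frechet_derivative (\<psi> \<circ> f \<circ> inv_into U \<phi>) (at (\<phi> x)) v))"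

definition velocity :: "('a, 'e::model_space) atlas \<Rightarrow> (real \<Rightarrow> 'a) \<Rightarrow> real \<Rightarrow> 'a \<times> 'e" where
  "velocity A \<gamma> t = (\<gamma> t, vector_derivative (snd (chart_at A (\<gamma> t)) \<circ> \<gamma>) (at t))"

definition vector_field :: "('a, 'e::model_space) atlas \<Rightarrow> ('a \<Rightarrow> 'e) \<Rightarrow> bool" where
  "vector_field A X \<longleftrightarrow> (\<forall>(U, \<phi>)\<in>A. smooth_on
     (\<lambda>u. let x = inv_into U \<phi> u in snd (tangent_map A std_atlas \<phi> (x, X x))) (\<phi> ` U))"

definition one_form :: "('a, 'e::model_space) atlas \<Rightarrow> ('a \<times> 'e \<Rightarrow> 'v::model_space) \<Rightarrow> bool" where
  "one_form A \<omega> \<longleftrightarrow> (\<forall>x\<in>points A. linear (\<lambda>v. \<omega> (x, v))) \<and>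
     (\<forall>(U, \<phi>)\<in>A. \<forall>v. smooth_on
        (\<lambda>u. \<omega> (tangent_map std_atlas A (inv_into U \<phi>) (u, v))) (\<phi> ` U))"

definition integral_curve ::
  "('a, 'e::model_space) atlas \<Rightarrow> ('a \<Rightarrow> 'e) \<Rightarrow> real set \<Rightarrow> (real \<Rightarrow> 'a) \<Rightarrow> bool" where
  "integral_curve A X J \<gamma> \<longleftrightarrow> open J \<and> is_interval J \<and>
     continuous_map (top_of_set J) (mtop A) \<gamma> \<and>
     (\<forall>t\<in>J. ((snd (chart_at A (\<gamma> t)) \<circ> \<gamma>) has_vector_derivative X (\<gamma> t)) (at t))"

text \<open>\<open>flow_dom A X t\<close> is the open set on which the time-\<open>t\<close> flow of \<open>X\<close> is defined.\<close>

definition flow_dom :: "('a, 'e::model_space) atlas \<Rightarrow> ('a \<Rightarrow> 'e) \<Rightarrow> real \<Rightarrow> 'a set" where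
  "flow_dom A X t = {x. \<exists>J \<gamma>. 0 \<in> J \<and> t \<in> J \<and> integral_curve A X J \<gamma> \<and> \<gamma> 0 = x}"

definition flow :: "('a, 'e::model_space) atlas \<Rightarrow> ('a \<Rightarrow> 'e) \<Rightarrow> real \<Rightarrow> 'a \<Rightarrow> 'a" where
  "flow A X t x =
     (THE z. \<exists>J \<gamma>. 0 \<in> J \<and> t \<in> J \<and> integral_curve A X J \<gamma> \<and> \<gamma> 0 = x \<and> \<gamma> t = z)"

text \<open>The vector field with a given flow \<open>Fl\<close>.\<close>

definition flow_generator :: "('a, 'e::model_space) atlas \<Rightarrow> (real \<Rightarrow> 'a \<Rightarrow> 'a) \<Rightarrow> 'a \<Rightarrow> 'e" where
  "flow_generator A Fl z = snd (velocity A (\<lambda>t. Fl t z) 0)"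


section \<open>Fibre bundles and natural bundles\<close>

definition trivialization ::
  "('b, 'f::model_space) atlas \<Rightarrow> ('a, 'e::model_space) atlas \<Rightarrow> ('b \<Rightarrow> 'a) \<Rightarrow>
   ('s, 'k::model_space) atlas \<Rightarrow> 'a set \<Rightarrow> ('b \<Rightarrow> 'a \<times> 's) \<Rightarrow> bool" where
  "trivialization E M \<pi> S U \<psi> \<longleftrightarrow> openin (mtop M) U \<and>
     diffeo (restrict_atlas E (\<pi> -` U)) (prod_atlas (restrict_atlas M U) S) \<psi> \<and>
     (\<forall>y\<in>points E \<inter> \<pi> -` U. fst (\<psi> y) = \<pi> y)"

text \<open>\<open>S\<close> is the standard fibre.\<close>

definition fiber_bundle ::
  "('b, 'f::model_space) atlas \<Rightarrow> ('a, 'e::model_space) atlas \<Rightarrow> ('b \<Rightarrow> 'a) \<Rightarrow>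
   ('s, 'k::model_space) atlas \<Rightarrow> bool" where
  "fiber_bundle E M \<pi> S \<longleftrightarrow> manifold E \<and> manifold M \<and> manifold S \<and> smooth_map E M \<pi> \<and>
     (\<forall>x\<in>points M. \<exists>U \<psi>. x \<in> U \<and> trivialization E M \<pi> S U \<psi>)"

text \<open>
  The map \<open>g\<close> from the bundle \<open>E\<close> to the bundle \<open>E'\<close> covers \<open>f\<close> and restricts to a diffeomorphism
  between fibres, the latter being identified with \<open>S\<close> through local trivializations.
\<close>

definition fiberwise_diffeo ::
  "('b, 'f::model_space) atlas \<Rightarrow> ('a, 'e::model_space) atlas \<Rightarrow> ('b \<Rightarrow> 'a) \<Rightarrow>
   ('b, 'f) atlas \<Rightarrow> ('a, 'e) atlas \<Rightarrow> ('b \<Rightarrow> 'a) \<Rightarrow>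
   ('s, 'k::model_space) atlas \<Rightarrow> ('a \<Rightarrow> 'a) \<Rightarrow> ('b \<Rightarrow> 'b) \<Rightarrow> bool" where
  "fiberwise_diffeo E M \<pi> E' M' \<pi>' S f g \<longleftrightarrow>
     smooth_map E E' g \<and> (\<forall>y\<in>points E. \<pi>' (g y) = f (\<pi> y)) \<and>
     (\<forall>x\<in>points M. \<forall>U \<psi> U' \<psi>'. x \<in> U \<and> trivialization E M \<pi> S U \<psi> \<and>
        f x \<in> U' \<and> trivialization E' M' \<pi>' S U' \<psi>' \<longrightarrow>
        diffeo S S (\<lambda>s. snd (\<psi>' (g (inv_into (points E \<inter> \<pi> -` U) \<psi> (x, s))))))"

text \<open>The category of manifolds with underlying set in \<open>'a\<close>, modelled on \<open>'e\<close>.\<close>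

definition Mf_morphism ::
  "('a, 'e::model_space) atlas \<Rightarrow> ('a, 'e) atlas \<Rightarrow> ('a \<Rightarrow> 'a) \<Rightarrow> bool" where
  "Mf_morphism M M' f \<longleftrightarrow> manifold M \<and> manifold M' \<and> local_diffeo M M' f"

record ('a, 'e, 'b, 'f) bundle_functor =
  Fobj :: "('a, 'e) atlas \<Rightarrow> ('b, 'f) atlas"
  Fmap :: "('a, 'e) atlas \<Rightarrow> ('a, 'e) atlas \<Rightarrow> ('a \<Rightarrow> 'a) \<Rightarrow> 'b \<Rightarrow> 'b"
  Fproj :: "('a, 'e) atlas \<Rightarrow> 'b \<Rightarrow> 'a"

text \<open>
  Functions on a manifold are total HOL functions that only matter on its points, hence the
  congruence condition. All bundles \<open>Fobj F M\<close> with \<open>M\<close> nonempty have diffeomorphic fibres, so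
  that one standard fibre \<open>S\<close> is no restriction.
\<close>

definition natural_bundle ::
  "('a, 'e::model_space, 'b, 'f::model_space) bundle_functor \<Rightarrow> ('s, 'k::model_space) atlas \<Rightarrow> bool" where
  "natural_bundle F S \<longleftrightarrow>
     (\<forall>M. manifold M \<longrightarrow> fiber_bundle (Fobj F M) M (Fproj F M) S) \<and>
     (\<forall>M M' f. Mf_morphism M M' f \<longrightarrow>
        fiberwise_diffeo (Fobj F M) M (Fproj F M) (Fobj F M') M' (Fproj F M') S f (Fmap F M M' f)) \<and>
     (\<forall>M M' f g. Mf_morphism M M' f \<and> (\<forall>x\<in>points M. f x = g x) \<longrightarrow>
        (\<forall>y\<in>points (Fobj F M). Fmap F M M' f y = Fmap F M M' g y)) \<and>
     (\<forall>M. manifold M \<longrightarrow> (\<forall>y\<in>points (Fobj F M). Fmap F M M (\<lambda>x. x) y = y)) \<and>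
     (\<forall>M M' M'' f g. Mf_morphism M M' f \<and> Mf_morphism M' M'' g \<longrightarrow>
        (\<forall>y\<in>points (Fobj F M). Fmap F M M'' (g \<circ> f) y = Fmap F M' M'' g (Fmap F M M' f y)))"

text \<open>
  \<open>Y\<close> is the canonical lift of \<open>X\<close> to \<open>Fobj F M\<close>. The two morphism conditions hold for every vector
  field \<open>X\<close> (openness of the flow domains, smoothness of the flow); they state that the
  arguments to which the functor is applied in the defining equations are morphisms.
\<close>

definition canonical_lift ::
  "('a, 'e::model_space, 'b, 'f::model_space) bundle_functor \<Rightarrow> ('a, 'e) atlas \<Rightarrow>
   ('a \<Rightarrow> 'e) \<Rightarrow> ('b \<Rightarrow> 'f) \<Rightarrow> bool" where
  "canonical_lift F M X Y \<longleftrightarrow> vector_field (Fobj F M) Y \<and>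
     (\<forall>t. let U = restrict_atlas M (flow_dom M X t);
              U' = restrict_atlas M (flow_dom M X (-t));
              \<Phi> = flow M X t; \<iota> = (\<lambda>x. x)
          in Mf_morphism U M \<iota> \<and> Mf_morphism U U' \<Phi> \<and>
             flow_dom (Fobj F M) Y t = Fmap F U M \<iota> ` points (Fobj F U) \<and>
             (\<forall>z\<in>points (Fobj F U).
                flow (Fobj F M) Y t (Fmap F U M \<iota> z) = Fmap F U' M \<iota> (Fmap F U U' \<Phi> z)))"


section \<open>Lie groups, actions, principal bundles\<close>

record ('g, 'k) lie_group_data = "'g monoid" +
  gcharts :: "('g, 'k) atlas"

definition lie_group :: "('g, 'k::model_space) lie_group_data \<Rightarrow> bool" where
  "lie_group G \<longleftrightarrow> group G \<and> manifold (gcharts G) \<and> points (gcharts G) = carrier G \<and>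
     smooth_map (prod_atlas (gcharts G) (gcharts G)) (gcharts G) (\<lambda>(g, h). mult G g h) \<and>
     smooth_map (gcharts G) (gcharts G) (m_inv G)"

definition smooth_left_action ::
  "('g, 'k::model_space) lie_group_data \<Rightarrow> ('n, 'd::model_space) atlas \<Rightarrow> ('g \<Rightarrow> 'n \<Rightarrow> 'n) \<Rightarrow> bool" where
  "smooth_left_action G N act \<longleftrightarrow>
     smooth_map (prod_atlas (gcharts G) N) N (\<lambda>(g, y). act g y) \<and>
     (\<forall>y\<in>points N. act (one G) y = y) \<and>
     (\<forall>g\<in>carrier G. \<forall>g'\<in>carrier G. \<forall>y\<in>points N. act (mult G g g') y = act g (act g' y))"

definition G_module ::
  "('g, 'k::model_space) lie_group_data \<Rightarrow> ('g \<Rightarrow> 'v::model_space \<Rightarrow> 'v) \<Rightarrow> bool" where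
  "G_module G \<rho> \<longleftrightarrow> smooth_left_action G std_atlas \<rho> \<and> (\<forall>g\<in>carrier G. linear (\<rho> g))"

definition tangent_action ::
  "('n, 'd::model_space) atlas \<Rightarrow> ('g \<Rightarrow> 'n \<Rightarrow> 'n) \<Rightarrow> 'g \<Rightarrow> 'n \<times> 'd \<Rightarrow> 'n \<times> 'd" where
  "tangent_action N act g = tangent_map N N (act g)"

definition equivariant_form ::
  "('g, 'k) lie_group_data \<Rightarrow> ('n, 'd::model_space) atlas \<Rightarrow> ('g \<Rightarrow> 'n \<Rightarrow> 'n) \<Rightarrow>
   ('g \<Rightarrow> 'v \<Rightarrow> 'v) \<Rightarrow> ('n \<times> 'd \<Rightarrow> 'v) \<Rightarrow> bool" where
  "equivariant_form G N act \<rho> \<omega> \<longleftrightarrow>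
     (\<forall>g\<in>carrier G. \<forall>y\<in>points N. \<forall>v. \<omega> (tangent_action N act g (y, v)) = \<rho> g (\<omega> (y, v)))"

record ('p, 'q, 'a, 'g) principal_data =
  ptotal :: "('p, 'q) atlas"
  pproj :: "'p \<Rightarrow> 'a"
  pact :: "'p \<Rightarrow> 'g \<Rightarrow> 'p"

definition principal_bundle ::
  "('a, 'e::model_space) atlas \<Rightarrow> ('g, 'k::model_space) lie_group_data \<Rightarrow>
   ('p, 'q::model_space, 'a, 'g) principal_data \<Rightarrow> bool" where
  "principal_bundle M G P \<longleftrightarrow> manifold (ptotal P) \<and> smooth_map (ptotal P) M (pproj P) \<and>
     smooth_map (prod_atlas (ptotal P) (gcharts G)) (ptotal P) (\<lambda>(p, g). pact P p g) \<and>
     (\<forall>p\<in>points (ptotal P). pact P p (one G) = p) \<and>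
     (\<forall>p\<in>points (ptotal P). \<forall>g\<in>carrier G. \<forall>g'\<in>carrier G.
        pact P p (mult G g g') = pact P (pact P p g) g') \<and>
     (\<forall>p\<in>points (ptotal P). \<forall>g\<in>carrier G. pproj P (pact P p g) = pproj P p) \<and>
     (\<forall>x\<in>points M. \<exists>U \<psi>. x \<in> U \<and> trivialization (ptotal P) M (pproj P) (gcharts G) U \<psi> \<and>
        (\<forall>p\<in>points (ptotal P) \<inter> pproj P -` U. \<forall>g\<in>carrier G.
           \<psi> (pact P p g) = (pproj P p, mult G (snd (\<psi> p)) g)))"

definition invariant_field ::
  "('g, 'k) lie_group_data \<Rightarrow> ('p, 'q::model_space, 'a, 'g) principal_data \<Rightarrow> ('p \<Rightarrow> 'q) \<Rightarrow> bool" where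
  "invariant_field G P Xt \<longleftrightarrow> (\<forall>g\<in>carrier G. \<forall>p\<in>points (ptotal P).
     tangent_map (ptotal P) (ptotal P) (\<lambda>p. pact P p g) (p, Xt p) = (pact P p g, Xt (pact P p g)))"

definition lies_over ::
  "('p, 'q::model_space, 'a, 'g) principal_data \<Rightarrow> ('a, 'e::model_space) atlas \<Rightarrow>
   ('p \<Rightarrow> 'q) \<Rightarrow> ('a \<Rightarrow> 'e) \<Rightarrow> bool" where
  "lies_over P M Xt X \<longleftrightarrow> (\<forall>p\<in>points (ptotal P).
     tangent_map (ptotal P) M (pproj P) (p, Xt p) = (pproj P p, X (pproj P p)))"


section \<open>Associated bundles\<close>

text \<open>The class \<open>[p, y]\<close>, i.e. the orbit of \<open>(p, y)\<close>.\<close>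

definition assoc_class ::
  "('g, 'k) lie_group_data \<Rightarrow> ('p, 'q, 'a, 'g) principal_data \<Rightarrow> ('g \<Rightarrow> 'y \<Rightarrow> 'y) \<Rightarrow>
   'p \<Rightarrow> 'y \<Rightarrow> ('p \<times> 'y) set" where
  "assoc_class G P act p y = {(pact P p g, act (m_inv G g) y) | g. g \<in> carrier G}"

definition local_section ::
  "('a, 'e::model_space) atlas \<Rightarrow> ('p, 'q::model_space, 'a, 'g) principal_data \<Rightarrow>
   'a set \<Rightarrow> ('a \<Rightarrow> 'p) \<Rightarrow> bool" where
  "local_section M P U \<sigma> \<longleftrightarrow> openin (mtop M) U \<and>
     smooth_map (restrict_atlas M U) (ptotal P) \<sigma> \<and> (\<forall>x\<in>U. pproj P (\<sigma> x) = x)"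

text \<open>
  The total space of the associated bundle \<open>P \<times>\<^sub>G N\<close>, with the charts \<open>[\<sigma> x, y] \<mapsto> (\<phi> x, \<eta> y)\<close>
  for charts \<open>\<phi>\<close> of \<open>M\<close> and \<open>\<eta>\<close> of \<open>N\<close> and smooth local sections \<open>\<sigma>\<close> of \<open>P\<close>.
\<close>

definition assoc_bundle ::
  "('a, 'e::model_space) atlas \<Rightarrow> ('g, 'k) lie_group_data \<Rightarrow>
   ('p, 'q::model_space, 'a, 'g) principal_data \<Rightarrow> ('n, 'd) atlas \<Rightarrow> ('g \<Rightarrow> 'n \<Rightarrow> 'n) \<Rightarrow>
   (('p \<times> 'n) set, 'e \<times> 'd) atlas" where
  "assoc_bundle M G P N act =
     {(\<Phi> ` D, map_prod \<phi> \<eta> \<circ> inv_into D \<Phi>) | \<Phi> D \<phi> \<eta>.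
        \<exists>U W U' \<sigma>. (U, \<phi>) \<in> M \<and> (W, \<eta>) \<in> N \<and> local_section M P U' \<sigma> \<and>
          D = (U \<inter> U') \<times> W \<and> \<Phi> = (\<lambda>(x, y). assoc_class G P act (\<sigma> x) y)}"

definition bundle_map_over_id ::
  "('b, 'f::model_space) atlas \<Rightarrow> ('b \<Rightarrow> 'a) \<Rightarrow> ('a, 'e::model_space) atlas \<Rightarrow>
   ('g, 'k) lie_group_data \<Rightarrow> ('p, 'q::model_space, 'a, 'g) principal_data \<Rightarrow>
   ('n, 'd::model_space) atlas \<Rightarrow> ('g \<Rightarrow> 'n \<Rightarrow> 'n) \<Rightarrow> ('b \<Rightarrow> ('p \<times> 'n) set) \<Rightarrow> bool" where
  "bundle_map_over_id E \<pi> M G P N act h \<longleftrightarrow> smooth_map E (assoc_bundle M G P N act) h \<and>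
     (\<forall>y\<in>points E. \<forall>(p, n)\<in>h y. pproj P p = \<pi> y)"

text \<open>\<open>p\<setminus>p'\<close> in \<open>G\<close> and \<open>p\<setminus>z\<close> in \<open>N\<close>.\<close>

definition pdiv :: "('g, 'k) lie_group_data \<Rightarrow> ('p, 'q, 'a, 'g) principal_data \<Rightarrow> 'p \<Rightarrow> 'p \<Rightarrow> 'g" where
  "pdiv G P p p' = (THE g. g \<in> carrier G \<and> pact P p g = p')"

definition adiv ::
  "('g, 'k) lie_group_data \<Rightarrow> ('p, 'q, 'a, 'g) principal_data \<Rightarrow> ('n, 'd) atlas \<Rightarrow>
   ('g \<Rightarrow> 'n \<Rightarrow> 'n) \<Rightarrow> 'p \<Rightarrow> ('p \<times> 'n) set \<Rightarrow> 'n" where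
  "adiv G P N act p z = (THE y. y \<in> points N \<and> z = assoc_class G P act p y)"


section \<open>The Darboux-Lie derivative\<close>

text \<open>
  The flow \<open>[p, y] \<mapsto> [\<Phi>\<^sup>t p, y]\<close> on \<open>P \<times>\<^sub>G N\<close> acts on a class representative by
  representative; since \<open>\<Phi>\<^sup>t\<close> is \<open>G\<close>-equivariant, the image of a class is again a class.
\<close>

definition assoc_flow ::
  "('p, 'q::model_space, 'a, 'g) principal_data \<Rightarrow> ('p \<Rightarrow> 'q) \<Rightarrow> real \<Rightarrow>
   ('p \<times> 'n) set \<Rightarrow> ('p \<times> 'n) set" where
  "assoc_flow P Xt t z = (\<lambda>(p, y). (flow (ptotal P) Xt t p, y)) ` z"

definition assoc_field ::
  "('a, 'e::model_space) atlas \<Rightarrow> ('g, 'k) lie_group_data \<Rightarrow>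
   ('p, 'q::model_space, 'a, 'g) principal_data \<Rightarrow> ('n, 'd::model_space) atlas \<Rightarrow>
   ('g \<Rightarrow> 'n \<Rightarrow> 'n) \<Rightarrow> ('p \<Rightarrow> 'q) \<Rightarrow> ('p \<times> 'n) set \<Rightarrow> 'e \<times> 'd" where
  "assoc_field M G P N act Xt = flow_generator (assoc_bundle M G P N act) (assoc_flow P Xt)"

definition lie_tilde ::
  "('b, 'f::model_space) atlas \<Rightarrow> ('b \<Rightarrow> 'f) \<Rightarrow> ('a, 'e::model_space) atlas \<Rightarrow>
   ('g, 'k) lie_group_data \<Rightarrow> ('p, 'q::model_space, 'a, 'g) principal_data \<Rightarrow>
   ('n, 'd::model_space) atlas \<Rightarrow> ('g \<Rightarrow> 'n \<Rightarrow> 'n) \<Rightarrow> ('p \<Rightarrow> 'q) \<Rightarrow>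
   ('b \<Rightarrow> ('p \<times> 'n) set) \<Rightarrow> 'b \<Rightarrow> ('p \<times> 'n) set \<times> ('e \<times> 'd)" where
  "lie_tilde E Y M G P N act Xt h y =
     (h y, snd (tangent_map E (assoc_bundle M G P N act) h (y, Y y))
           - assoc_field M G P N act Xt (h y))"

text \<open>
  \<open>\<nu>\<close> sends the vertical vector \<open>\<xi>\<close> represented by \<open>t \<mapsto> [\<gamma>\<^sub>P t, \<gamma>\<^sub>N t]\<close>, where \<open>\<gamma>\<^sub>P\<close> is vertical,
  to \<open>[\<gamma>\<^sub>P 0, d/dt|\<^sub>0 (\<gamma>\<^sub>P 0 \<setminus> \<gamma>\<^sub>P t) \<gamma>\<^sub>N t]\<close>.
\<close>

definition nu ::
  "('a, 'e::model_space) atlas \<Rightarrow> ('g, 'k) lie_group_data \<Rightarrow>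
   ('p, 'q::model_space, 'a, 'g) principal_data \<Rightarrow> ('n, 'd::model_space) atlas \<Rightarrow>
   ('g \<Rightarrow> 'n \<Rightarrow> 'n) \<Rightarrow> ('p \<times> 'n) set \<times> ('e \<times> 'd) \<Rightarrow> ('p \<times> ('n \<times> 'd)) set" where
  "nu M G P N act \<xi> = (THE c. \<exists>\<epsilon>>0. \<exists>\<gamma>P \<gamma>N.
     smooth_map (interval_atlas \<epsilon>) (ptotal P) \<gamma>P \<and> smooth_map (interval_atlas \<epsilon>) N \<gamma>N \<and>
     (\<forall>t\<in>{-\<epsilon><..<\<epsilon>}. pproj P (\<gamma>P t) = pproj P (\<gamma>P 0)) \<and>
     velocity (assoc_bundle M G P N act) (\<lambda>t. assoc_class G P act (\<gamma>P t) (\<gamma>N t)) 0 = \<xi> \<and>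
     c = assoc_class G P (tangent_action N act) (\<gamma>P 0)
           (velocity N (\<lambda>t. act (pdiv G P (\<gamma>P 0) (\<gamma>P t)) (\<gamma>N t)) 0))"

text \<open>\<open>id \<times>\<^sub>G \<omega>\<close>; by equivariance the image of the orbit \<open>[p, Y]\<close> is the orbit \<open>[p, \<omega> Y]\<close>.\<close>

definition id_times_form :: "('n \<times> 'd \<Rightarrow> 'v) \<Rightarrow> ('p \<times> ('n \<times> 'd)) set \<Rightarrow> ('p \<times> 'v) set" where
  "id_times_form \<omega> c = (\<lambda>(p, Y). (p, \<omega> Y)) ` c"

definition darboux_lie ::
  "('b, 'f::model_space) atlas \<Rightarrow> ('b \<Rightarrow> 'f) \<Rightarrow> ('a, 'e::model_space) atlas \<Rightarrow>
   ('g, 'k) lie_group_data \<Rightarrow> ('p, 'q::model_space, 'a, 'g) principal_data \<Rightarrow>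
   ('n, 'd::model_space) atlas \<Rightarrow> ('g \<Rightarrow> 'n \<Rightarrow> 'n) \<Rightarrow> ('n \<times> 'd \<Rightarrow> 'v) \<Rightarrow> ('p \<Rightarrow> 'q) \<Rightarrow>
   ('b \<Rightarrow> ('p \<times> 'n) set) \<Rightarrow> 'b \<Rightarrow> ('p \<times> 'v) set" where
  "darboux_lie E Y M G P N act \<omega> Xt h =
     id_times_form \<omega> \<circ> nu M G P N act \<circ> lie_tilde E Y M G P N act Xt h"

end

theory Submission
  imports Defs
begin

text \<open>
  Near \<open>x\<close> choose a section \<open>\<sigma>\<close> of \<open>P\<close>, write the flow line of \<open>p\<close> as \<open>\<sigma>(x\<^sub>t) k\<^sub>t\<close> and the curve
  \<open>h(\<Phi>\<^sup>t y)\<close>, which lies over the same \<open>x\<^sub>t\<close>, as \<open>[\<sigma>(x\<^sub>t), m\<^sub>t]\<close>. In the chart of \<open>P \<times>\<^sub>G N\<close> given by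
  \<open>\<sigma>\<close>, the vertical vector to be computed is \<open>d/dt m\<^sub>t - d/dt (k\<^sub>t n\<^sub>0)\<close> with \<open>n\<^sub>0 = k\<^sub>0\<^bsup>-1\<^esup> m\<^sub>0\<close>, whereas the
  right-hand side differentiates \<open>r\<^sub>t = k\<^sub>t\<^bsup>-1\<^esup> m\<^sub>t\<close>. Put \<open>a\<^sub>t = k\<^sub>t k\<^sub>0\<^bsup>-1\<^esup>\<close>. Then \<open>m\<^sub>t = a\<^sub>t (k\<^sub>0 r\<^sub>t)\<close> with
  \<open>a\<^sub>0 = 1\<close>, and the product rule for the action gives \<open>d/dt m\<^sub>t = d/dt (a\<^sub>t m\<^sub>0) + d/dt (k\<^sub>0 r\<^sub>t)\<close>, where
  \<open>a\<^sub>t m\<^sub>0 = k\<^sub>t n\<^sub>0\<close>. Equivariance of \<open>\<omega>\<close> removes the factor \<open>k\<^sub>0\<close>. That flow lines of \<open>P\<close> and \<open>F(M)\<close>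
  exist, are unique, project to \<open>M\<close> and commute with \<open>G\<close> rests on Picard-Lindelof.
\<close>

section \<open>Ordinary differential equations\<close>

text \<open>The encoding shapes the proof. \<open>flow\<close>, \<open>pdiv\<close>,
  \<open>adiv\<close> and \<open>nu\<close> are definite descriptions, so each can be evaluated only
  after existence and uniqueness are known; for \<open>nu\<close> this means independence of the
  representing curves. A tangent vector is a coordinate vector in the chart that
  \<open>chart_at\<close> picks, so the section \<sigma> is not free: it is the one from which the
  chart picked at h(y) is built. The charts of the associated bundle are never shown to form a
  manifold; every computation there stays in that single chart. The final comparison concerns first
  derivatives at time 0, so group operations, actions and sections are used through the
  differentiable curves that they send to differentiable curves. Two places ask for more: vector
  fields must be locally Lipschitz in charts, and \<open>nu\<close> demands representing curves that
  are smooth on an interval. Naturality of F enters through one fact, that flow lines of the lift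
  project to flow lines of X.\<close>

lemma vector_derivative_norm_bound:
  fixes f :: "real \<Rightarrow> 'a::real_normed_vector"
  assumes "convex S"
    and "\<And>t. t \<in> S \<Longrightarrow> (f has_vector_derivative f' t) (at t within S)"
    and "\<And>t. t \<in> S \<Longrightarrow> norm (f' t) \<le> B"
    and "s \<in> S" "t \<in> S"
  shows "norm (f s - f t) \<le> B * \<bar>s - t\<bar>"
proof -
  have "norm (f s - f t) \<le> B * norm (s - t)"
  proof (rule differentiable_bound[OF assms(1) _ _ assms(4,5)])
    fix u assume "u \<in> S"
    then show "(f has_derivative (\<lambda>h. h *\<^sub>R f' u)) (at u within S)"
      using assms(2) by (simp add: has_vector_derivative_def)
    show "onorm (\<lambda>h. h *\<^sub>R f' u) \<le> B"
      using assms(3)[OF \<open>u \<in> S\<close>] onorm_scaleR_left[of "\<lambda>h. h" "f' u"]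
      by (simp add: bounded_linear_ident onorm_id[unfolded id_def])
  qed
  then show ?thesis by simp
qed

lemma Ck_on_imp_continuous_on: "Ck_on k f S \<Longrightarrow> continuous_on S f"
  by (cases k) (auto simp: continuous_at_imp_continuous_on differentiable_imp_continuous_within)

text \<open>\<open>Ck_on\<close> controls the derivative only in each fixed direction, not in
  operator norm. A finite orthonormal basis turns these directional bounds into a bound on the
  operator norm, and a ball is convex, so the mean value inequality applies.\<close>

lemma C1_locally_lipschitz:
  fixes f :: "'a::model_space \<Rightarrow> 'b::real_normed_vector"
  assumes "open S" "Ck_on (Suc 0) f S" "x0 \<in> S"
  obtains r L where "r > 0" "cball x0 r \<subseteq> S" "L \<ge> 0"
    "\<And>x y. x \<in> cball x0 r \<Longrightarrow> y \<in> cball x0 r \<Longrightarrow> norm (f x - f y) \<le> L * norm (x - y)"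
proof -
  obtain B :: "'a set" where B: "finite B"
    "\<forall>b\<in>B. \<forall>b'\<in>B. inner b b' = (if b = b' then 1 else 0)"
    "\<And>x. x = (\<Sum>b\<in>B. inner x b *\<^sub>R b)"
    using finite_orthonormal_basis[where 'a = 'a] by blast
  define D where "D = (\<lambda>x b. frechet_derivative f (at x) b)"
  have D: "(f has_derivative D x) (at x)" if "x \<in> S" for x
    using assms(2) that unfolding D_def by (simp add: frechet_derivative_works[symmetric])
  have cont: "continuous_on S (\<lambda>x. D x b)" for b
    using assms(2) unfolding D_def by simp
  \<comment> \<open>\<open>g\<close> dominates the operator norm of \<open>D x\<close>, because each
    coordinate of a vector is at most its norm. It is continuous, hence below
    \<open>g x0 + 1\<close> near \<open>x0\<close>.\<close>
  define g where "g = (\<lambda>x. \<Sum>b\<in>B. norm (D x b))"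
  have "continuous_on S g"
    unfolding g_def by (intro continuous_intros cont)
  then have "isCont g x0"
    using assms(1,3) continuous_on_eq_continuous_at by blast
  then have "\<forall>\<^sub>F x in nhds x0. g x < g x0 + 1"
    by (intro order_tendstoD(2)[of _ "g x0"]) (auto simp: isCont_def tendsto_at_iff_tendsto_nhds)
  then have "\<forall>\<^sub>F x in nhds x0. g x < g x0 + 1 \<and> x \<in> S"
    using assms(1,3) eventually_nhds_in_open eventually_conj by blast
  then obtain d where d: "d > 0" "\<And>x. dist x x0 < d \<Longrightarrow> g x < g x0 + 1 \<and> x \<in> S"
    unfolding eventually_nhds_metric by blast
  define L where "L = g x0 + 1"
  have L: "L \<ge> 0" unfolding L_def g_def by (simp add: add_nonneg_nonneg sum_nonneg)
  have sub: "cball x0 (d/2) \<subseteq> S" using d by (force simp: dist_commute)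
  have on: "onorm (D x) \<le> L" if "x \<in> cball x0 (d/2)" for x
  proof (rule onorm_bound[OF L])
    fix v
    have xS: "x \<in> S" using sub that by auto
    have lin: "linear (D x)" using D[OF xS] by (simp add: has_derivative_linear)
    have nb: "\<bar>inner v b\<bar> \<le> norm v" if "b \<in> B" for b
    proof -
      have "norm b = 1" using B(2) that by (simp add: norm_eq_1)
      then show ?thesis using Cauchy_Schwarz_ineq2[of v b] by simp
    qed
    have "D x v = (\<Sum>b\<in>B. inner v b *\<^sub>R D x b)"
      by (subst B(3)[of v]) (simp add: linear_sum[OF lin] linear_cmul[OF lin])
    also have "norm \<dots> \<le> (\<Sum>b\<in>B. norm v * norm (D x b))"
      by (rule sum_norm_le) (simp add: mult_right_mono nb)
    also have "\<dots> = g x * norm v" by (simp add: g_def sum_distrib_left mult.commute)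
    also have "\<dots> \<le> L * norm v"
      using d(2)[of x] that d(1) by (intro mult_right_mono) (auto simp: L_def dist_commute)
    finally show "norm (D x v) \<le> L * norm v" .
  qed
  show thesis
  proof (rule that[of "d/2" L])
    show "norm (f x - f y) \<le> L * norm (x - y)"
      if "x \<in> cball x0 (d/2)" "y \<in> cball x0 (d/2)" for x y
      using differentiable_bound[OF convex_cball _ on that(1,2)] D sub
      by (meson has_derivative_at_withinI subset_iff)
  qed (use d(1) L sub in auto)
qed

text \<open>On a short interval the mean value inequality shows that the maximum of
  \<open>norm (u t - v t)\<close> is at most half of itself, so it vanishes.\<close>

lemma ode_local_uniqueness:
  fixes f :: "'a::model_space \<Rightarrow> 'a"
  assumes "open S" "Ck_on (Suc 0) f S" "u t0 \<in> S" "u t0 = v t0"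
    and u: "\<forall>\<^sub>F t in nhds t0. (u has_vector_derivative f (u t)) (at t)"
    and v: "\<forall>\<^sub>F t in nhds t0. (v has_vector_derivative f (v t)) (at t)"
  shows "\<forall>\<^sub>F t in nhds t0. u t = v t"
proof -
  obtain r L where r: "r > 0" "L \<ge> 0"
    "\<And>x y. x \<in> cball (u t0) r \<Longrightarrow> y \<in> cball (u t0) r \<Longrightarrow> norm (f x - f y) \<le> L * norm (x - y)"
    using C1_locally_lipschitz[OF assms(1-3)] by metis
  have ct: "\<forall>\<^sub>F t in nhds t0. w t \<in> ball (u t0) r"
    if "\<forall>\<^sub>F t in nhds t0. (w has_vector_derivative f (w t)) (at t)" "w t0 = u t0" for w
  proof -
    have "isCont w t0"
      using eventually_nhds_x_imp_x[OF that(1)] has_vector_derivative_continuous by blast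
    then have "(w \<longlongrightarrow> u t0) (nhds t0)"
      using that(2) by (metis isCont_def tendsto_at_iff_tendsto_nhds)
    then show ?thesis
      by (rule topological_tendstoD) (use r(1) in auto)
  qed
  have "\<forall>\<^sub>F t in nhds t0. ((u has_vector_derivative f (u t)) (at t) \<and> u t \<in> ball (u t0) r) \<and>
      (v has_vector_derivative f (v t)) (at t) \<and> v t \<in> ball (u t0) r"
    using u v ct[OF u] ct[OF v] assms(4) by (simp add: eventually_conj_iff)
  then obtain d where d: "d > 0" "\<And>t. dist t t0 < d \<Longrightarrow>
      ((u has_vector_derivative f (u t)) (at t) \<and> u t \<in> ball (u t0) r) \<and>
      (v has_vector_derivative f (v t)) (at t) \<and> v t \<in> ball (u t0) r"
    unfolding eventually_nhds_metric by blast
  \<comment> \<open>The term \<open>d/2\<close> keeps the closed interval \<open>I\<close> strictly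
    inside the \<open>d\<close>-neighbourhood; the other term gives \<open>L * e \<le> 1/2\<close>,
    with \<open>L + 1\<close> instead of \<open>L\<close> to allow \<open>L = 0\<close>.\<close>
  define e where "e = min (d/2) (1 / (2 * (L + 1)))"
  have e: "e > 0" "e < d" "L * e \<le> 1/2"
  proof -
    show "e > 0" "e < d" using d(1) r(2) by (auto simp: e_def)
    have "L * e \<le> L * (1 / (2 * (L + 1)))" using r(2) by (intro mult_left_mono) (auto simp: e_def)
    also have "\<dots> \<le> 1/2" using r(2) by (simp add: field_simps)
    finally show "L * e \<le> 1/2" .
  qed
  define I where "I = {t0 - e..t0 + e}"
  have I: "dist t t0 < d" if "t \<in> I" for t using that e by (auto simp: I_def dist_real_def)
  define w where "w = (\<lambda>t. u t - v t)"
  have w': "(w has_vector_derivative f (u t) - f (v t)) (at t)" if "t \<in> I" for t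
    unfolding w_def using d(2)[OF I[OF that]] by (auto intro: has_vector_derivative_diff)
  have "continuous_on I (\<lambda>t. norm (w t))"
    using w' by (intro continuous_intros continuous_at_imp_continuous_on)
      (blast intro: has_vector_derivative_continuous)
  then obtain s where s: "s \<in> I" "\<And>t. t \<in> I \<Longrightarrow> norm (w t) \<le> norm (w s)"
    using continuous_attains_sup[of I "\<lambda>t. norm (w t)"] e(1) by (force simp: I_def)
  have "norm (w s - w t0) \<le> (L * norm (w s)) * \<bar>s - t0\<bar>"
  proof (rule vector_derivative_norm_bound[of I])
    show "(w has_vector_derivative f (u t) - f (v t)) (at t within I)" if "t \<in> I" for t
      using w'[OF that] by (rule has_vector_derivative_at_within)
    show "norm (f (u t) - f (v t)) \<le> L * norm (w s)" if "t \<in> I" for t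
    proof -
      have "norm (f (u t) - f (v t)) \<le> L * norm (w t)"
        unfolding w_def using d(2)[OF I[OF that]] by (intro r(3)) auto
      also have "\<dots> \<le> L * norm (w s)" using s(2)[OF that] r(2) by (intro mult_left_mono) auto
      finally show ?thesis .
    qed
  qed (use s e(1) in \<open>auto simp: I_def\<close>)
  also have "\<dots> \<le> (L * norm (w s)) * e"
    using s(1) r(2) by (intro mult_left_mono) (auto simp: I_def)
  also have "\<dots> \<le> 1/2 * norm (w s)" using mult_right_mono[OF e(3), of "norm (w s)"]
    by (simp add: mult_ac)
  finally have "norm (w s) \<le> 0" using assms(4) by (simp add: w_def)
  then have eqI: "u t = v t" if "t \<in> I" for t using s(2)[OF that] by (simp add: w_def)
  have "u t = v t" if "dist t t0 < e" for t
    by (rule eqI) (use that in \<open>simp add: I_def dist_real_def abs_less_iff\<close>)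
  then show ?thesis
    unfolding eventually_nhds_metric using e(1)
    by (intro exI[of _ e]) simp
qed

text \<open>Picard iteration as a contraction on bounded continuous functions from the whole real
  line into \<open>cball x0 r\<close>. The limit solves the equation on the open interval, where
  derivatives within \<open>I\<close> are genuine derivatives.\<close>

lemma ode_local_existence:
  fixes f :: "'a::model_space \<Rightarrow> 'a"
  assumes "open S" "Ck_on (Suc 0) f S" "x0 \<in> S"
  obtains d u where "d > 0" "u 0 = x0"
    "\<And>t. \<bar>t\<bar> < d \<Longrightarrow> u t \<in> S \<and> (u has_vector_derivative f (u t)) (at t)"
proof -
  obtain r L where r: "r > 0" "cball x0 r \<subseteq> S" "L \<ge> 0"
    "\<And>x y. x \<in> cball x0 r \<Longrightarrow> y \<in> cball x0 r \<Longrightarrow> norm (f x - f y) \<le> L * norm (x - y)"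
    using C1_locally_lipschitz[OF assms(1-3)] by metis
  \<comment> \<open>A bound for \<open>f\<close> on the ball by the Lipschitz estimate; the summand
    1 makes it positive, so that \<open>r / K\<close> makes sense.\<close>
  define K where "K = norm (f x0) + L * r + 1"
  have K: "K > 0" using r(1,3) by (simp add: K_def add_nonneg_pos)
  have fK: "norm (f x) \<le> K" if "x \<in> cball x0 r" for x
  proof -
    have "norm (f x - f x0) \<le> L * norm (x - x0)" using r that by auto
    also have "\<dots> \<le> L * r" using that r(3)
      by (intro mult_left_mono) (auto simp: dist_norm norm_minus_commute)
    finally show ?thesis using norm_triangle_ineq2[of "f x" "f x0"] by (simp add: K_def)
  qed
  \<comment> \<open>The first term keeps the iterates in the ball, as a solution moves at speed at
    most \<open>K\<close>; the second makes the iteration contract by the factor 1/2.\<close>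
  define d where "d = min (r / K) (1 / (2 * (L + 1)))"
  have d: "d > 0" "K * d \<le> r" "L * d \<le> 1/2"
  proof -
    show "d > 0" using r K by (auto simp: d_def)
    have "K * d \<le> K * (r / K)" using K by (intro mult_left_mono) (auto simp: d_def)
    then show "K * d \<le> r" using K by simp
    have "L * d \<le> L * (1 / (2 * (L + 1)))" using r(3) by (intro mult_left_mono) (auto simp: d_def)
    also have "\<dots> \<le> 1/2" using r(3) by (simp add: field_simps)
    finally show "L * d \<le> 1/2" .
  qed
  define I where "I = {-d..d}"
  \<comment> \<open>Clamping time to \<open>I\<close> extends the iterates constantly to all of the
    real line, so that they live in the complete space of bounded continuous functions.\<close>
  define c where "c = (\<lambda>t. max (-d) (min d t))"
  have c: "c t \<in> I" "\<bar>c t\<bar> \<le> d" for t using d(1) by (auto simp: c_def I_def)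
  have c0: "c 0 = 0" using d(1) by (auto simp: c_def)
  have cI: "c t = t" if "t \<in> I" for t using that by (auto simp: c_def I_def)
  have cc: "continuous_on UNIV c" unfolding c_def by (intro continuous_intros)
  have fc: "continuous_on (cball x0 r) f"
    using Ck_on_imp_continuous_on[OF assms(2)] r(2) by (rule continuous_on_subset)
  \<comment> \<open>The integral starts at \<open>-d\<close>, so that one formula serves negative
    and positive times; subtracting \<open>G g 0\<close> moves the base point to 0.\<close>
  define G where "G = (\<lambda>g :: real \<Rightarrow>\<^sub>C 'a. \<lambda>t. integral {-d..t} (\<lambda>s. f (g s)))"
  define T0 where "T0 = (\<lambda>g :: real \<Rightarrow>\<^sub>C 'a. \<lambda>t. x0 + (G g (c t) - G g 0))"
  define X where "X = PiC UNIV (\<lambda>_::real. cball x0 r)"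
  have X: "g t \<in> cball x0 r" if "g \<in> X" for g t
    using that by (auto simp: X_def mem_PiC_iff)
  have G': "(G g has_vector_derivative f (g t)) (at t within I)" if "g \<in> X" "t \<in> I" for g t
    unfolding G_def I_def
  proof (rule integral_has_vector_derivative)
    show "continuous_on {-d..d} (\<lambda>s. f (g s))"
      by (rule continuous_on_compose2[OF fc]) (use X[OF that(1)] in auto)
  qed (use that in \<open>auto simp: I_def\<close>)
  have T0: "T0 g t \<in> cball x0 r" if "g \<in> X" for g t
  proof -
    have "norm (G g (c t) - G g 0) \<le> K * \<bar>c t - 0\<bar>"
      by (rule vector_derivative_norm_bound[of I])
        (use G' fK X that c(1) d(1) in \<open>auto simp: I_def\<close>)
    also have "\<dots> \<le> K * d" using c(2) K by (intro mult_left_mono) auto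
    also have "\<dots> \<le> r" by (rule d)
    finally show ?thesis by (simp add: T0_def dist_norm norm_minus_commute)
  qed
  have T0b: "T0 g \<in> bcontfun" if "g \<in> X" for g
    unfolding bcontfun_def
  proof (intro CollectI conjI)
    have "continuous_on I (G g)"
      using G'[OF that] has_vector_derivative_continuous continuous_on_eq_continuous_within by blast
    then have "continuous_on UNIV (\<lambda>t. G g (c t))"
      using continuous_on_compose2[OF _ cc] c by blast
    then show "continuous_on UNIV (T0 g)" unfolding T0_def by (intro continuous_intros)
    show "bounded (range (T0 g))"
      by (rule bounded_subset[OF bounded_cball]) (use T0[OF that] in blast)
  qed
  define T where "T = (\<lambda>g. Bcontfun (T0 g))"
  have T: "apply_bcontfun (T g) = T0 g" if "g \<in> X" for g
    unfolding T_def using T0b[OF that] by (rule Bcontfun_inverse)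
  have "\<exists>!g\<in>X. T g = g"
  proof (rule Banach_fix[where c="1/2"])
    show "complete X" unfolding complete_eq_closed X_def by (intro closed_PiC) auto
    have "const_bcontfun x0 \<in> X" using r(1) by (auto simp: X_def mem_PiC_iff const_bcontfun.rep_eq)
    then show "X \<noteq> {}" by blast
    show "T ` X \<subseteq> X" using T T0 by (auto simp: X_def mem_PiC_iff)
    fix g h assume "g \<in> X" "h \<in> X"
    note gh = this
    show "dist (T g) (T h) \<le> 1/2 * dist g h"
    proof (rule dist_bound)
      fix t
      have "norm ((G g (c t) - G h (c t)) - (G g 0 - G h 0)) \<le> (L * dist g h) * \<bar>c t - 0\<bar>"
      proof (rule vector_derivative_norm_bound[of I])
        show "((\<lambda>t. G g t - G h t) has_vector_derivative f (g t) - f (h t)) (at t within I)"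
          if "t \<in> I" for t
          using G' gh that by (intro has_vector_derivative_diff) auto
        show "norm (f (g t) - f (h t)) \<le> L * dist g h" for t
        proof -
          have "norm (f (g t) - f (h t)) \<le> L * norm (g t - h t)" using X gh by (intro r(4)) auto
          also have "\<dots> \<le> L * dist g h"
            using dist_bounded[of g t h] r(3) by (intro mult_left_mono) (auto simp: dist_norm)
          finally show ?thesis .
        qed
      qed (use c(1) d(1) in \<open>auto simp: I_def\<close>)
      also have "\<dots> \<le> (L * dist g h) * d" using c(2) r(3) by (intro mult_left_mono) auto
      also have "\<dots> \<le> 1/2 * dist g h"
        using mult_right_mono[OF d(3), of "dist g h"] by (simp add: mult_ac)
      finally show "dist (T g t) (T h t) \<le> 1/2 * dist g h"
        using gh by (simp add: T T0_def dist_norm algebra_simps)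
    qed
  qed auto
  then obtain g where g: "g \<in> X" "T g = g" by blast
  have gT: "apply_bcontfun g = T0 g" using T[OF g(1)] g(2) by argo
  show thesis
  proof (rule that[of d "apply_bcontfun g"])
    show "g 0 = x0" by (subst gT) (simp add: T0_def c0)
    fix t assume t: "\<bar>t\<bar> < d"
    have "(G g has_vector_derivative f (g t)) (at t within {-d<..<d})"
      by (rule has_vector_derivative_within_subset[OF G'[OF g(1)]])
        (use t in \<open>auto simp: I_def abs_less_iff\<close>)
    then have "(G g has_vector_derivative f (g t)) (at t)"
      using t by (subst (asm) has_vector_derivative_within_open) auto
    then have D: "((\<lambda>t. x0 + (G g t - G g 0)) has_vector_derivative f (g t)) (at t)"
      by (auto intro!: derivative_eq_intros)
    have "(apply_bcontfun g has_vector_derivative f (g t)) (at t)"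
      by (rule has_vector_derivative_transform_within_open[OF D, of "{-d<..<d}"])
        (use t in \<open>auto simp: gT T0_def cI I_def\<close>)
    moreover have "g t \<in> S" using X[OF g(1)] r(2) by blast
    ultimately show "g t \<in> S \<and> (apply_bcontfun g has_vector_derivative f (g t)) (at t)" by blast
  qed (rule d)
qed

section \<open>Derivatives in charts\<close>

lemma topspace_mtop: "topspace (mtop A) = points A"
proof (rule Set.set_eqI)
  fix x
  have "x \<in> topspace (mtop A) \<longleftrightarrow> (\<exists>U \<phi> V. (U, \<phi>) \<in> A \<and> open V \<and> x \<in> U \<and> \<phi> x \<in> V)"
    unfolding mtop_def topology_generated_by_topspace by blast
  also have "\<dots> \<longleftrightarrow> (\<exists>U \<phi>. (U, \<phi>) \<in> A \<and> x \<in> U)"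
    using open_UNIV by blast
  also have "\<dots> \<longleftrightarrow> x \<in> points A" unfolding points_def by force
  finally show "x \<in> topspace (mtop A) \<longleftrightarrow> x \<in> points A" .
qed

lemma openin_mtop_chart:
  "(U, \<phi>) \<in> A \<Longrightarrow> open V \<Longrightarrow> openin (mtop A) (U \<inter> \<phi> -` V)"
  unfolding mtop_def by (rule topology_generated_by_Basis) blast

lemma openin_mtop_chart_dom: "c \<in> A \<Longrightarrow> openin (mtop A) (fst c)"
  using openin_mtop_chart[of "fst c" "snd c" A UNIV] by simp

text \<open>The empty set needs no case of its own: it is the union of the empty family.\<close>

lemma openin_mtop_induct [consumes 1, case_names Int Union chart]:
  assumes "openin (mtop A) S"
    and "\<And>S T. Q S \<Longrightarrow> Q T \<Longrightarrow> Q (S \<inter> T)"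
    and "\<And>\<S>. (\<And>S. S \<in> \<S> \<Longrightarrow> Q S) \<Longrightarrow> Q (\<Union>\<S>)"
    and "\<And>U \<phi> V. (U, \<phi>) \<in> A \<Longrightarrow> open V \<Longrightarrow> Q (U \<inter> \<phi> -` V)"
  shows "Q S"
proof -
  have "generate_topology_on {U \<inter> \<phi> -` V | U \<phi> V. (U, \<phi>) \<in> A \<and> open V} S"
    using assms(1) by (simp add: mtop_def openin_topology_generated_by_iff)
  then show ?thesis
  proof induction
    case Empty
    show ?case using assms(3)[of "{}"] by simp
  next
    case (Basis S)
    then show ?case using assms(4) by blast
  qed (use assms(2,3) in blast)+
qed

text \<open>
  All that the calculus of derivatives in charts needs of an atlas. Products and restrictions of
  manifolds enjoy it for simple reasons, without any discussion of smoothness.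
\<close>

definition topological_atlas :: "('a, 'e::model_space) atlas \<Rightarrow> bool" where
  "topological_atlas A \<longleftrightarrow>
     (\<forall>(U, \<phi>)\<in>A. inj_on \<phi> U \<and> (\<forall>S. openin (mtop A) S \<longrightarrow> open (\<phi> ` (U \<inter> S))))"

lemma topological_atlasD:
  assumes "topological_atlas A" "c \<in> A"
  shows "inj_on (snd c) (fst c)" "openin (mtop A) S \<Longrightarrow> open (snd c ` (fst c \<inter> S))"
    "open (snd c ` fst c)"
proof -
  show "inj_on (snd c) (fst c)" and *: "openin (mtop A) S \<Longrightarrow> open (snd c ` (fst c \<inter> S))" for S
    using assms by (cases c; fastforce simp: topological_atlas_def)+
  show "open (snd c ` fst c)" using *[OF openin_mtop_chart_dom[OF assms(2)]] by simp
qed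

lemma Ck_on_subset: "Ck_on k f S \<Longrightarrow> T \<subseteq> S \<Longrightarrow> Ck_on k f T"
  by (induction k arbitrary: f) (auto intro: continuous_on_subset)

lemma smooth_on_imp_continuous_on: "smooth_on f S \<Longrightarrow> continuous_on S f"
  unfolding smooth_on_def using Ck_on_imp_continuous_on by blast

lemma smooth_on_imp_differentiable: "smooth_on f S \<Longrightarrow> x \<in> S \<Longrightarrow> f differentiable (at x)"
  unfolding smooth_on_def by (metis Ck_on.simps(2))

lemma manifold_transition:
  assumes "manifold A" "(U, \<phi>) \<in> A" "(W, \<psi>) \<in> A"
  shows "open (\<phi> ` (U \<inter> W))" "smooth_on (\<psi> \<circ> inv_into U \<phi>) (\<phi> ` (U \<inter> W))"
  using assms
  unfolding manifold_def split_def Ball_def split_paired_All fst_conv snd_conv by blast+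

lemma isCont_tendsto_nhds: "isCont f x \<Longrightarrow> (f \<longlongrightarrow> f x) (nhds x)"
  by (simp add: isCont_def tendsto_at_iff_tendsto_nhds)

text \<open>Induction over the generated topology. Injectivity of a chart lets images commute with
  intersections, and for a generator the image is a preimage under a continuous transition map with
  open domain.\<close>

lemma manifold_topological_atlas:
  assumes "manifold A"
  shows "topological_atlas A"
  unfolding topological_atlas_def
proof (intro ballI, clarify, intro conjI allI impI)
  fix U \<phi> assume c: "(U, \<phi>) \<in> A"
  show inj: "inj_on \<phi> U" using assms c by (auto simp: manifold_def)
  fix S assume "openin (mtop A) S"
  then show "open (\<phi> ` (U \<inter> S))"
  proof (induction rule: openin_mtop_induct)
    case (Int S T)
    have "\<phi> ` (U \<inter> (S \<inter> T)) = \<phi> ` (U \<inter> S) \<inter> \<phi> ` (U \<inter> T)"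
      using inj by (auto dest: inj_onD)
    then show ?case using Int by auto
  next
    case (Union \<S>)
    have "\<phi> ` (U \<inter> \<Union>\<S>) = (\<Union>S\<in>\<S>. \<phi> ` (U \<inter> S))" by auto
    then show ?case using Union by auto
  next
    case (chart W \<psi> V)
    have "open (\<phi> ` (U \<inter> W))" "continuous_on (\<phi> ` (U \<inter> W)) (\<psi> \<circ> inv_into U \<phi>)"
      using manifold_transition[OF assms c chart(1)] smooth_on_imp_continuous_on by blast+
    then have "open ((\<psi> \<circ> inv_into U \<phi>) -` V \<inter> \<phi> ` (U \<inter> W))"
      using chart(2) continuous_on_open_vimage by blast
    also have "(\<psi> \<circ> inv_into U \<phi>) -` V \<inter> \<phi> ` (U \<inter> W) = \<phi> ` (U \<inter> (W \<inter> \<psi> -` V))"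
      using inj by (auto simp: image_iff)
    finally show ?case .
  qed
qed

text \<open>As \<open>S\<close> is open, a set open for the restricted atlas is also open for
  \<open>A\<close>, so the openness of its chart images is inherited.\<close>

lemma restrict_topological_atlas:
  assumes "topological_atlas A" "openin (mtop A) S"
  shows "topological_atlas (restrict_atlas A S)"
proof -
  have sub: "openin (mtop A) T" if "openin (mtop (restrict_atlas A S)) T" for T
    using that
  proof (induction rule: openin_mtop_induct)
    case (chart U \<phi> V)
    then obtain U' where "(U', \<phi>) \<in> A" "U = U' \<inter> S" by (auto simp: restrict_atlas_def)
    moreover have "(U' \<inter> S) \<inter> \<phi> -` V = (U' \<inter> \<phi> -` V) \<inter> S" by auto
    ultimately show ?case using openin_mtop_chart chart(2) assms(2) by (metis openin_Int)
  qed auto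
  show ?thesis
    unfolding topological_atlas_def
  proof (intro ballI, clarify, intro conjI allI impI)
    fix U \<phi> assume "(U, \<phi>) \<in> restrict_atlas A S"
    then obtain U' where U': "(U', \<phi>) \<in> A" "U = U' \<inter> S" by (auto simp: restrict_atlas_def)
    note c = topological_atlasD[OF assms(1) U'(1), simplified]
    show "inj_on \<phi> U" using c(1) U'(2) by (auto intro: inj_on_subset)
    fix T assume "openin (mtop (restrict_atlas A S)) T"
    then show "open (\<phi> ` (U \<inter> T))"
      using c(2)[OF openin_Int[OF assms(2) sub]] by (simp add: U'(2) Int_assoc)
  qed
qed

text \<open>An open set of the product model space contains a box around each of its points; pulled
  back through the two charts, these boxes show that every generator is open in the product
  topology.\<close>

lemma openin_mtop_prod:
  assumes "openin (mtop (prod_atlas A B)) S"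
  shows "openin (prod_topology (mtop A) (mtop B)) S"
  using assms
proof (induction rule: openin_mtop_induct)
  case (chart D \<theta> V)
  then obtain U \<phi> W \<psi> where c: "D = U \<times> W" "\<theta> = map_prod \<phi> \<psi>" "(U, \<phi>) \<in> A" "(W, \<psi>) \<in> B"
    by (auto simp: prod_atlas_def)
  show ?case
    unfolding openin_prod_topology_alt
  proof (intro allI impI)
    fix x y assume "(x, y) \<in> D \<inter> \<theta> -` V"
    then have xy: "x \<in> U" "y \<in> W" "(\<phi> x, \<psi> y) \<in> V" using c by auto
    then obtain V1 V2 where V: "open V1" "open V2" "\<phi> x \<in> V1" "\<psi> y \<in> V2" "V1 \<times> V2 \<subseteq> V"
      using chart(2) by (metis mem_Sigma_iff open_prod_elim)
    show "\<exists>S T. openin (mtop A) S \<and> openin (mtop B) T \<and> x \<in> S \<and> y \<in> T \<and> S \<times> T \<subseteq> D \<inter> \<theta> -` V"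
      using xy V c by (intro exI[of _ "U \<inter> \<phi> -` V1"] exI[of _ "W \<inter> \<psi> -` V2"])
        (auto intro: openin_mtop_chart)
  qed
qed auto

lemma prod_topological_atlas:
  assumes "topological_atlas A" "topological_atlas B"
  shows "topological_atlas (prod_atlas A B)"
  unfolding topological_atlas_def
proof (intro ballI, clarify, intro conjI allI impI)
  fix D \<theta> assume "(D, \<theta>) \<in> prod_atlas A B"
  then obtain U \<phi> W \<psi> where c: "D = U \<times> W" "\<theta> = map_prod \<phi> \<psi>" "(U, \<phi>) \<in> A" "(W, \<psi>) \<in> B"
    by (auto simp: prod_atlas_def)
  note a = topological_atlasD[OF assms(1) c(3), simplified] and
    b = topological_atlasD[OF assms(2) c(4), simplified]
  show "inj_on \<theta> D" unfolding c using a(1) b(1) by (rule map_prod_inj_on)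
  fix S assume "openin (mtop (prod_atlas A B)) S"
  then have S: "openin (prod_topology (mtop A) (mtop B)) S" by (rule openin_mtop_prod)
  show "open (\<theta> ` (D \<inter> S))"
    unfolding open_subopen[of "\<theta> ` (D \<inter> S)"]
  proof (intro ballI)
    fix z assume "z \<in> \<theta> ` (D \<inter> S)"
    then obtain x y where xy: "z = (\<phi> x, \<psi> y)" "x \<in> U" "y \<in> W" "(x, y) \<in> S" using c by auto
    then obtain S1 S2 where S12: "openin (mtop A) S1" "openin (mtop B) S2" "x \<in> S1" "y \<in> S2"
      "S1 \<times> S2 \<subseteq> S"
      using S by (metis openin_prod_topology_alt)
    have "open (\<phi> ` (U \<inter> S1) \<times> \<psi> ` (W \<inter> S2))"
      using a(2)[OF S12(1)] b(2)[OF S12(2)] by (rule open_Times)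
    moreover have "z \<in> \<phi> ` (U \<inter> S1) \<times> \<psi> ` (W \<inter> S2)" using xy S12 by auto
    moreover have "\<phi> ` (U \<inter> S1) \<times> \<psi> ` (W \<inter> S2) \<subseteq> \<theta> ` (D \<inter> S)"
    proof clarify
      fix x y assume "x \<in> U" "x \<in> S1" "y \<in> W" "y \<in> S2"
      then show "(\<phi> x, \<psi> y) \<in> \<theta> ` (D \<inter> S)"
        using S12(5) by (intro image_eqI[of _ _ "(x, y)"]) (auto simp: c)
    qed
    ultimately show "\<exists>T. open T \<and> z \<in> T \<and> T \<subseteq> \<theta> ` (D \<inter> S)" by blast
  qed
qed

lemma chart_at_mem:
  assumes "x \<in> points A"
  shows "chart_at A x \<in> A" "x \<in> fst (chart_at A x)"
proof -
  have "\<exists>c. c \<in> A \<and> x \<in> fst c" using assms by (auto simp: points_def)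
  from someI_ex[OF this] show "chart_at A x \<in> A" "x \<in> fst (chart_at A x)"
    by (auto simp: chart_at_def)
qed

lemma chart_subset_points: "c \<in> A \<Longrightarrow> x \<in> fst c \<Longrightarrow> x \<in> points A"
  by (auto simp: points_def)

text \<open>The third conjunct keeps \<^const>\<open>inv_into\<close> and the chart \<open>c'\<close> away from junk values near \<open>x\<close>.\<close>

definition chart_deriv ::
  "('a, 'e::real_normed_vector) chart \<Rightarrow> ('b, 'f::real_normed_vector) chart \<Rightarrow>
   ('a \<Rightarrow> 'b) \<Rightarrow> 'a \<Rightarrow> ('e \<Rightarrow> 'f) \<Rightarrow> bool" where
  "chart_deriv c c' f x L \<longleftrightarrow> x \<in> fst c \<and> inj_on (snd c) (fst c) \<and>
     (\<forall>\<^sub>F u in nhds (snd c x). u \<in> snd c ` fst c \<and> f (inv_into (fst c) (snd c) u) \<in> fst c') \<and>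
     ((snd c' \<circ> f \<circ> inv_into (fst c) (snd c)) has_derivative L) (at (snd c x))"

definition curve_deriv :: "('a, 'e::real_normed_vector) chart \<Rightarrow> (real \<Rightarrow> 'a) \<Rightarrow> real \<Rightarrow> 'e \<Rightarrow> bool" where
  "curve_deriv c \<gamma> t v \<longleftrightarrow>
     (\<forall>\<^sub>F s in nhds t. \<gamma> s \<in> fst c) \<and> ((snd c \<circ> \<gamma>) has_vector_derivative v) (at t)"

section \<open>Chain rule and pairing for derivatives read in charts\<close>

lemma chart_deriv_mem:
  assumes "chart_deriv c c' f x L"
  shows "x \<in> fst c" "f x \<in> fst c'" "inj_on (snd c) (fst c)"
proof -
  show x: "x \<in> fst c" "inj_on (snd c) (fst c)" using assms by (auto simp: chart_deriv_def)
  have "\<forall>\<^sub>F u in nhds (snd c x). u \<in> snd c ` fst c \<and> f (inv_into (fst c) (snd c) u) \<in> fst c'"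
    using assms by (simp add: chart_deriv_def)
  from eventually_nhds_x_imp_x[OF this] show "f x \<in> fst c'" using x by simp
qed

lemma curve_deriv_mem: "curve_deriv c \<gamma> t v \<Longrightarrow> \<gamma> t \<in> fst c"
  unfolding curve_deriv_def using eventually_nhds_x_imp_x by blast

lemma chart_deriv_linear: "chart_deriv c c' f x L \<Longrightarrow> linear L"
  by (auto simp: chart_deriv_def intro: has_derivative_linear)

lemma chart_deriv_unique: "chart_deriv c c' f x L \<Longrightarrow> chart_deriv c c' f x L' \<Longrightarrow> L = L'"
  by (auto simp: chart_deriv_def intro: has_derivative_unique)

lemma curve_deriv_unique: "curve_deriv c \<gamma> t v \<Longrightarrow> curve_deriv c \<gamma> t w \<Longrightarrow> v = w"
  by (auto simp: curve_deriv_def intro: vector_derivative_unique_at)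

lemma has_vector_derivative_eventually_cong:
  assumes "(f has_vector_derivative v) (at t)" "\<forall>\<^sub>F s in nhds t. f s = g s"
  shows "(g has_vector_derivative v) (at t)"
  using assms has_vector_derivative_cong_ev[where S = UNIV and x = t and f = f and g = g] eventually_nhds_x_imp_x[OF assms(2)]
  by simp

lemma curve_deriv_cong:
  assumes "curve_deriv c \<gamma> t v" "\<forall>\<^sub>F s in nhds t. \<gamma> s = \<delta> s"
  shows "curve_deriv c \<delta> t v"
  unfolding curve_deriv_def
proof
  show "\<forall>\<^sub>F s in nhds t. \<delta> s \<in> fst c"
    using assms unfolding curve_deriv_def by (auto elim: eventually_elim2)
  have "\<forall>\<^sub>F s in nhds t. (snd c \<circ> \<gamma>) s = (snd c \<circ> \<delta>) s"
    using assms(2) by eventually_elim simp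
  then show "((snd c \<circ> \<delta>) has_vector_derivative v) (at t)"
    using assms(1) has_vector_derivative_eventually_cong unfolding curve_deriv_def by blast
qed

lemma chart_deriv_cong:
  assumes "topological_atlas A" "c \<in> A" "chart_deriv c c' f x L"
    and "\<And>z. z \<in> points A \<Longrightarrow> f z = g z"
  shows "chart_deriv c c' g x L"
proof -
  let ?i = "inv_into (fst c) (snd c)"
  note m = chart_deriv_mem[OF assms(3)] and op = topological_atlasD(3)[OF assms(1,2)]
  have eq: "f (?i u) = g (?i u)" if "u \<in> snd c ` fst c" for u
    using assms(4) chart_subset_points[OF assms(2)] inv_into_into[OF that] by blast
  have "((snd c' \<circ> g \<circ> ?i) has_derivative L) (at (snd c x))"
    by (rule has_derivative_transform_within_open[of "snd c' \<circ> f \<circ> ?i" _ _ UNIV, OF _ op])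
      (use assms(3) m(1) eq in \<open>auto simp: chart_deriv_def\<close>)
  moreover have "\<forall>\<^sub>F u in nhds (snd c x). u \<in> snd c ` fst c \<and> f (?i u) \<in> fst c'"
    using assms(3) by (simp add: chart_deriv_def)
  then have "\<forall>\<^sub>F u in nhds (snd c x). u \<in> snd c ` fst c \<and> g (?i u) \<in> fst c'"
    by eventually_elim (metis eq)
  ultimately show ?thesis using m by (simp add: chart_deriv_def)
qed

text \<open>A curve is a map out of the real line with its identity chart. This makes the chain and
  pairing rules for curves instances of those for maps.\<close>

lemma chart_deriv_curve:
  "chart_deriv (UNIV, \<lambda>t. t) c \<gamma> t (\<lambda>s. s *\<^sub>R v) \<longleftrightarrow> curve_deriv c \<gamma> t v"
proof -
  have "inv_into UNIV (\<lambda>t::real. t) = (\<lambda>t. t)"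
    by (rule ext) (metis UNIV_I f_inv_into_f rangeI)
  then show ?thesis
    by (simp add: chart_deriv_def curve_deriv_def has_vector_derivative_def comp_def inj_on_def)
qed

text \<open>The inner \<open>inv_into\<close> cancels the chart \<open>c'\<close> only where
  \<open>f\<close> lands in its domain. That happens near \<open>x\<close>, so the composed
  representatives agree with the representative of the composition on a neighbourhood, which
  suffices for the derivative.\<close>

lemma chart_deriv_comp:
  assumes f: "chart_deriv c c' f x L" and g: "chart_deriv c' c'' g (f x) L'"
  shows "chart_deriv c c'' (\<lambda>x. g (f x)) x (\<lambda>v. L' (L v))"
proof -
  let ?i = "inv_into (fst c) (snd c)" and ?i' = "inv_into (fst c') (snd c')"
  let ?F = "snd c' \<circ> f \<circ> ?i" and ?G = "snd c'' \<circ> g \<circ> ?i'"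
  note fm = chart_deriv_mem[OF f] and gm = chart_deriv_mem[OF g]
  have ix: "?i (snd c x) = x" using fm by simp
  have Fx: "?F (snd c x) = snd c' (f x)" using ix by simp
  \<comment> \<open>Continuity of the representative of \<open>f\<close> pulls the eventual
    condition on \<open>g\<close> back to a neighbourhood of \<open>snd c x\<close>.\<close>
  have "(?F \<longlongrightarrow> snd c' (f x)) (nhds (snd c x))"
    using isCont_tendsto_nhds[OF has_derivative_continuous[of ?F L "snd c x" UNIV]] f
    unfolding Fx by (simp add: chart_deriv_def)
  moreover have "\<forall>\<^sub>F w in nhds (snd c' (f x)). g (?i' w) \<in> fst c''"
    using g by (auto simp: chart_deriv_def elim: eventually_mono)
  ultimately have "\<forall>\<^sub>F u in nhds (snd c x). g (?i' (?F u)) \<in> fst c''"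
    by (rule eventually_compose_filterlim[rotated])
  moreover have ev: "\<forall>\<^sub>F u in nhds (snd c x). u \<in> snd c ` fst c \<and> f (?i u) \<in> fst c'"
    using f by (simp add: chart_deriv_def)
  ultimately have 1: "\<forall>\<^sub>F u in nhds (snd c x). u \<in> snd c ` fst c \<and> g (f (?i u)) \<in> fst c''"
    by eventually_elim (use gm(3) in simp)
  have "(?F has_derivative L) (at (snd c x))" using f by (simp add: chart_deriv_def)
  moreover have "(?G has_derivative L') (at (?F (snd c x)))"
    using g unfolding Fx by (simp add: chart_deriv_def)
  ultimately have "(?G \<circ> ?F has_derivative L' \<circ> L) (at (snd c x))"
    by (rule diff_chain_at)
  moreover have eq: "\<forall>\<^sub>F u in nhds (snd c x). (?G \<circ> ?F) u = (snd c'' \<circ> (\<lambda>x. g (f x)) \<circ> ?i) u"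
    using ev by eventually_elim (use gm(3) in simp)
  moreover have "\<forall>\<^sub>F u in at (snd c x). (?G \<circ> ?F) u = (snd c'' \<circ> (\<lambda>x. g (f x)) \<circ> ?i) u"
    using eq by (simp only: eventually_nhds_conv_at)
  ultimately have "((snd c'' \<circ> (\<lambda>x. g (f x)) \<circ> ?i) has_derivative L' \<circ> L) (at (snd c x))"
    using has_derivative_transform_eventually eventually_nhds_x_imp_x[OF eq] UNIV_I by blast
  then show ?thesis using 1 fm by (simp add: chart_deriv_def comp_def)
qed

lemma curve_deriv_comp:
  assumes "curve_deriv c \<gamma> t v" "chart_deriv c c' f (\<gamma> t) L"
  shows "curve_deriv c' (\<lambda>s. f (\<gamma> s)) t (L v)"
  using chart_deriv_comp[OF assms(1)[folded chart_deriv_curve] assms(2)]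
    linear_cmul[OF chart_deriv_linear[OF assms(2)]]
  by (simp flip: chart_deriv_curve)

definition prod_chart :: "('a, 'e) chart \<Rightarrow> ('b, 'f) chart \<Rightarrow> ('a \<times> 'b, 'e \<times> 'f) chart" where
  "prod_chart c c' = (fst c \<times> fst c', map_prod (snd c) (snd c'))"

lemma prod_chart_mem: "c \<in> A \<Longrightarrow> c' \<in> B \<Longrightarrow> prod_chart c c' \<in> prod_atlas A B"
  by (cases c; cases c') (auto simp: prod_chart_def prod_atlas_def)

lemma chart_deriv_Pair:
  assumes "chart_deriv c c1 f x L1" "chart_deriv c c2 g x L2"
  shows "chart_deriv c (prod_chart c1 c2) (\<lambda>x. (f x, g x)) x (\<lambda>v. (L1 v, L2 v))"
proof -
  have "snd (prod_chart c1 c2) \<circ> (\<lambda>x. (f x, g x)) \<circ> inv_into (fst c) (snd c) =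
      (\<lambda>u. ((snd c1 \<circ> f \<circ> inv_into (fst c) (snd c)) u, (snd c2 \<circ> g \<circ> inv_into (fst c) (snd c)) u))"
    by (auto simp: prod_chart_def)
  moreover have "\<forall>\<^sub>F u in nhds (snd c x). u \<in> snd c ` fst c \<and>
      (\<lambda>x. (f x, g x)) (inv_into (fst c) (snd c) u) \<in> fst (prod_chart c1 c2)"
    using assms unfolding chart_deriv_def by (auto simp: prod_chart_def elim: eventually_elim2)
  ultimately show ?thesis
    using assms unfolding chart_deriv_def by (simp only: has_derivative_Pair simp_thms)
qed

lemma curve_deriv_Pair:
  assumes "curve_deriv c \<gamma> t v" "curve_deriv c' \<delta> t w"
  shows "curve_deriv (prod_chart c c') (\<lambda>s. (\<gamma> s, \<delta> s)) t (v, w)"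
  using chart_deriv_Pair[OF assms[folded chart_deriv_curve]]
  by (simp flip: chart_deriv_curve)

lemma curve_deriv_const: "y \<in> fst c \<Longrightarrow> curve_deriv c (\<lambda>_. y) t 0"
  by (simp add: curve_deriv_def comp_def)

lemma chart_deriv_const:
  assumes "topological_atlas A" "c \<in> A" "x \<in> fst c" "y \<in> fst c'"
  shows "chart_deriv c c' (\<lambda>_. y) x (\<lambda>_. 0)"
  using assms topological_atlasD[OF assms(1,2)] eventually_nhds_in_open[of "snd c ` fst c" "snd c x"]
  by (simp add: chart_deriv_def comp_def)

lemma chart_deriv_ident:
  assumes "topological_atlas A" "c \<in> A" "x \<in> fst c"
  shows "chart_deriv c c (\<lambda>x. x) x (\<lambda>v. v)"
proof -
  note c = topological_atlasD[OF assms(1,2)]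
  have ev: "\<forall>\<^sub>F u in nhds (snd c x). u \<in> snd c ` fst c"
    using c(3) assms(3) by (intro eventually_nhds_in_open) auto
  have "((\<lambda>u. snd c (inv_into (fst c) (snd c) u)) has_derivative (\<lambda>v. v)) (at (snd c x))"
    by (rule has_derivative_transform_within_open[OF has_derivative_ident c(3)])
      (use assms(3) in \<open>auto simp: f_inv_into_f\<close>)
  moreover have "\<forall>\<^sub>F u in nhds (snd c x). u \<in> snd c ` fst c \<and>
     inv_into (fst c) (snd c) u \<in> fst c"
    using ev by eventually_elim (auto simp: inv_into_into)
  ultimately show ?thesis using assms(3) c(1)
    by (simp add: chart_deriv_def comp_def)
qed

text \<open>Continuity makes the set on which the local representative is defined open in the chart.
  The target \<open>B\<close> is an arbitrary atlas, so the lemma covers maps into the associated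
  bundle.\<close>

lemma smooth_map_chart_deriv:
  assumes "topological_atlas A" "smooth_map A B f" "c \<in> A" "c' \<in> B" "x \<in> fst c" "f x \<in> fst c'"
  shows "\<exists>L. chart_deriv c c' f x L"
proof -
  let ?S = "{x \<in> topspace (mtop A). f x \<in> fst c'}"
  note c = topological_atlasD[OF assms(1,3)]
  have eq: "fst c \<inter> f -` fst c' = fst c \<inter> ?S"
    using openin_subset[OF openin_mtop_chart_dom[OF assms(3)]] by auto
  have "continuous_map (mtop A) (mtop B) f" using assms(2) by (simp add: smooth_map_def)
  then have "openin (mtop A) ?S"
    using openin_mtop_chart_dom[OF assms(4)] openin_continuous_map_preimage by blast
  then have op: "open (snd c ` (fst c \<inter> f -` fst c'))" unfolding eq by (rule c(2))
  have mem: "snd c x \<in> snd c ` (fst c \<inter> f -` fst c')" using assms by auto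
  have "smooth_on (snd c' \<circ> f \<circ> inv_into (fst c) (snd c)) (snd c ` (fst c \<inter> f -` fst c'))"
    using assms(2-4) unfolding smooth_map_def by (cases c; cases c') fastforce
  from smooth_on_imp_differentiable[OF this mem] obtain L where
    "((snd c' \<circ> f \<circ> inv_into (fst c) (snd c)) has_derivative L) (at (snd c x))"
    by (auto simp: differentiable_def)
  moreover have "\<forall>\<^sub>F u in nhds (snd c x).
      u \<in> snd c ` fst c \<and> f (inv_into (fst c) (snd c) u) \<in> fst c'"
    using eventually_nhds_in_open[OF op mem] by eventually_elim (use c(1) in auto)
  ultimately show ?thesis using assms(5) c(1) by (auto simp: chart_deriv_def)
qed

lemma chart_deriv_change:
  assumes "manifold A" "c \<in> A" "c' \<in> A" "x \<in> fst c" "x \<in> fst c'"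
  obtains L where "chart_deriv c c' (\<lambda>x. x) x L"
proof -
  have "smooth_map A A (\<lambda>x. x)"
    using assms(1) by (auto simp: smooth_map_def manifold_def comp_def)
  then show thesis
    using smooth_map_chart_deriv[where f = "\<lambda>x. x", OF manifold_topological_atlas[OF assms(1)] _
      assms(2-5)] that by blast
qed

text \<open>Differentiability in a chart implies continuity there; the chart image of
  \<open>S\<close> is open, and injectivity of the chart carries membership back to
  \<open>S\<close>.\<close>

lemma curve_deriv_eventually_in:
  assumes "topological_atlas A" "c \<in> A" "curve_deriv c \<gamma> t v" "openin (mtop A) S" "\<gamma> t \<in> S"
  shows "\<forall>\<^sub>F s in nhds t. \<gamma> s \<in> S"
proof -
  note c = topological_atlasD[OF assms(1,2)]
  have op: "open (snd c ` (fst c \<inter> S))" using c(2)[OF assms(4)] .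
  have "((snd c \<circ> \<gamma>) \<longlongrightarrow> snd c (\<gamma> t)) (nhds t)"
    using isCont_tendsto_nhds[OF has_vector_derivative_continuous[of "snd c \<circ> \<gamma>" v t UNIV]]
      assms(3) by (simp add: curve_deriv_def)
  then have "\<forall>\<^sub>F s in nhds t. (snd c \<circ> \<gamma>) s \<in> snd c ` (fst c \<inter> S)"
    by (rule topological_tendstoD[OF _ op]) (use curve_deriv_mem[OF assms(3)] assms(5) in auto)
  moreover have "\<forall>\<^sub>F s in nhds t. \<gamma> s \<in> fst c" using assms(3) by (simp add: curve_deriv_def)
  ultimately show ?thesis
    by eventually_elim (use c(1) in \<open>auto dest: inj_onD\<close>)
qed

lemma curve_deriv_chart_change:
  assumes "manifold A" "c \<in> A" "c' \<in> A" "curve_deriv c \<gamma> t v" "\<gamma> t \<in> fst c'"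
  shows "\<exists>w. curve_deriv c' \<gamma> t w"
proof -
  obtain L where "chart_deriv c c' (\<lambda>x. x) (\<gamma> t) L"
    using chart_deriv_change[OF assms(1-3) curve_deriv_mem[OF assms(4)] assms(5)] .
  from curve_deriv_comp[OF assms(4) this] show ?thesis by blast
qed

lemma curve_deriv_smooth_map:
  assumes "topological_atlas A" "smooth_map A B f" "c \<in> A" "c' \<in> B" "curve_deriv c \<gamma> t v"
    "f (\<gamma> t) \<in> fst c'"
  shows "\<exists>w. curve_deriv c' (\<lambda>s. f (\<gamma> s)) t w"
proof -
  obtain L where "chart_deriv c c' f (\<gamma> t) L"
    using smooth_map_chart_deriv[OF assms(1-4) curve_deriv_mem[OF assms(5)] assms(6)] by blast
  from curve_deriv_comp[OF assms(5) this] show ?thesis by blast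
qed

lemma curve_deriv_restrict:
  assumes "topological_atlas A" "c \<in> A" "curve_deriv c \<gamma> t v" "openin (mtop A) S" "\<gamma> t \<in> S"
  shows "curve_deriv (fst c \<inter> S, snd c) \<gamma> t v"
  using assms(3) curve_deriv_eventually_in[OF assms]
  by (auto simp: curve_deriv_def elim: eventually_elim2)

lemma restrict_atlas_mem: "c \<in> A \<Longrightarrow> (fst c \<inter> S, snd c) \<in> restrict_atlas A S"
  by (cases c) (force simp: restrict_atlas_def)

lemma curve_deriv_snd:
  "curve_deriv (prod_chart c c') \<gamma> t v \<Longrightarrow> curve_deriv c' (\<lambda>s. snd (\<gamma> s)) t (snd v)"
  unfolding curve_deriv_def
proof (intro conjI, elim conjE)
  assume "(\<forall>\<^sub>F s in nhds t. \<gamma> s \<in> fst (prod_chart c c')) \<and>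
    (snd (prod_chart c c') \<circ> \<gamma> has_vector_derivative v) (at t)"
  then have "((\<lambda>s. snd ((snd (prod_chart c c') \<circ> \<gamma>) s)) has_vector_derivative snd v) (at t)"
    using bounded_linear.has_vector_derivative[OF bounded_linear_snd] by blast
  then show "(snd c' \<circ> (\<lambda>s. snd (\<gamma> s)) has_vector_derivative snd v) (at t)"
    by (simp add: prod_chart_def comp_def snd_map_prod)
qed (auto simp: prod_chart_def elim!: eventually_mono)

section \<open>Comparison with \<open>tangent_map\<close> and \<open>velocity\<close>\<close>

lemma tangent_map_eq:
  assumes "chart_deriv (chart_at A x) (chart_at B (f x)) f x L"
  shows "tangent_map A B f (x, v) = (f x, L v)"
proof -
  obtain U \<phi> W \<psi> where "chart_at A x = (U, \<phi>)" "chart_at B (f x) = (W, \<psi>)" by fastforce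
  then show ?thesis
    using assms frechet_derivative_at[of _ L "\<phi> x"] by (simp add: tangent_map_def chart_deriv_def)
qed

lemma velocity_eq:
  "curve_deriv (chart_at A (\<gamma> t)) \<gamma> t v \<Longrightarrow> velocity A \<gamma> t = (\<gamma> t, v)"
  by (auto simp: velocity_def curve_deriv_def intro: vector_derivative_at)

lemma smooth_map_tangent_map:
  assumes "topological_atlas A" "smooth_map A B f" "x \<in> points A"
  obtains L where "chart_deriv (chart_at A x) (chart_at B (f x)) f x L"
    "\<And>v. tangent_map A B f (x, v) = (f x, L v)"
proof -
  have "f x \<in> points B"
    using assms(2,3) continuous_map_image_subset_topspace[of "mtop A" "mtop B" f]
    by (auto simp: smooth_map_def topspace_mtop)
  then obtain L where L: "chart_deriv (chart_at A x) (chart_at B (f x)) f x L"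
    using smooth_map_chart_deriv[OF assms(1,2)] chart_at_mem assms(3) by metis
  show thesis by (rule that[OF L tangent_map_eq[OF L]])
qed

section \<open>Integral curves and flows\<close>

lemma continuous_map_mtopI:
  assumes "manifold A" "open J"
    and "\<And>t. t \<in> J \<Longrightarrow> \<exists>c\<in>A. \<exists>v. curve_deriv c \<gamma> t v"
  shows "continuous_map (top_of_set J) (mtop A) \<gamma>"
proof -
  have "openin (top_of_set J) {t \<in> J. \<gamma> t \<in> S}" if S: "openin (mtop A) S" for S
  proof -
    have "open {t \<in> J. \<gamma> t \<in> S}"
      unfolding open_subopen[of "{t \<in> J. \<gamma> t \<in> S}"]
    proof (intro ballI)
      fix t assume t: "t \<in> {t \<in> J. \<gamma> t \<in> S}"
      then obtain c v where "c \<in> A" "curve_deriv c \<gamma> t v" using assms(3) by blast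
      then have "\<forall>\<^sub>F s in nhds t. \<gamma> s \<in> S"
        using curve_deriv_eventually_in[OF manifold_topological_atlas[OF assms(1)]] S t by blast
      moreover have "\<forall>\<^sub>F s in nhds t. s \<in> J" using assms(2) t by (intro eventually_nhds_in_open) auto
      ultimately have "\<forall>\<^sub>F s in nhds t. s \<in> {t \<in> J. \<gamma> t \<in> S}" by eventually_elim simp
      then show "\<exists>T. open T \<and> t \<in> T \<and> T \<subseteq> {t \<in> J. \<gamma> t \<in> S}"
        unfolding eventually_nhds by blast
    qed
    then show ?thesis using assms(2) by (simp add: openin_open_eq)
  qed
  moreover have "\<gamma> t \<in> points A" if "t \<in> J" for t
    using assms(3)[OF that] curve_deriv_mem chart_subset_points by metis
  ultimately show ?thesis by (simp add: continuous_map_def topspace_mtop Pi_iff)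
qed

lemma integral_curveI:
  assumes "manifold A" "open J" "is_interval J"
    and "\<And>t. t \<in> J \<Longrightarrow> \<gamma> t \<in> points A \<and> curve_deriv (chart_at A (\<gamma> t)) \<gamma> t (X (\<gamma> t))"
  shows "integral_curve A X J \<gamma>"
  using assms continuous_map_mtopI[OF assms(1,2)] chart_at_mem(1)
  unfolding integral_curve_def curve_deriv_def by metis

text \<open>The definition speaks of the derivative in the chart at \<open>\<gamma> t\<close> but
  not of nearby points lying in its domain; continuity of \<gamma> provides this.\<close>

lemma integral_curveD:
  assumes "integral_curve A X J \<gamma>"
  shows "open J" "is_interval J" "t \<in> J \<Longrightarrow> \<gamma> t \<in> points A"
    "t \<in> J \<Longrightarrow> curve_deriv (chart_at A (\<gamma> t)) \<gamma> t (X (\<gamma> t))"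
proof -
  show J: "open J" "is_interval J" using assms by (auto simp: integral_curve_def)
  have c: "continuous_map (top_of_set J) (mtop A) \<gamma>" using assms by (simp add: integral_curve_def)
  then show pt: "\<gamma> t \<in> points A" if "t \<in> J" for t
    using that continuous_map_image_subset_topspace[OF c] by (auto simp: topspace_mtop)
  show "curve_deriv (chart_at A (\<gamma> t)) \<gamma> t (X (\<gamma> t))" if t: "t \<in> J"
  proof -
    let ?U = "fst (chart_at A (\<gamma> t))"
    have "openin (top_of_set J) {s \<in> topspace (top_of_set J). \<gamma> s \<in> ?U}"
      using openin_continuous_map_preimage[OF c openin_mtop_chart_dom[OF chart_at_mem(1)[OF pt[OF t]]]] .
    then have "open {s \<in> J. \<gamma> s \<in> ?U}" using J(1) by (simp add: openin_open_eq)
    then have "\<forall>\<^sub>F s in nhds t. s \<in> {s \<in> J. \<gamma> s \<in> ?U}"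
      using t chart_at_mem(2)[OF pt[OF t]] by (intro eventually_nhds_in_open) auto
    then show ?thesis
      using assms t unfolding integral_curve_def curve_deriv_def by (auto elim: eventually_mono)
  qed
qed

lemma integral_curve_subset:
  assumes "manifold A" "integral_curve A X J \<gamma>" "open K" "is_interval K" "K \<subseteq> J"
  shows "integral_curve A X K \<gamma>"
  using integral_curveI[OF assms(1,3,4)] integral_curveD(3,4)[OF assms(2)] assms(5) by blast

text \<open>The coordinate expression of the field in one fixed chart. The values of
  \<open>X\<close> itself refer to a chart that varies with the point, so \<open>X\<close> gives no
  differential equation on an open set of the model space, whereas this function does.\<close>

definition local_field :: "('a, 'e::model_space) atlas \<Rightarrow> ('a \<Rightarrow> 'e) \<Rightarrow> ('a, 'e) chart \<Rightarrow> 'e \<Rightarrow> 'e" where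
  "local_field A X c u =
     (let x = inv_into (fst c) (snd c) u in snd (tangent_map A std_atlas (snd c) (x, X x)))"

lemma local_field_C1:
  "vector_field A X \<Longrightarrow> c \<in> A \<Longrightarrow> Ck_on (Suc 0) (local_field A X c) (snd c ` fst c)"
  unfolding vector_field_def local_field_def[abs_def] smooth_on_def by (cases c) fastforce

lemma chart_deriv_local_field:
  assumes "manifold A" "c \<in> A" "x \<in> fst c"
    and L: "chart_deriv (chart_at A x) c (\<lambda>x. x) x L"
  shows "local_field A X c (snd c x) = L (X x)"
proof -
  have i: "inv_into (fst c) (snd c) (snd c x) = x"
    using topological_atlasD(1)[OF manifold_topological_atlas[OF assms(1)] assms(2)] assms(3) by simp
  have std: "chart_at std_atlas y = (UNIV, \<lambda>v. v)" for y :: 'b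
    using chart_at_mem(1)[of y std_atlas] by (auto simp: std_atlas_def points_def)
  have "chart_deriv (chart_at A x) (chart_at std_atlas (snd c x)) (snd c) x L"
    using L by (simp add: std chart_deriv_def comp_def eventually_conj_iff)
  from tangent_map_eq[OF this] show ?thesis by (simp add: local_field_def i)
qed

text \<open>The derivatives \<open>L\<close> and \<open>L'\<close> of the two changes of chart
  compose to the derivative of the identity, so a velocity can be moved from the chart of the point
  to \<open>c\<close> and back.\<close>

lemma curve_deriv_local_field:
  assumes "manifold A" "c \<in> A" "\<gamma> t \<in> fst c"
  shows "curve_deriv c \<gamma> t (local_field A X c (snd c (\<gamma> t))) \<longleftrightarrow>
    curve_deriv (chart_at A (\<gamma> t)) \<gamma> t (X (\<gamma> t))"
proof -
  note pt = chart_at_mem[OF chart_subset_points[OF assms(2,3)]]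
  obtain L where L: "chart_deriv (chart_at A (\<gamma> t)) c (\<lambda>x. x) (\<gamma> t) L"
    using chart_deriv_change[OF assms(1) pt(1) assms(2) pt(2) assms(3)] .
  obtain L' where L': "chart_deriv c (chart_at A (\<gamma> t)) (\<lambda>x. x) (\<gamma> t) L'"
    using chart_deriv_change[OF assms(1,2) pt(1) assms(3) pt(2)] .
  have id: "(\<lambda>v. L' (L v)) = (\<lambda>v. v)"
    using chart_deriv_unique[OF chart_deriv_comp[OF L L']
      chart_deriv_ident[OF manifold_topological_atlas[OF assms(1)] pt]] .
  have eq: "local_field A X c (snd c (\<gamma> t)) = L (X (\<gamma> t))"
    using chart_deriv_local_field[OF assms(1-3) L] .
  show ?thesis
  proof
    assume "curve_deriv c \<gamma> t (local_field A X c (snd c (\<gamma> t)))"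
    from curve_deriv_comp[OF this L'] show "curve_deriv (chart_at A (\<gamma> t)) \<gamma> t (X (\<gamma> t))"
      unfolding eq using fun_cong[OF id] by simp
  next
    assume "curve_deriv (chart_at A (\<gamma> t)) \<gamma> t (X (\<gamma> t))"
    from curve_deriv_comp[OF this L] show "curve_deriv c \<gamma> t (local_field A X c (snd c (\<gamma> t)))"
      unfolding eq .
  qed
qed

lemma integral_curve_local:
  assumes "manifold A" "integral_curve A X J \<gamma>" "t \<in> J" "c \<in> A" "\<gamma> t \<in> fst c"
  shows "\<forall>\<^sub>F s in nhds t. \<gamma> s \<in> fst c \<and>
    ((snd c \<circ> \<gamma>) has_vector_derivative local_field A X c ((snd c \<circ> \<gamma>) s)) (at s)"
proof -
  note D = integral_curveD[OF assms(2)]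
  have "\<forall>\<^sub>F s in nhds t. \<gamma> s \<in> fst c"
    using curve_deriv_eventually_in[OF manifold_topological_atlas[OF assms(1)]
      chart_at_mem(1)[OF D(3)[OF assms(3)]] D(4)[OF assms(3)] openin_mtop_chart_dom[OF assms(4)] assms(5)] .
  moreover have "\<forall>\<^sub>F s in nhds t. s \<in> J" using D(1) assms(3) by (rule eventually_nhds_in_open)
  ultimately show ?thesis
  proof eventually_elim
    case (elim s)
    then show ?case
      using curve_deriv_local_field[OF assms(1,4), of \<gamma> s X] D(4)[of s]
      by (simp add: curve_deriv_def)
  qed
qed

lemma integral_curve_local_unique:
  assumes "manifold A" "vector_field A X" "integral_curve A X J \<gamma>" "integral_curve A X K \<delta>"
    and "t \<in> J" "t \<in> K" "\<gamma> t = \<delta> t"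
  shows "\<forall>\<^sub>F s in nhds t. \<gamma> s = \<delta> s"
proof -
  define c where "c = chart_at A (\<gamma> t)"
  have c: "c \<in> A" "\<gamma> t \<in> fst c" "\<delta> t \<in> fst c"
    using chart_at_mem[OF integral_curveD(3)[OF assms(3,5)]] assms(7) by (auto simp: c_def)
  note top = topological_atlasD[OF manifold_topological_atlas[OF assms(1)] c(1)]
  note 1 = integral_curve_local[OF assms(1,3,5) c(1,2)] and 2 = integral_curve_local[OF assms(1,4,6) c(1,3)]
  have "\<forall>\<^sub>F s in nhds t. (snd c \<circ> \<gamma>) s = (snd c \<circ> \<delta>) s"
    by (rule ode_local_uniqueness[OF top(3) local_field_C1[OF assms(2) c(1)]])
      (use 1 2 c assms(7) in \<open>auto simp: eventually_conj_iff comp_def\<close>)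
  then show ?thesis using 1 2
    by eventually_elim (use top(1) in \<open>auto dest: inj_onD\<close>)
qed

lemma closedin_Hausdorff_equalizer:
  assumes "Hausdorff_space Y" "continuous_map X Y f" "continuous_map X Y g"
  shows "closedin X {x \<in> topspace X. f x = g x}"
proof -
  have "closedin (prod_topology Y Y) {(y, y) | y. y \<in> topspace Y}"
    using assms(1) by (simp add: Hausdorff_space_closedin_diagonal image_def Setcompr_eq_image)
  moreover have "continuous_map X (prod_topology Y Y) (\<lambda>x. (f x, g x))"
    using assms(2,3) by (simp add: continuous_map_paired)
  ultimately have "closedin X {x \<in> topspace X. (f x, g x) \<in> {(y, y) | y. y \<in> topspace Y}}"
    by (rule closedin_continuous_map_preimage[rotated])
  also have "{x \<in> topspace X. (f x, g x) \<in> {(y, y) | y. y \<in> topspace Y}} = {x \<in> topspace X. f x = g x}"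
    using continuous_map_image_subset_topspace[OF assms(2)] by auto
  finally show ?thesis .
qed

text \<open>On the connected set \<open>J \<inter> K\<close> the set of agreement is closed because
  the manifold is Hausdorff, open by local uniqueness, and contains 0.\<close>

lemma integral_curve_unique:
  assumes A: "manifold A" and X: "vector_field A X"
    and \<gamma>: "integral_curve A X J \<gamma>" and \<delta>: "integral_curve A X K \<delta>"
    and "0 \<in> J" "0 \<in> K" "\<gamma> 0 = \<delta> 0" "t \<in> J" "t \<in> K"
  shows "\<gamma> t = \<delta> t"
proof -
  define I where "I = J \<inter> K"
  have I: "open I" "connected I" "0 \<in> I" "t \<in> I"
    using integral_curveD(1,2)[OF \<gamma>] integral_curveD(1,2)[OF \<delta>] assms(5-9)
    by (auto simp: I_def is_interval_connected_1[symmetric] intro: is_interval_Int)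
  have "continuous_map (top_of_set I) (mtop A) \<gamma>" "continuous_map (top_of_set I) (mtop A) \<delta>"
    using \<gamma> \<delta> by (auto simp: integral_curve_def I_def intro: continuous_map_from_subtopology_mono)
  then have cl: "closedin (top_of_set I) {s \<in> I. \<gamma> s = \<delta> s}"
    using closedin_Hausdorff_equalizer[of "mtop A" "top_of_set I" \<gamma> \<delta>] A by (simp add: manifold_def)
  have "open {s \<in> I. \<gamma> s = \<delta> s}"
    unfolding open_subopen[of "{s \<in> I. \<gamma> s = \<delta> s}"]
  proof (intro ballI)
    fix s assume s: "s \<in> {s \<in> I. \<gamma> s = \<delta> s}"
    then have "\<forall>\<^sub>F r in nhds s. \<gamma> r = \<delta> r"
      using integral_curve_local_unique[OF A X \<gamma> \<delta>] by (auto simp: I_def)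
    moreover have "\<forall>\<^sub>F r in nhds s. r \<in> I" using I(1) s by (intro eventually_nhds_in_open) auto
    ultimately have "\<forall>\<^sub>F r in nhds s. r \<in> {s \<in> I. \<gamma> s = \<delta> s}" by eventually_elim simp
    then show "\<exists>T. open T \<and> s \<in> T \<and> T \<subseteq> {s \<in> I. \<gamma> s = \<delta> s}"
      unfolding eventually_nhds by blast
  qed
  then have "openin (top_of_set I) {s \<in> I. \<gamma> s = \<delta> s}"
    using I(1) by (simp add: openin_open_eq)
  with cl I(2) have "{s \<in> I. \<gamma> s = \<delta> s} = {} \<or> {s \<in> I. \<gamma> s = \<delta> s} = I"
    unfolding connected_clopen by blast
  then show ?thesis using I(3,4) assms(7) by blast
qed

text \<open>Uniqueness makes the definite description in \<open>flow\<close> denote, so the flow can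
  be read off from any integral curve through the point.\<close>

lemma flow_eq:
  assumes "manifold A" "vector_field A X" "integral_curve A X J \<gamma>" "0 \<in> J" "t \<in> J" "\<gamma> 0 = x"
  shows "flow A X t x = \<gamma> t"
  unfolding flow_def
proof (rule the_equality)
  show "\<exists>J \<gamma>'. 0 \<in> J \<and> t \<in> J \<and> integral_curve A X J \<gamma>' \<and> \<gamma>' 0 = x \<and> \<gamma>' t = \<gamma> t"
    using assms by blast
  show "z = \<gamma> t" if "\<exists>J \<gamma>. 0 \<in> J \<and> t \<in> J \<and> integral_curve A X J \<gamma> \<and> \<gamma> 0 = x \<and> \<gamma> t = z" for z
    using that integral_curve_unique[OF assms(1,2) _ assms(3)] assms(4-6) by metis
qed

lemma flow_domI:
  "integral_curve A X J \<gamma> \<Longrightarrow> 0 \<in> J \<Longrightarrow> t \<in> J \<Longrightarrow> \<gamma> 0 = x \<Longrightarrow> x \<in> flow_dom A X t"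
  by (auto simp: flow_dom_def)

lemma integral_curve_exists:
  assumes "manifold A" "vector_field A X" "x \<in> points A"
  obtains d \<gamma> where "d > 0" "integral_curve A X {-d<..<d} \<gamma>" "\<gamma> 0 = x"
proof -
  define c where "c = chart_at A x"
  have c: "c \<in> A" "x \<in> fst c" using chart_at_mem[OF assms(3)] by (auto simp: c_def)
  let ?i = "inv_into (fst c) (snd c)"
  note top = topological_atlasD[OF manifold_topological_atlas[OF assms(1)] c(1)]
  obtain d u where u: "d > 0" "u 0 = snd c x"
    "\<And>t. \<bar>t\<bar> < d \<Longrightarrow> u t \<in> snd c ` fst c \<and> (u has_vector_derivative local_field A X c (u t)) (at t)"
    using ode_local_existence[OF top(3) local_field_C1[OF assms(2) c(1)], of "snd c x"] c(2) by blast
  let ?\<gamma> = "\<lambda>t. ?i (u t)"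
  have u1: "?\<gamma> t \<in> fst c" "snd c (?\<gamma> t) = u t" if "\<bar>t\<bar> < d" for t
    using u(3)[OF that] by (auto simp: f_inv_into_f inv_into_into)
  have "integral_curve A X {-d<..<d} ?\<gamma>"
  proof (rule integral_curveI[OF assms(1)])
    fix t assume "t \<in> {-d<..<d}"
    then have t: "\<bar>t\<bar> < d" by auto
    have ev: "\<forall>\<^sub>F s in nhds t. \<bar>s\<bar> < d"
      using eventually_nhds_in_open[of "{-d<..<d}" t] t
      by (simp add: abs_less_iff eventually_conj_iff minus_less_iff conj_commute)
    have "((snd c \<circ> ?\<gamma>) has_vector_derivative local_field A X c (u t)) (at t)"
      using has_vector_derivative_transform_within_open[of u _ t "{-d<..<d}" "snd c \<circ> ?\<gamma>"]
        u(3)[OF t] u1(2) t by (simp add: abs_less_iff)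
    then have "curve_deriv c ?\<gamma> t (local_field A X c (snd c (?\<gamma> t)))"
      using ev by (auto simp: curve_deriv_def u1 t elim!: eventually_mono)
    then show "?\<gamma> t \<in> points A \<and> curve_deriv (chart_at A (?\<gamma> t)) ?\<gamma> t (X (?\<gamma> t))"
      using curve_deriv_local_field[OF assms(1) c(1), of ?\<gamma> t X] u1(1)[OF t]
        chart_subset_points[OF c(1)] by blast
  qed (auto simp: is_interval_oo)
  moreover have "?\<gamma> 0 = x" using u(2) c(2) top(1) by simp
  ultimately show thesis using that u(1) by blast
qed

text \<open>The chain rule for \<open>f\<close>-related fields. It serves both the right
  translations of \<open>P\<close> and the projection to \<open>M\<close>.\<close>

lemma integral_curve_map:
  assumes "manifold B" "integral_curve A X J \<gamma>"
    and "\<And>x. x \<in> points A \<Longrightarrow> f x \<in> points B"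
    and "\<And>x. x \<in> points A \<Longrightarrow> \<exists>L. chart_deriv (chart_at A x) (chart_at B (f x)) f x L"
    and "\<And>x. x \<in> points A \<Longrightarrow> tangent_map A B f (x, X x) = (f x, Y (f x))"
  shows "integral_curve B Y J (\<lambda>t. f (\<gamma> t))"
proof (rule integral_curveI[OF assms(1)])
  note D = integral_curveD[OF assms(2)]
  fix t assume t: "t \<in> J"
  obtain L where L: "chart_deriv (chart_at A (\<gamma> t)) (chart_at B (f (\<gamma> t))) f (\<gamma> t) L"
    using assms(4)[OF D(3)[OF t]] by blast
  have "L (X (\<gamma> t)) = Y (f (\<gamma> t))"
    using tangent_map_eq[OF L] assms(5)[OF D(3)[OF t]] by simp
  then show "f (\<gamma> t) \<in> points B \<and>
      curve_deriv (chart_at B (f (\<gamma> t))) (\<lambda>t. f (\<gamma> t)) t (Y (f (\<gamma> t)))"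
    using curve_deriv_comp[OF D(4)[OF t] L] assms(3)[OF D(3)[OF t]] by simp
qed (use integral_curveD[OF assms(2)] in auto)

section \<open>Differentiable curves\<close>

text \<open>Hides the chart and the velocity, so that differentiability can be passed through group
  operations, actions and sections; on a manifold \<open>diff_curve_chart\<close> recovers a
  velocity in any chart around the point.\<close>

definition diff_curve :: "('a, 'e::real_normed_vector) atlas \<Rightarrow> (real \<Rightarrow> 'a) \<Rightarrow> real \<Rightarrow> bool" where
  "diff_curve A \<gamma> t \<longleftrightarrow> (\<exists>c\<in>A. \<exists>v. curve_deriv c \<gamma> t v)"

lemma diff_curve_point: "diff_curve A \<gamma> t \<Longrightarrow> \<gamma> t \<in> points A"
  unfolding diff_curve_def using curve_deriv_mem chart_subset_points by metis

lemma diff_curve_chart: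
  assumes "manifold A" "diff_curve A \<gamma> t" "c \<in> A" "\<gamma> t \<in> fst c"
  obtains v where "curve_deriv c \<gamma> t v"
  using assms curve_deriv_chart_change[OF assms(1)] unfolding diff_curve_def by blast

lemma diff_curve_eventually:
  assumes "topological_atlas A" "diff_curve A \<gamma> t" "openin (mtop A) S" "\<gamma> t \<in> S"
  shows "\<forall>\<^sub>F s in nhds t. \<gamma> s \<in> S"
  using assms curve_deriv_eventually_in[OF assms(1)] unfolding diff_curve_def by blast

lemma diff_curve_eventually_points:
  assumes "topological_atlas A" "diff_curve A \<gamma> t"
  shows "\<forall>\<^sub>F s in nhds t. \<gamma> s \<in> points A"
  using diff_curve_eventually[OF assms _ diff_curve_point[OF assms(2)]]
  by (metis openin_topspace topspace_mtop)

lemma diff_curve_const: "y \<in> points A \<Longrightarrow> diff_curve A (\<lambda>_. y) t"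
  unfolding diff_curve_def using chart_at_mem curve_deriv_const by metis

lemma diff_curve_cong:
  "diff_curve A \<gamma> t \<Longrightarrow> \<forall>\<^sub>F s in nhds t. \<gamma> s = \<delta> s \<Longrightarrow> diff_curve A \<delta> t"
  unfolding diff_curve_def using curve_deriv_cong by blast

lemma smooth_map_points: "smooth_map A B f \<Longrightarrow> x \<in> points A \<Longrightarrow> f x \<in> points B"
  using continuous_map_image_subset_topspace[of "mtop A" "mtop B" f]
  by (auto simp: smooth_map_def topspace_mtop)

lemma diff_curve_map:
  assumes "topological_atlas A" "smooth_map A B f" "diff_curve A \<gamma> t"
  shows "diff_curve B (\<lambda>s. f (\<gamma> s)) t"
proof -
  obtain c v where c: "c \<in> A" "curve_deriv c \<gamma> t v" using assms(3) by (auto simp: diff_curve_def)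
  note d = chart_at_mem[OF smooth_map_points[OF assms(2) diff_curve_point[OF assms(3)]]]
  show ?thesis
    using curve_deriv_smooth_map[OF assms(1,2) c(1) d(1) c(2) d(2)] d(1) by (auto simp: diff_curve_def)
qed

lemma diff_curve_Pair:
  "diff_curve A \<gamma> t \<Longrightarrow> diff_curve B \<delta> t \<Longrightarrow> diff_curve (prod_atlas A B) (\<lambda>s. (\<gamma> s, \<delta> s)) t"
  unfolding diff_curve_def by (blast intro: curve_deriv_Pair prod_chart_mem)

lemma diff_curve_snd:
  assumes "diff_curve (prod_atlas A B) \<gamma> t"
  shows "diff_curve B (\<lambda>s. snd (\<gamma> s)) t"
proof -
  obtain c v where c: "c \<in> prod_atlas A B" "curve_deriv c \<gamma> t v" using assms by (auto simp: diff_curve_def)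
  then obtain c1 c2 where "c = prod_chart c1 c2" "c2 \<in> B"
    by (fastforce simp: prod_atlas_def prod_chart_def)
  then show ?thesis using curve_deriv_snd c(2) by (metis diff_curve_def)
qed

lemma diff_curve_restrict:
  assumes "topological_atlas A" "diff_curve A \<gamma> t" "openin (mtop A) S" "\<gamma> t \<in> S"
  shows "diff_curve (restrict_atlas A S) \<gamma> t"
proof -
  obtain c v where c: "c \<in> A" "curve_deriv c \<gamma> t v" using assms(2) by (auto simp: diff_curve_def)
  show ?thesis
    using curve_deriv_restrict[OF assms(1) c assms(3,4)] restrict_atlas_mem[OF c(1)]
    unfolding diff_curve_def by blast
qed

lemma points_prod_atlas: "points (prod_atlas A B) = points A \<times> points B"
proof (intro equalityI subsetI)
  fix z assume "z \<in> points (prod_atlas A B)"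
  then obtain U \<phi> W \<psi> where "z \<in> U \<times> W" "(U, \<phi>) \<in> A" "(W, \<psi>) \<in> B"
    by (auto simp: points_def prod_atlas_def)
  then show "z \<in> points A \<times> points B" unfolding points_def by force
next
  fix z assume "z \<in> points A \<times> points B"
  then obtain c d where "c \<in> A" "d \<in> B" "fst z \<in> fst c" "snd z \<in> fst d"
    by (auto simp: points_def)
  then show "z \<in> points (prod_atlas A B)"
    using chart_subset_points[OF prod_chart_mem, of c A d B z]
    by (auto simp: prod_chart_def mem_Times_iff)
qed

lemma points_restrict_atlas: "points (restrict_atlas A S) = points A \<inter> S"
  unfolding points_def restrict_atlas_def by force

section \<open>Principal and associated bundles\<close>

locale principal =
  fixes M :: "('a, 'e::model_space) atlas" and G :: "('g, 'l::model_space) lie_group_data"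
    and P :: "('p, 'q::model_space, 'a, 'g) principal_data"
  assumes M: "manifold M" and G: "lie_group G" and P: "principal_bundle M G P"
begin

abbreviation "TP \<equiv> ptotal P"
abbreviation "TG \<equiv> gcharts G"
abbreviation "\<pi> \<equiv> pproj P"

lemma P_manifold: "manifold TP" and \<pi>_smooth: "smooth_map TP M \<pi>"
  and pact_smooth: "smooth_map (prod_atlas TP TG) TP (\<lambda>(p, g). pact P p g)"
  using P by (auto simp: principal_bundle_def)

lemma G_manifold: "manifold TG" and points_G [simp]: "points TG = carrier G"
  and mult_smooth: "smooth_map (prod_atlas TG TG) TG (\<lambda>(g, h). mult G g h)"
  and inv_smooth: "smooth_map TG TG (m_inv G)"
  using G by (auto simp: lie_group_def)

sublocale group G using G by (simp add: lie_group_def)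

lemmas tops = manifold_topological_atlas[OF M] manifold_topological_atlas[OF P_manifold]
  manifold_topological_atlas[OF G_manifold]

lemma pact_one [simp]: "p \<in> points TP \<Longrightarrow> pact P p \<one>\<^bsub>G\<^esub> = p"
  and pact_mult: "p \<in> points TP \<Longrightarrow> g \<in> carrier G \<Longrightarrow> k \<in> carrier G \<Longrightarrow>
    pact P p (g \<otimes>\<^bsub>G\<^esub> k) = pact P (pact P p g) k"
  and \<pi>_pact [simp]: "p \<in> points TP \<Longrightarrow> g \<in> carrier G \<Longrightarrow> \<pi> (pact P p g) = \<pi> p"
  using P by (auto simp: principal_bundle_def)

lemma pact_points [simp]: "p \<in> points TP \<Longrightarrow> g \<in> carrier G \<Longrightarrow> pact P p g \<in> points TP"
  using smooth_map_points[OF pact_smooth, of "(p, g)"] by (simp add: points_prod_atlas)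

lemma \<pi>_points: "p \<in> points TP \<Longrightarrow> \<pi> p \<in> points M"
  using smooth_map_points[OF \<pi>_smooth] .

lemma openin_fibres:
  assumes "openin (mtop M) U"
  shows "openin (mtop TP) (points TP \<inter> \<pi> -` U)"
proof -
  have "continuous_map (mtop TP) (mtop M) \<pi>" using \<pi>_smooth by (simp add: smooth_map_def)
  from openin_continuous_map_preimage[OF this assms] show ?thesis
    by (simp add: topspace_mtop vimage_def Int_def)
qed

text \<open>Trivializations restrict the atlas to a full preimage under \<pi>, which may contain
  junk outside the total space, while openness concerns only the part inside
  \<open>points TP\<close>. Both yield the same atlas.\<close>

lemma restrict_atlas_points: "restrict_atlas A (points A \<inter> S) = restrict_atlas A S"
  unfolding restrict_atlas_def points_def by (rule image_cong) fastforce+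

text \<open>The \<open>G\<close>-component \<open>\<theta>\<close> of a local trivialization over \<open>U\<close>.\<close>

definition gauge :: "'a set \<Rightarrow> ('p \<Rightarrow> 'g) \<Rightarrow> bool" where
  "gauge U \<theta> \<longleftrightarrow> openin (mtop M) U \<and>
     (\<forall>p\<in>points TP. \<pi> p \<in> U \<longrightarrow> \<theta> p \<in> carrier G) \<and>
     (\<forall>p\<in>points TP. \<forall>g\<in>carrier G. \<pi> p \<in> U \<longrightarrow> \<theta> (pact P p g) = \<theta> p \<otimes>\<^bsub>G\<^esub> g) \<and>
     (\<forall>p\<in>points TP. \<forall>p'\<in>points TP. \<pi> p \<in> U \<longrightarrow> \<pi> p = \<pi> p' \<longrightarrow> \<theta> p = \<theta> p' \<longrightarrow> p = p') \<and>
     (\<forall>\<gamma> t. diff_curve TP \<gamma> t \<longrightarrow> \<pi> (\<gamma> t) \<in> U \<longrightarrow> diff_curve TG (\<lambda>s. \<theta> (\<gamma> s)) t)"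

lemma gaugeD:
  assumes "gauge U \<theta>"
  shows "openin (mtop M) U"
    "p \<in> points TP \<Longrightarrow> \<pi> p \<in> U \<Longrightarrow> \<theta> p \<in> carrier G"
    "p \<in> points TP \<Longrightarrow> \<pi> p \<in> U \<Longrightarrow> g \<in> carrier G \<Longrightarrow> \<theta> (pact P p g) = \<theta> p \<otimes>\<^bsub>G\<^esub> g"
    "p \<in> points TP \<Longrightarrow> p' \<in> points TP \<Longrightarrow> \<pi> p \<in> U \<Longrightarrow> \<pi> p = \<pi> p' \<Longrightarrow> \<theta> p = \<theta> p' \<Longrightarrow> p = p'"
    "diff_curve TP \<gamma> t \<Longrightarrow> \<pi> (\<gamma> t) \<in> U \<Longrightarrow> diff_curve TG (\<lambda>s. \<theta> (\<gamma> s)) t"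
  using assms unfolding gauge_def by blast+

lemma gauge_exists:
  assumes "x \<in> points M"
  obtains U \<theta> where "x \<in> U" "gauge U \<theta>"
proof -
  obtain U \<psi> where U: "x \<in> U" "trivialization TP M \<pi> TG U \<psi>"
    and eq: "\<And>p g. p \<in> points TP \<inter> \<pi> -` U \<Longrightarrow> g \<in> carrier G \<Longrightarrow>
           \<psi> (pact P p g) = (\<pi> p, mult G (snd (\<psi> p)) g)"
  proof -
    have "\<forall>x\<in>points M. \<exists>U \<psi>. x \<in> U \<and> trivialization TP M \<pi> TG U \<psi> \<and>
        (\<forall>p\<in>points TP \<inter> \<pi> -` U. \<forall>g\<in>carrier G. \<psi> (pact P p g) = (\<pi> p, mult G (snd (\<psi> p)) g))"
      using P unfolding principal_bundle_def by (elim conjE)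
    from bspec[OF this assms] show thesis using that by (elim exE conjE) simp
  qed
  have U': "openin (mtop M) U" and bij: "bij_betw \<psi> (points TP \<inter> \<pi> -` U) ((points M \<inter> U) \<times> carrier G)"
    and sm: "smooth_map (restrict_atlas TP (\<pi> -` U)) (prod_atlas (restrict_atlas M U) TG) \<psi>"
    and fst: "\<And>p. p \<in> points TP \<inter> \<pi> -` U \<Longrightarrow> fst (\<psi> p) = \<pi> p"
    using U(2) by (auto simp: trivialization_def diffeo_def points_prod_atlas points_restrict_atlas)
  have "gauge U (\<lambda>p. snd (\<psi> p))"
    unfolding gauge_def
  proof (intro conjI ballI allI impI)
    show "snd (\<psi> p) \<in> carrier G" if "p \<in> points TP" "\<pi> p \<in> U" for p
      using bij_betw_apply[OF bij, of p] that by (auto simp: mem_Times_iff)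
    show "snd (\<psi> (pact P p g)) = snd (\<psi> p) \<otimes>\<^bsub>G\<^esub> g"
      if "p \<in> points TP" "g \<in> carrier G" "\<pi> p \<in> U" for p g
      using eq[of p g] that by simp
    show "p = p'" if "p \<in> points TP" "p' \<in> points TP" "\<pi> p \<in> U" "\<pi> p = \<pi> p'" "snd (\<psi> p) = snd (\<psi> p')" for p p'
      using inj_onD[OF bij_betw_imp_inj_on[OF bij], of p p'] that fst by (simp add: prod_eq_iff)
    show "diff_curve TG (\<lambda>s. snd (\<psi> (\<gamma> s))) t" if "diff_curve TP \<gamma> t" "\<pi> (\<gamma> t) \<in> U" for \<gamma> t
    proof -
      have "diff_curve (restrict_atlas TP (points TP \<inter> \<pi> -` U)) \<gamma> t"
        using diff_curve_restrict[OF tops(2) that(1) openin_fibres[OF U']] diff_curve_point[OF that(1)] that(2)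
        by simp
      moreover have "topological_atlas (restrict_atlas TP (points TP \<inter> \<pi> -` U))"
        using restrict_topological_atlas[OF tops(2) openin_fibres[OF U']] .
      ultimately show ?thesis
        using diff_curve_snd[OF diff_curve_map[OF _ sm]] by (simp add: restrict_atlas_points)
    qed
  qed (rule U')
  then show thesis using that U(1) by blast
qed

text \<open>Freeness of the action is not among the axioms of \<open>principal_bundle\<close>; it
  comes from the equivariance of a trivialization and cancellation in the group.\<close>

lemma pact_eq_iff:
  assumes "p \<in> points TP" "g \<in> carrier G" "k \<in> carrier G" "pact P p g = pact P p k"
  shows "g = k"
proof -
  obtain U \<theta> where U: "\<pi> p \<in> U" "gauge U \<theta>"
    using gauge_exists[OF \<pi>_points[OF assms(1)]] .
  note \<theta> = gaugeD[OF U(2)]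
  have "\<theta> p \<otimes>\<^bsub>G\<^esub> g = \<theta> p \<otimes>\<^bsub>G\<^esub> k"
    using \<theta>(3)[OF assms(1) U(1) assms(2)] \<theta>(3)[OF assms(1) U(1) assms(3)] assms(4) by simp
  then show ?thesis using \<theta>(2)[OF assms(1) U(1)] assms(2,3) by simp
qed

lemma pdiv_unique:
  assumes "p \<in> points TP" "g \<in> carrier G" "pact P p g = p'"
  shows "pdiv G P p p' = g"
  unfolding pdiv_def using assms pact_eq_iff by (intro the_equality) auto

text \<open>A trivialization turns division in the fibre into division in the group. This gives
  transitivity on fibres and, through \<open>diff_curve_pdiv\<close>, differentiability of
  quotients.\<close>

lemma pdiv_gauge:
  assumes "p \<in> points TP" "p' \<in> points TP" "\<pi> p = \<pi> p'" "\<pi> p \<in> U" and U: "gauge U \<theta>"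
  shows "pdiv G P p p' = inv\<^bsub>G\<^esub> \<theta> p \<otimes>\<^bsub>G\<^esub> \<theta> p'" "pact P p (inv\<^bsub>G\<^esub> \<theta> p \<otimes>\<^bsub>G\<^esub> \<theta> p') = p'"
proof -
  note \<theta> = gaugeD[OF U]
  let ?g = "inv\<^bsub>G\<^esub> \<theta> p \<otimes>\<^bsub>G\<^esub> \<theta> p'"
  have c: "\<theta> p \<in> carrier G" "\<theta> p' \<in> carrier G" using \<theta>(2) assms(1-4) by auto
  then have g: "?g \<in> carrier G" by simp
  have "\<theta> (pact P p ?g) = \<theta> p'"
    using \<theta>(3)[OF assms(1,4) g] c by (simp add: m_assoc[symmetric])
  then show "pact P p ?g = p'" using \<theta>(4)[of "pact P p ?g" p'] assms(1-4) g by simp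
  then show "pdiv G P p p' = ?g" using pdiv_unique[OF assms(1) g] by simp
qed

lemma pdiv_works:
  assumes "p \<in> points TP" "p' \<in> points TP" "\<pi> p = \<pi> p'"
  shows "pdiv G P p p' \<in> carrier G" "pact P p (pdiv G P p p') = p'"
proof -
  obtain U \<theta> where U: "\<pi> p \<in> U" "gauge U \<theta>"
    using gauge_exists[OF \<pi>_points[OF assms(1)]] .
  have "inv\<^bsub>G\<^esub> \<theta> p \<otimes>\<^bsub>G\<^esub> \<theta> p' \<in> carrier G" using U(1) gaugeD(2)[OF U(2)] assms by simp
  then show "pdiv G P p p' \<in> carrier G" "pact P p (pdiv G P p p') = p'"
    using pdiv_gauge[OF assms U] by (simp_all only:)
qed

section \<open>Group operations and fibrewise division along curves\<close>

lemma diff_curve_mult: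
  assumes "diff_curve TG g t" "diff_curve TG k t"
  shows "diff_curve TG (\<lambda>s. g s \<otimes>\<^bsub>G\<^esub> k s) t"
  using diff_curve_map[OF prod_topological_atlas[OF tops(3) tops(3)] mult_smooth diff_curve_Pair[OF assms]]
  by simp

lemma diff_curve_inv:
  "diff_curve TG g t \<Longrightarrow> diff_curve TG (\<lambda>s. inv\<^bsub>G\<^esub> g s) t"
  using diff_curve_map[OF tops(3) inv_smooth] .

lemma diff_curve_pdiv:
  assumes "diff_curve TP a t" "diff_curve TP b t" "\<forall>\<^sub>F s in nhds t. \<pi> (a s) = \<pi> (b s)"
  shows "diff_curve TG (\<lambda>s. pdiv G P (a s) (b s)) t"
proof -
  note pa = diff_curve_point[OF assms(1)]
  have eq: "\<pi> (b t) = \<pi> (a t)" using eventually_nhds_x_imp_x[OF assms(3)] by simp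
  obtain U \<theta> where U: "\<pi> (a t) \<in> U" "gauge U \<theta>"
    using gauge_exists[OF \<pi>_points[OF pa]] .
  note \<theta> = gaugeD[OF U(2)]
  have "diff_curve TG (\<lambda>s. inv\<^bsub>G\<^esub> \<theta> (a s) \<otimes>\<^bsub>G\<^esub> \<theta> (b s)) t"
    using U(1) eq by (intro diff_curve_mult diff_curve_inv \<theta>(5) assms(1,2)) auto
  moreover have "\<forall>\<^sub>F s in nhds t. a s \<in> points TP \<inter> \<pi> -` U"
    using diff_curve_eventually[OF tops(2) assms(1) openin_fibres[OF \<theta>(1)]] pa U(1) by simp
  then have "\<forall>\<^sub>F s in nhds t. inv\<^bsub>G\<^esub> \<theta> (a s) \<otimes>\<^bsub>G\<^esub> \<theta> (b s) = pdiv G P (a s) (b s)"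
    using diff_curve_eventually_points[OF tops(2) assms(2)] assms(3)
    by eventually_elim (use pdiv_gauge(1)[OF _ _ _ _ U(2)] in simp)
  ultimately show ?thesis by (rule diff_curve_cong)
qed

text \<open>Reindexing the orbit by left translation in \<open>G\<close>. The operation
  \<open>act\<close> is arbitrary apart from the product law at \<open>y\<close>, as the lemma is
  used for the action on \<open>N\<close> and for its tangent action.\<close>

lemma assoc_class_pact:
  assumes "p \<in> points TP" "g \<in> carrier G"
    and mult: "\<And>a b. a \<in> carrier G \<Longrightarrow> b \<in> carrier G \<Longrightarrow> act (a \<otimes>\<^bsub>G\<^esub> b) y = act a (act b y)"
  shows "assoc_class G P act (pact P p g) y = assoc_class G P act p (act g y)"
proof (intro equalityI subsetI)
  fix z assume "z \<in> assoc_class G P act (pact P p g) y"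
  then obtain k where k: "k \<in> carrier G" "z = (pact P (pact P p g) k, act (inv\<^bsub>G\<^esub> k) y)"
    by (auto simp: assoc_class_def)
  have "act (inv\<^bsub>G\<^esub> (g \<otimes>\<^bsub>G\<^esub> k)) (act g y) = act (inv\<^bsub>G\<^esub> k) y"
    using mult[of "inv\<^bsub>G\<^esub> (g \<otimes>\<^bsub>G\<^esub> k)" g] assms(2) k(1) by (simp add: inv_mult_group m_assoc)
  then show "z \<in> assoc_class G P act p (act g y)"
    using k assms(1,2) by (auto simp: assoc_class_def pact_mult intro!: exI[of _ "g \<otimes>\<^bsub>G\<^esub> k"])
next
  fix z assume "z \<in> assoc_class G P act p (act g y)"
  then obtain k where k: "k \<in> carrier G" "z = (pact P p k, act (inv\<^bsub>G\<^esub> k) (act g y))"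
    by (auto simp: assoc_class_def)
  let ?k = "inv\<^bsub>G\<^esub> g \<otimes>\<^bsub>G\<^esub> k"
  have "act (inv\<^bsub>G\<^esub> ?k) y = act (inv\<^bsub>G\<^esub> k) (act g y)"
    using mult[of "inv\<^bsub>G\<^esub> k" g] assms(2) k(1) by (simp add: inv_mult_group)
  moreover have "pact P (pact P p g) ?k = pact P p k"
    using assms(1,2) k(1) by (simp add: pact_mult[symmetric] m_assoc[symmetric])
  ultimately show "z \<in> assoc_class G P act (pact P p g) y"
    using k assms(2) by (auto simp: assoc_class_def intro!: exI[of _ ?k])
qed

end

locale associated = principal M G P
  for M :: "('a, 'e::model_space) atlas" and G :: "('g, 'l::model_space) lie_group_data"
    and P :: "('p, 'q::model_space, 'a, 'g) principal_data" +
  fixes N :: "('n, 'd::model_space) atlas" and act :: "'g \<Rightarrow> 'n \<Rightarrow> 'n"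
  assumes N: "manifold N" and act: "smooth_left_action G N act"
begin

lemmas topN = manifold_topological_atlas[OF N]

lemma act_one [simp]: "y \<in> points N \<Longrightarrow> act \<one>\<^bsub>G\<^esub> y = y"
  and act_mult: "g \<in> carrier G \<Longrightarrow> k \<in> carrier G \<Longrightarrow> y \<in> points N \<Longrightarrow>
    act (g \<otimes>\<^bsub>G\<^esub> k) y = act g (act k y)"
  and act_smooth: "smooth_map (prod_atlas TG N) N (\<lambda>(g, y). act g y)"
  using act by (auto simp: smooth_left_action_def)

lemma act_points [simp]: "g \<in> carrier G \<Longrightarrow> y \<in> points N \<Longrightarrow> act g y \<in> points N"
  using smooth_map_points[OF act_smooth, of "(g, y)"] by (simp add: points_prod_atlas)

lemma act_act_inv [simp]: "g \<in> carrier G \<Longrightarrow> y \<in> points N \<Longrightarrow> act g (act (inv\<^bsub>G\<^esub> g) y) = y"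
  by (simp_all flip: act_mult)

lemma diff_curve_act:
  assumes "diff_curve TG g t" "diff_curve N y t"
  shows "diff_curve N (\<lambda>s. act (g s) (y s)) t"
  using diff_curve_map[OF prod_topological_atlas[OF tops(3) topN] act_smooth diff_curve_Pair[OF assms]]
  by simp

text \<open>Smoothness is given for the joint map on the product; freezing the group element is
  composition with \<open>n \<mapsto> (g, n)\<close>.\<close>

lemma act_chart_deriv:
  assumes "g \<in> carrier G" "n \<in> points N"
  obtains L where "chart_deriv (chart_at N n) (chart_at N (act g n)) (act g) n L"
proof -
  note cN = chart_at_mem[OF assms(2)] and cn = chart_at_mem[OF act_points[OF assms]]
    and cG = chart_at_mem[of g TG, simplified, OF assms(1)]
  have P: "chart_deriv (chart_at N n) (prod_chart (chart_at TG g) (chart_at N n))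
      (\<lambda>n. (g, n)) n (\<lambda>v. (0, v))"
    by (rule chart_deriv_Pair[OF chart_deriv_const[OF topN cN cG(2)] chart_deriv_ident[OF topN cN]])
  obtain L where "chart_deriv (prod_chart (chart_at TG g) (chart_at N n)) (chart_at N (act g n))
      (\<lambda>(g, y). act g y) (g, n) L"
    using smooth_map_chart_deriv[OF prod_topological_atlas[OF tops(3) topN] act_smooth
        prod_chart_mem[OF cG(1) cN(1)] cn(1), of "(g, n)"] cG(2) cN(2) cn(2)
    by (auto simp: prod_chart_def)
  from chart_deriv_comp[OF P this] show thesis using that by simp
qed

lemma tangent_action_velocity:
  assumes "g \<in> carrier G" "diff_curve N y t"
  shows "tangent_action N act g (velocity N y t) = velocity N (\<lambda>s. act g (y s)) t"
proof -
  note yt = diff_curve_point[OF assms(2)]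
  obtain L where L: "chart_deriv (chart_at N (y t)) (chart_at N (act g (y t))) (act g) (y t) L"
    using act_chart_deriv[OF assms(1) yt] .
  obtain v where v: "curve_deriv (chart_at N (y t)) y t v"
    using diff_curve_chart[OF N assms(2) chart_at_mem[OF yt]] .
  show ?thesis
    using velocity_eq[OF v] velocity_eq[OF curve_deriv_comp[OF v L]] tangent_map_eq[OF L]
    by (simp add: tangent_action_def)
qed

lemma tangent_action_mult:
  assumes "g \<in> carrier G" "k \<in> carrier G" "y \<in> points N"
  shows "tangent_action N act (g \<otimes>\<^bsub>G\<^esub> k) (y, v) = tangent_action N act g (tangent_action N act k (y, v))"
proof -
  obtain L where L: "chart_deriv (chart_at N y) (chart_at N (act k y)) (act k) y L"
    using act_chart_deriv[OF assms(2,3)] .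
  obtain L' where L': "chart_deriv (chart_at N (act k y)) (chart_at N (act g (act k y))) (act g) (act k y) L'"
    using act_chart_deriv[OF assms(1), of "act k y"] assms by auto
  obtain L'' where L'': "chart_deriv (chart_at N y) (chart_at N (act (g \<otimes>\<^bsub>G\<^esub> k) y)) (act (g \<otimes>\<^bsub>G\<^esub> k)) y L''"
    using act_chart_deriv[OF m_closed[OF assms(1,2)] assms(3)] .
  have "chart_deriv (chart_at N y) (chart_at N (act (g \<otimes>\<^bsub>G\<^esub> k) y)) (\<lambda>y. act g (act k y)) y (\<lambda>v. L' (L v))"
    using chart_deriv_comp[OF L L'] assms by (simp add: act_mult)
  then have "chart_deriv (chart_at N y) (chart_at N (act (g \<otimes>\<^bsub>G\<^esub> k) y)) (act (g \<otimes>\<^bsub>G\<^esub> k)) y (\<lambda>v. L' (L v))"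
  proof (rule chart_deriv_cong[OF topN chart_at_mem(1)[OF assms(3)]])
    show "act g (act k z) = act (g \<otimes>\<^bsub>G\<^esub> k) z" if "z \<in> points N" for z
      using that assms by (simp add: act_mult)
  qed
  from chart_deriv_unique[OF L'' this] have "L'' v = L' (L v)" by simp
  then show ?thesis
    using tangent_map_eq[OF L] tangent_map_eq[OF L'] tangent_map_eq[OF L''] assms
    by (simp add: tangent_action_def act_mult)
qed

section \<open>Classes, division and charts of the associated bundle\<close>

lemma assoc_class_eqD:
  assumes "p \<in> points TP" "p' \<in> points TP" "y \<in> points N"
    and "assoc_class G P act p y = assoc_class G P act p' y'"
  shows "\<pi> p = \<pi> p'" "\<exists>g\<in>carrier G. p = pact P p' g \<and> y = act (inv\<^bsub>G\<^esub> g) y'"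
proof -
  have "(p, y) \<in> assoc_class G P act p y"
    unfolding assoc_class_def using assms(1,3) by (intro CollectI exI[of _ "\<one>\<^bsub>G\<^esub>"]) simp
  then have "(p, y) \<in> assoc_class G P act p' y'" using assms(4) by simp
  then show *: "\<exists>g\<in>carrier G. p = pact P p' g \<and> y = act (inv\<^bsub>G\<^esub> g) y'"
    by (auto simp: assoc_class_def)
  then show "\<pi> p = \<pi> p'" using assms(2) by auto
qed

text \<open>The representatives differ by an element fixing \<open>p\<close>, which is the identity
  by freeness. This is the uniqueness behind \<open>adiv\<close>.\<close>

lemma assoc_class_inj:
  assumes "p \<in> points TP" "y \<in> points N" "y' \<in> points N"
    and "assoc_class G P act p y = assoc_class G P act p y'"
  shows "y = y'"
proof -
  obtain g where g: "g \<in> carrier G" "p = pact P p g" "y = act (inv\<^bsub>G\<^esub> g) y'"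
    using assoc_class_eqD(2)[OF assms(1,1,2,4)] by blast
  have "g = \<one>\<^bsub>G\<^esub>" using pact_eq_iff[OF assms(1) g(1) one_closed] g(2) assms(1) by simp
  then show ?thesis using g(3) assms(3) by simp
qed

lemma adiv_assoc_class:
  assumes "p \<in> points TP" "y \<in> points N"
  shows "adiv G P N act p (assoc_class G P act p y) = y"
  unfolding adiv_def
proof (rule the_equality)
  fix y' assume "y' \<in> points N \<and> assoc_class G P act p y = assoc_class G P act p y'"
  then show "y' = y" using assoc_class_inj[OF assms] by metis
qed (use assms in simp)

lemma assoc_class_pact_act:
  assumes "p \<in> points TP" "g \<in> carrier G" "y \<in> points N"
  shows "assoc_class G P act (pact P p g) y = assoc_class G P act p (act g y)"
  using assms by (intro assoc_class_pact) (auto simp: act_mult)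

lemma local_sectionD:
  assumes "local_section M P U \<sigma>"
  shows "openin (mtop M) U" "x \<in> U \<Longrightarrow> \<sigma> x \<in> points TP" "x \<in> U \<Longrightarrow> \<pi> (\<sigma> x) = x"
    "diff_curve M \<gamma> t \<Longrightarrow> \<gamma> t \<in> U \<Longrightarrow> diff_curve TP (\<lambda>s. \<sigma> (\<gamma> s)) t"
proof -
  show U: "openin (mtop M) U" and "x \<in> U \<Longrightarrow> \<pi> (\<sigma> x) = x"
    using assms by (auto simp: local_section_def)
  have sm: "smooth_map (restrict_atlas M U) TP \<sigma>" using assms by (simp add: local_section_def)
  have sub: "U \<subseteq> points M" using openin_subset[OF U] by (simp add: topspace_mtop)
  show "x \<in> U \<Longrightarrow> \<sigma> x \<in> points TP"
    using smooth_map_points[OF sm] sub by (auto simp: points_restrict_atlas)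
  show "diff_curve M \<gamma> t \<Longrightarrow> \<gamma> t \<in> U \<Longrightarrow> diff_curve TP (\<lambda>s. \<sigma> (\<gamma> s)) t"
    using diff_curve_map[OF restrict_topological_atlas[OF tops(1) U] sm]
      diff_curve_restrict[OF tops(1) _ U] by blast
qed

text \<open>Writing \<open>p\<close> as \<open>\<sigma> (\<pi> p)\<close> times a group element and
  moving that element across the class exhibits a preimage under \<Phi>; injectivity of \<Phi> on
  \<open>D\<close> then evaluates \<open>inv_into\<close>.\<close>

lemma assoc_chart_apply:
  assumes \<sigma>: "local_section M P U' \<sigma>" and W: "W \<subseteq> points N" and D: "D = (U \<inter> U') \<times> W"
    and \<Phi>: "\<Phi> = (\<lambda>(x, y). assoc_class G P act (\<sigma> x) y)"
    and p: "p \<in> points TP" "\<pi> p \<in> U \<inter> U'" and y: "y \<in> points N"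
    and mem: "act (pdiv G P (\<sigma> (\<pi> p)) p) y \<in> W"
  shows "inv_into D \<Phi> (assoc_class G P act p y) = (\<pi> p, act (pdiv G P (\<sigma> (\<pi> p)) p) y)"
    "assoc_class G P act p y \<in> \<Phi> ` D"
proof -
  note s = local_sectionD[OF \<sigma>]
  let ?k = "pdiv G P (\<sigma> (\<pi> p)) p"
  have \<sigma>p: "\<sigma> (\<pi> p) \<in> points TP" "\<pi> (\<sigma> (\<pi> p)) = \<pi> p" using s(2,3) p(2) by auto
  note k = pdiv_works[OF \<sigma>p(1) p(1) \<sigma>p(2)]
  have eq: "assoc_class G P act p y = \<Phi> (\<pi> p, act ?k y)"
    using assoc_class_pact_act[OF \<sigma>p(1) k(1) y] k(2) by (simp add: \<Phi>)
  have mem': "(\<pi> p, act ?k y) \<in> D" using mem p(2) by (simp add: D)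
  have "inj_on \<Phi> D"
  proof (rule inj_onI)
    fix z z' assume z: "z \<in> D" "z' \<in> D" "\<Phi> z = \<Phi> z'"
    obtain x y x' y' where xy: "z = (x, y)" "z' = (x', y')" by fastforce
    have m: "x \<in> U'" "x' \<in> U'" "y \<in> points N" "y' \<in> points N" using z W by (auto simp: D xy)
    have e: "assoc_class G P act (\<sigma> x) y = assoc_class G P act (\<sigma> x') y'" using z(3) by (simp add: \<Phi> xy)
    have "x = x'" using assoc_class_eqD(1)[OF s(2)[OF m(1)] s(2)[OF m(2)] m(3) e] s(3) m by simp
    then show "z = z'" using assoc_class_inj[OF s(2)[OF m(1)] m(3,4)] e by (simp add: xy)
  qed
  then show "inv_into D \<Phi> (assoc_class G P act p y) = (\<pi> p, act ?k y)"
    unfolding eq using mem' by simp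
  show "assoc_class G P act p y \<in> \<Phi> ` D" unfolding eq using mem' by blast
qed

text \<open>The coordinate expression of a curve of classes \<open>[a s, b s]\<close>. It is applied
  to the flow line of the field induced on the associated bundle and to the representing curves in
  \<open>nu\<close>.\<close>

lemma assoc_chart_curve:
  assumes \<sigma>: "local_section M P U' \<sigma>" and c: "(U, \<phi>) \<in> M" "(W, \<eta>) \<in> N" and D: "D = (U \<inter> U') \<times> W"
    and \<Phi>: "\<Phi> = (\<lambda>(x, y). assoc_class G P act (\<sigma> x) y)"
    and a: "diff_curve TP a t" and b: "diff_curve N b t" and at: "\<pi> (a t) \<in> U \<inter> U'"
    and k: "k = (\<lambda>s. pdiv G P (\<sigma> (\<pi> (a s))) (a s))" and mem: "act (k t) (b t) \<in> W"
  shows "diff_curve TG k t" "diff_curve N (\<lambda>s. act (k s) (b s)) t"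
    "\<forall>\<^sub>F s in nhds t. assoc_class G P act (a s) (b s) \<in> \<Phi> ` D \<and>
       (map_prod \<phi> \<eta> \<circ> inv_into D \<Phi>) (assoc_class G P act (a s) (b s)) = (\<phi> (\<pi> (a s)), \<eta> (act (k s) (b s)))"
    "\<forall>\<^sub>F s in nhds t. a s \<in> points TP \<and> \<pi> (a s) \<in> U' \<and> k s \<in> carrier G \<and> pact P (\<sigma> (\<pi> (a s))) (k s) = a s"
proof -
  note s = local_sectionD[OF \<sigma>]
  have m: "diff_curve M (\<lambda>s. \<pi> (a s)) t" using diff_curve_map[OF tops(2) \<pi>_smooth a] .
  have UU: "openin (mtop M) (U \<inter> U')" using openin_mtop_chart_dom[OF c(1)] s(1) by auto
  have ev1: "\<forall>\<^sub>F s in nhds t. \<pi> (a s) \<in> U \<inter> U'" using diff_curve_eventually[OF tops(1) m UU at] .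
  have d: "diff_curve TP (\<lambda>s. \<sigma> (\<pi> (a s))) t" using s(4)[OF m] at by simp
  show k': "diff_curve TG k t"
    unfolding k by (rule diff_curve_pdiv[OF d a]) (use ev1 s(3) in \<open>auto elim!: eventually_mono\<close>)
  then show kb: "diff_curve N (\<lambda>s. act (k s) (b s)) t" using b by (rule diff_curve_act)
  have Wo: "openin (mtop N) W" using openin_mtop_chart_dom[OF c(2)] by simp
  have W: "W \<subseteq> points N" using openin_subset[OF Wo] by (simp add: topspace_mtop)
  have ev: "\<forall>\<^sub>F s in nhds t. a s \<in> points TP" "\<forall>\<^sub>F s in nhds t. b s \<in> points N"
    "\<forall>\<^sub>F s in nhds t. act (k s) (b s) \<in> W"
    using diff_curve_eventually_points[OF tops(2) a] diff_curve_eventually_points[OF topN b]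
      diff_curve_eventually[OF topN kb Wo mem] by auto
  show "\<forall>\<^sub>F s in nhds t. assoc_class G P act (a s) (b s) \<in> \<Phi> ` D \<and>
       (map_prod \<phi> \<eta> \<circ> inv_into D \<Phi>) (assoc_class G P act (a s) (b s)) = (\<phi> (\<pi> (a s)), \<eta> (act (k s) (b s)))"
    using ev ev1
  proof eventually_elim
    case (elim s)
    show ?case
      using assoc_chart_apply[OF \<sigma> W D \<Phi> elim(1,4,2) elim(3)[unfolded k]] by (simp add: k)
  qed
  show "\<forall>\<^sub>F s in nhds t. a s \<in> points TP \<and> \<pi> (a s) \<in> U' \<and> k s \<in> carrier G \<and> pact P (\<sigma> (\<pi> (a s))) (k s) = a s"
    using ev(1) ev1
    by eventually_elim (use pdiv_works s(2,3) in \<open>simp add: k\<close>)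
qed

end

section \<open>Smooth curves with prescribed velocity\<close>

lemma Ck_on_cong:
  assumes "open S" "\<And>x. x \<in> S \<Longrightarrow> f x = g x" "Ck_on k f S"
  shows "Ck_on k g S"
  using assms(2,3)
proof (induction k arbitrary: f g)
  case 0
  then show ?case by (simp cong: continuous_on_cong)
next
  case (Suc k)
  have D: "(g has_derivative frechet_derivative f (at x)) (at x)" if "x \<in> S" for x
    by (rule has_derivative_transform_within_open[of f _ _ UNIV, OF _ assms(1)])
      (use Suc.prems that in \<open>auto simp: frechet_derivative_works[symmetric]\<close>)
  have "frechet_derivative g (at x) = frechet_derivative f (at x)" if "x \<in> S" for x
    using frechet_derivative_at[OF D[OF that]] by simp
  then have "Ck_on k (\<lambda>x. frechet_derivative g (at x) v) S" for v
    using Suc.IH[of "\<lambda>x. frechet_derivative f (at x) v"] Suc.prems(2) by simp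
  then show ?case using D by (auto simp: differentiable_def)
qed

text \<open>For an affine inner map the derivative in direction \<open>s\<close> is again a function
  of the same shape, a directional derivative of \<open>f\<close> along the line, so the induction
  closes without a general chain rule of higher order.\<close>

lemma Ck_on_affine:
  assumes "open S" "Ck_on k f S"
  shows "Ck_on k (\<lambda>t::real. f (a + t *\<^sub>R w)) {t. a + t *\<^sub>R w \<in> S}"
  using assms(2)
proof (induction k arbitrary: f)
  case 0
  then have "continuous_on S f" by simp
  then have "continuous_on {t. a + t *\<^sub>R w \<in> S} (\<lambda>t. f (a + t *\<^sub>R w))"
    by (rule continuous_on_compose2) (auto intro!: continuous_intros)
  then show ?case by simp
next
  case (Suc k)
  let ?T = "{t. a + t *\<^sub>R w \<in> S}"
  have op: "open ?T"
    using open_vimage[OF assms(1), of "\<lambda>t. a + t *\<^sub>R w"] by (simp add: vimage_def continuous_intros)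
  have D: "((\<lambda>t. f (a + t *\<^sub>R w)) has_derivative
      (\<lambda>s. frechet_derivative f (at (a + t *\<^sub>R w)) (s *\<^sub>R w))) (at t)" if "t \<in> ?T" for t
  proof (rule has_derivative_compose[where f = "\<lambda>t. a + t *\<^sub>R w"])
    show "((\<lambda>t. a + t *\<^sub>R w) has_derivative (\<lambda>s. s *\<^sub>R w)) (at t)"
      by (auto intro!: derivative_eq_intros)
    show "(f has_derivative frechet_derivative f (at (a + t *\<^sub>R w))) (at (a + t *\<^sub>R w))"
      using Suc.prems that by (simp add: frechet_derivative_works[symmetric])
  qed
  have "Ck_on k (\<lambda>t. frechet_derivative (\<lambda>t. f (a + t *\<^sub>R w)) (at t) s) ?T" for s
  proof (rule Ck_on_cong[OF op])
    show "Ck_on k (\<lambda>t. frechet_derivative f (at (a + t *\<^sub>R w)) (s *\<^sub>R w)) ?T"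
      using Suc.IH[of "\<lambda>x. frechet_derivative f (at x) (s *\<^sub>R w)"] Suc.prems by simp
    show "frechet_derivative f (at (a + t *\<^sub>R w)) (s *\<^sub>R w) =
        frechet_derivative (\<lambda>t. f (a + t *\<^sub>R w)) (at t) s" if "t \<in> ?T" for t
      using fun_cong[OF frechet_derivative_at[OF D[OF that]], of s] .
  qed
  then show ?case using D by (auto simp: differentiable_def)
qed

lemma Ck_on_const: "Ck_on k (\<lambda>_. c) S"
  by (induction k arbitrary: c) auto

section \<open>Smooth curves on an interval\<close>

lemma mtop_interval_atlas: "mtop (interval_atlas \<epsilon>) = top_of_set {-\<epsilon><..<\<epsilon>}"
proof -
  have "openin (mtop (interval_atlas \<epsilon>)) S \<longleftrightarrow> S \<subseteq> {-\<epsilon><..<\<epsilon>} \<and> open S" for S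
  proof
    assume "openin (mtop (interval_atlas \<epsilon>)) S"
    then show "S \<subseteq> {-\<epsilon><..<\<epsilon>} \<and> open S"
      by (induction rule: openin_mtop_induct) (auto simp: interval_atlas_def)
  next
    assume "S \<subseteq> {-\<epsilon><..<\<epsilon>} \<and> open S"
    then show "openin (mtop (interval_atlas \<epsilon>)) S"
      using openin_mtop_chart[of "{-\<epsilon><..<\<epsilon>}" "\<lambda>t. t" "interval_atlas \<epsilon>" S]
      by (simp add: interval_atlas_def Int_absorb1)
  qed
  then show ?thesis
    by (auto simp: topology_eq openin_open_eq)
qed

lemma interval_topological_atlas: "topological_atlas (interval_atlas \<epsilon>)"
  unfolding topological_atlas_def mtop_interval_atlas
  by (auto simp: interval_atlas_def openin_open_eq inj_on_def)

lemma smooth_interval_diff_curve: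
  assumes "smooth_map (interval_atlas \<epsilon>) A \<gamma>" "t \<in> {-\<epsilon><..<\<epsilon>}"
  shows "diff_curve A \<gamma> t"
proof (rule diff_curve_map[OF interval_topological_atlas assms(1)])
  have "curve_deriv ({-\<epsilon><..<\<epsilon>}, \<lambda>t. t) (\<lambda>s. s) t 1"
    using eventually_nhds_in_open[of "{-\<epsilon><..<\<epsilon>}" t] assms(2)
    by (simp add: curve_deriv_def comp_def)
  then show "diff_curve (interval_atlas \<epsilon>) (\<lambda>s. s) t"
    by (auto simp: diff_curve_def interval_atlas_def)
qed

lemma smooth_interval_const:
  assumes "y \<in> points A"
  shows "smooth_map (interval_atlas \<epsilon>) A (\<lambda>_. y)"
  using assms by (auto simp: smooth_map_def smooth_on_def comp_def Ck_on_const topspace_mtop)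

text \<open>The curve is a straight line in the chart. \<open>nu\<close> asks for representatives
  that are smooth on an interval, while \<open>nu_vertical\<close> is given a curve with a known
  derivative at 0 alone.\<close>

lemma smooth_interval_curve_exists:
  assumes A: "manifold A" and c: "(W, \<eta>) \<in> A" and n: "n \<in> W"
  obtains \<epsilon> \<gamma> where "\<epsilon> > 0" "smooth_map (interval_atlas \<epsilon>) A \<gamma>" "\<gamma> 0 = n" "curve_deriv (W, \<eta>) \<gamma> 0 w"
proof -
  note top = topological_atlasD[OF manifold_topological_atlas[OF A] c, simplified]
  let ?l = "\<lambda>t. \<eta> n + t *\<^sub>R w"
  have op: "open {t. ?l t \<in> S}" if "open S" for S
    using open_vimage[OF that, of ?l] by (simp add: vimage_def continuous_intros)
  then obtain \<epsilon> where \<epsilon>: "\<epsilon> > 0" "\<And>t. \<bar>t\<bar> < \<epsilon> \<Longrightarrow> ?l t \<in> \<eta> ` W"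
    using openE[OF op[OF top(3)], of 0] n by (auto simp: subset_iff dist_real_def)
  define J where "J = {-\<epsilon><..<\<epsilon>}"
  have J: "open J" "0 \<in> J" "\<And>t. t \<in> J \<Longrightarrow> ?l t \<in> \<eta> ` W"
    using \<epsilon> by (auto simp: J_def abs_less_iff)
  define \<gamma> where "\<gamma> = (\<lambda>t. inv_into W \<eta> (?l t))"
  have \<gamma>: "\<gamma> t \<in> W" "\<eta> (\<gamma> t) = ?l t" if "t \<in> J" for t
    using J(3)[OF that] by (auto simp: \<gamma>_def inv_into_into f_inv_into_f)
  have cd: "curve_deriv (W, \<eta>) \<gamma> t w" if "t \<in> J" for t
    unfolding curve_deriv_def fst_conv snd_conv
  proof
    show "\<forall>\<^sub>F s in nhds t. \<gamma> s \<in> W"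
      using eventually_nhds_in_open[OF J(1) that] by eventually_elim (rule \<gamma>)
    have "(?l has_vector_derivative w) (at t)" by (auto intro!: derivative_eq_intros)
    then show "(\<eta> \<circ> \<gamma> has_vector_derivative w) (at t)"
      by (rule has_vector_derivative_transform_within_open[OF _ J(1) that]) (simp add: \<gamma>)
  qed
  have cont: "continuous_map (top_of_set J) (mtop A) \<gamma>"
    using continuous_map_mtopI[OF A J(1)] cd c by blast
  have "smooth_on (\<psi> \<circ> \<gamma> \<circ> inv_into J (\<lambda>t. t)) ((\<lambda>t. t) ` (J \<inter> \<gamma> -` V))" if V: "(V, \<psi>) \<in> A" for V \<psi>
    unfolding smooth_on_def
  proof
    fix k
    note tr = manifold_transition[OF A c V]
    have "openin (top_of_set J) {t \<in> topspace (top_of_set J). \<gamma> t \<in> V}"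
      using openin_continuous_map_preimage[OF cont] openin_mtop_chart_dom[OF V] by simp
    then have op2: "open (J \<inter> \<gamma> -` V)" using J(1) by (simp add: openin_open_eq Int_def vimage_def)
    \<comment> \<open>Read in the chart \<psi>, the curve is the transition map along a straight
      line.\<close>
    have "Ck_on k (\<lambda>t. (\<psi> \<circ> inv_into W \<eta>) (?l t)) {t. ?l t \<in> \<eta> ` (W \<inter> V)}"
      using Ck_on_affine[OF tr(1), of k "\<psi> \<circ> inv_into W \<eta>"] tr(2) by (simp add: smooth_on_def)
    then have "Ck_on k (\<lambda>t. (\<psi> \<circ> inv_into W \<eta>) (?l t)) (J \<inter> \<gamma> -` V)"
    proof (rule Ck_on_subset)
      show "J \<inter> \<gamma> -` V \<subseteq> {t. ?l t \<in> \<eta> ` (W \<inter> V)}"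
        using \<gamma> by (fastforce intro: rev_image_eqI)
    qed
    then have "Ck_on k (\<psi> \<circ> \<gamma> \<circ> inv_into J (\<lambda>t. t)) (J \<inter> \<gamma> -` V)"
      by (rule Ck_on_cong[OF op2, rotated]) (simp add: \<gamma>_def inv_into_f_eq)
    then show "Ck_on k (\<psi> \<circ> \<gamma> \<circ> inv_into J (\<lambda>t. t)) ((\<lambda>t. t) ` (J \<inter> \<gamma> -` V))" by simp
  qed
  then have "smooth_map (interval_atlas \<epsilon>) A \<gamma>"
    using cont unfolding smooth_map_def mtop_interval_atlas
    by (auto simp: J_def interval_atlas_def)
  moreover have "\<gamma> 0 = n" using top(1) n by (simp add: \<gamma>_def)
  ultimately show thesis using that[OF \<epsilon>(1)] cd[OF J(2)] by blast
qed

lemma velocity_cong: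
  assumes "\<forall>\<^sub>F s in nhds t. \<gamma> s = \<delta> s"
  shows "velocity A \<gamma> t = velocity A \<delta> t"
proof -
  have eq: "\<gamma> t = \<delta> t" using eventually_nhds_x_imp_x[OF assms] .
  have "vector_derivative (\<phi> \<circ> \<gamma>) (at t) = vector_derivative (\<phi> \<circ> \<delta>) (at t)" for \<phi> :: "'a \<Rightarrow> 'b"
    by (rule vector_derivative_cong_eq) (use assms eq in \<open>auto elim: eventually_mono\<close>)
  then show ?thesis by (simp add: velocity_def eq)
qed

lemma velocity_eq_chart:
  assumes "manifold A" "c \<in> A" "curve_deriv c \<gamma> t v" "curve_deriv c \<delta> t v" "\<gamma> t = \<delta> t"
  shows "velocity A \<gamma> t = velocity A \<delta> t"
proof -
  note m = curve_deriv_mem[OF assms(3)]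
  note ca = chart_at_mem[OF chart_subset_points[OF assms(2) m]]
  obtain L where L: "chart_deriv c (chart_at A (\<gamma> t)) (\<lambda>x. x) (\<gamma> t) L"
    using chart_deriv_change[OF assms(1,2) ca(1) m ca(2)] .
  show ?thesis
    using velocity_eq[OF curve_deriv_comp[OF assms(3) L]]
      velocity_eq[of A \<delta> t "L v"] curve_deriv_comp[OF assms(4) L[unfolded assms(5)]] assms(5) by simp
qed

context associated
begin

text \<open>The derivative \<open>L\<close> of the action at \<open>(\<one>, k t)\<close> is linear,
  so it splits over the group direction and the direction in \<open>N\<close>; on the latter it is
  the identity, because the unit acts trivially.\<close>

lemma curve_deriv_act_product:
  assumes c: "c \<in> N" and a: "diff_curve TG a t" "a t = \<one>\<^bsub>G\<^esub>"
    and u: "curve_deriv c (\<lambda>s. act (a s) (k s)) t u"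
    and u1: "curve_deriv c (\<lambda>s. act (a s) (k t)) t u1"
    and u2: "curve_deriv c k t u2"
  shows "u = u1 + u2"
proof -
  have kt: "k t \<in> fst c" "k t \<in> points N" using curve_deriv_mem[OF u2] chart_subset_points[OF c] by auto
  define d where "d = chart_at TG (\<one>\<^bsub>G\<^esub>)"
  have d: "d \<in> TG" "\<one>\<^bsub>G\<^esub> \<in> fst d" using chart_at_mem[of "\<one>\<^bsub>G\<^esub>" TG] by (auto simp: d_def)
  obtain \<alpha> where \<alpha>: "curve_deriv d a t \<alpha>" using diff_curve_chart[OF G_manifold a(1) d(1)] d(2) a(2) by auto
  obtain L where L: "chart_deriv (prod_chart d c) c (\<lambda>(g, y). act g y) (\<one>\<^bsub>G\<^esub>, k t) L"
    using smooth_map_chart_deriv[OF prod_topological_atlas[OF tops(3) topN] act_smooth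
        prod_chart_mem[OF d(1) c] c, of "(\<one>\<^bsub>G\<^esub>, k t)"] kt d(2)
    by (auto simp: prod_chart_def)
  \<comment> \<open>One formula for three pairs of curves: both factors moving, only the group
    factor, only the point.\<close>
  have *: "curve_deriv c (\<lambda>s. act (g s) (y s)) t (L (v, w))"
    if "curve_deriv d g t v" "curve_deriv c y t w" "g t = \<one>\<^bsub>G\<^esub>" "y t = k t" for g y v w
    using curve_deriv_comp[OF curve_deriv_Pair[OF that(1,2)], of c "\<lambda>(g, y). act g y" L] L that(3,4) by simp
  have "L (\<alpha>, u2) = u" using curve_deriv_unique[OF *[OF \<alpha> u2 a(2) refl] u] .
  moreover have "L (\<alpha>, 0) = u1"
    using curve_deriv_unique[OF *[OF \<alpha> curve_deriv_const[OF kt(1)] a(2) refl] u1] .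
  moreover have "L (0, u2) = u2"
  proof -
    have "curve_deriv c (\<lambda>s. act \<one>\<^bsub>G\<^esub> (k s)) t (L (0, u2))"
      using *[OF curve_deriv_const[OF d(2)] u2] by simp
    moreover have "\<forall>\<^sub>F s in nhds t. k s \<in> fst c" using u2 by (simp add: curve_deriv_def)
    then have "\<forall>\<^sub>F s in nhds t. act \<one>\<^bsub>G\<^esub> (k s) = k s"
      by eventually_elim (use chart_subset_points[OF c] in simp)
    ultimately show ?thesis using curve_deriv_unique[OF curve_deriv_cong u2] by blast
  qed
  moreover have "L (\<alpha>, u2) = L (\<alpha>, 0) + L (0, u2)"
    using linear_add[OF chart_deriv_linear[OF L], of "(\<alpha>, 0)" "(0, u2)"] by simp
  ultimately show ?thesis by simp
qed

lemma assoc_class_tangent: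
  assumes "p \<in> points TP" "g \<in> carrier G" "y \<in> points N"
  shows "assoc_class G P (tangent_action N act) (pact P p g) (y, v) =
    assoc_class G P (tangent_action N act) p (tangent_action N act g (y, v))"
  using assms by (intro assoc_class_pact) (auto simp: tangent_action_mult)

abbreviation "B \<equiv> assoc_bundle M G P N act"

lemma nu_vertical:
  assumes c: "(U, \<phi>) \<in> M" "(W, \<eta>) \<in> N" and \<sigma>: "local_section M P U' \<sigma>"
    and D: "D = (U \<inter> U') \<times> W" and \<Phi>: "\<Phi> = (\<lambda>(x, y). assoc_class G P act (\<sigma> x) y)"
    and x: "x \<in> U \<inter> U'" and n: "n \<in> W" and z: "z = assoc_class G P act (\<sigma> x) n"
    and cz: "chart_at B z = (\<Phi> ` D, map_prod \<phi> \<eta> \<circ> inv_into D \<Phi>)"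
    and \<gamma>: "curve_deriv (W, \<eta>) \<gamma> 0 w" "\<gamma> 0 = n"
  shows "nu M G P N act (z, (0, w)) = assoc_class G P (tangent_action N act) (\<sigma> x) (velocity N \<gamma> 0)"
proof -
  note s = local_sectionD[OF \<sigma>]
  have \<sigma>x: "\<sigma> x \<in> points TP" "\<pi> (\<sigma> x) = x" using s(2,3) x by auto
  have W: "W \<subseteq> points N" using chart_subset_points[OF c(2)] by auto
  \<comment> \<open>For vertical \<open>a\<close> the base coordinate is constantly
    \<open>\<phi> x\<close>, which explains the component 0.\<close>
  have vel: "velocity B (\<lambda>t. assoc_class G P act (a t) (b t)) 0 = (z, (0, w'))"
    if a: "diff_curve TP a 0" and b: "diff_curve N b 0"
      and ax: "\<forall>\<^sub>F t in nhds 0. \<pi> (a t) = x" and ab: "assoc_class G P act (a 0) (b 0) = z"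
      and w': "curve_deriv (W, \<eta>) (\<lambda>t. act (pdiv G P (\<sigma> x) (a t)) (b t)) 0 w'" for a b w'
  proof -
    define k where "k = (\<lambda>s. pdiv G P (\<sigma> (\<pi> (a s))) (a s))"
    have a0: "\<pi> (a 0) = x" using eventually_nhds_x_imp_x[OF ax] .
    have k0: "act (k 0) (b 0) \<in> W" using curve_deriv_mem[OF w'] by (simp add: k_def a0)
    have "\<pi> (a 0) \<in> U \<inter> U'" using a0 x by simp
    note cc = assoc_chart_curve[OF \<sigma> c D \<Phi> a b this k_def k0]
    have "((\<lambda>t. (\<phi> x, (\<eta> \<circ> (\<lambda>t. act (pdiv G P (\<sigma> x) (a t)) (b t))) t)) has_vector_derivative (0, w')) (at 0)"
      using w' unfolding curve_deriv_def by (intro has_vector_derivative_Pair) (auto simp: comp_def)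
    moreover have "\<forall>\<^sub>F t in nhds 0.
        (\<phi> x, (\<eta> \<circ> (\<lambda>t. act (pdiv G P (\<sigma> x) (a t)) (b t))) t) =
        ((map_prod \<phi> \<eta> \<circ> inv_into D \<Phi>) \<circ> (\<lambda>t. assoc_class G P act (a t) (b t))) t"
      using cc(3) ax by eventually_elim (simp add: k_def)
    ultimately have "(((map_prod \<phi> \<eta> \<circ> inv_into D \<Phi>) \<circ> (\<lambda>t. assoc_class G P act (a t) (b t)))
        has_vector_derivative (0, w')) (at 0)"
      by (rule has_vector_derivative_eventually_cong)
    moreover have "\<forall>\<^sub>F t in nhds 0. assoc_class G P act (a t) (b t) \<in> \<Phi> ` D"
      using cc(3) by eventually_elim simp
    ultimately have "curve_deriv (chart_at B z) (\<lambda>t. assoc_class G P act (a t) (b t)) 0 (0, w')"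
      by (simp add: cz curve_deriv_def)
    then show ?thesis using velocity_eq[of B "\<lambda>t. assoc_class G P act (a t) (b t)" 0] ab by simp
  qed
  have uniq: "velocity B (\<lambda>t. assoc_class G P act (a t) (b t)) 0 = (z, (0, w)) \<Longrightarrow>
      assoc_class G P (tangent_action N act) (a 0) (velocity N (\<lambda>t. act (pdiv G P (a 0) (a t)) (b t)) 0) =
      assoc_class G P (tangent_action N act) (\<sigma> x) (velocity N \<gamma> 0)"
    if a: "diff_curve TP a 0" and b: "diff_curve N b 0" and av: "\<forall>\<^sub>F t in nhds 0. \<pi> (a t) = \<pi> (a 0)" for a b
  proof -
    assume v: "velocity B (\<lambda>t. assoc_class G P act (a t) (b t)) 0 = (z, (0, w))"
    note pa = diff_curve_point[OF a] and pb = diff_curve_point[OF b]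
    have ab: "assoc_class G P act (a 0) (b 0) = z" using v by (simp add: velocity_def)
    have a0: "\<pi> (a 0) = x" using assoc_class_eqD(1)[OF pa \<sigma>x(1) pb] ab \<sigma>x(2) by (simp add: z)
    define k where "k = (\<lambda>t. pdiv G P (\<sigma> x) (a t))"
    have k: "k t \<in> carrier G" "pact P (\<sigma> x) (k t) = a t" if "a t \<in> points TP" "\<pi> (a t) = x" for t
      using pdiv_works[OF \<sigma>x(1) that(1)] that(2) \<sigma>x(2) by (auto simp: k_def)
    note k0 = k[OF pa a0]
    have kn: "act (k 0) (b 0) = n"
    proof (rule assoc_class_inj[OF \<sigma>x(1)])
      show "assoc_class G P act (\<sigma> x) (act (k 0) (b 0)) = assoc_class G P act (\<sigma> x) n"
        using assoc_class_pact_act[OF \<sigma>x(1) k0(1) pb] k0(2) ab by (simp add: z)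
    qed (use k0 pb n W in auto)
    have dk: "diff_curve TG k 0"
      unfolding k_def by (rule diff_curve_pdiv[OF diff_curve_const[OF \<sigma>x(1)] a])
        (use av a0 \<sigma>x(2) in \<open>auto elim!: eventually_mono\<close>)
    define j where "j = (\<lambda>t. act (k t) (b t))"
    have j: "diff_curve N j 0" unfolding j_def by (rule diff_curve_act[OF dk b])
    obtain w' where w': "curve_deriv (W, \<eta>) j 0 w'"
      using diff_curve_chart[OF N j c(2)] kn n by (auto simp: j_def)
    \<comment> \<open>The chart reads the class as \<open>(\<phi> x, \<eta> (j t))\<close> near 0,
      so the prescribed velocity determines \<open>w'\<close>.\<close>
    have "velocity B (\<lambda>t. assoc_class G P act (a t) (b t)) 0 = (z, (0, w'))"
      using vel[OF a b _ ab] av a0 w' by (simp add: j_def k_def)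
    then have "w' = w" using v by simp
    then have vj: "velocity N j 0 = velocity N \<gamma> 0"
      using velocity_eq_chart[OF N c(2) w', of \<gamma>] \<gamma> kn by (simp add: j_def)
    have evp: "\<forall>\<^sub>F t in nhds 0. a t \<in> points TP" "\<forall>\<^sub>F t in nhds 0. b t \<in> points N"
      using diff_curve_eventually_points[OF tops(2) a] diff_curve_eventually_points[OF topN b] .
    define i where "i = (\<lambda>t. act (pdiv G P (a 0) (a t)) (b t))"
    have di: "diff_curve N i 0"
      unfolding i_def
      by (intro diff_curve_act b diff_curve_pdiv diff_curve_const pa a)
        (use av in \<open>auto elim!: eventually_mono\<close>)
    have "\<forall>\<^sub>F t in nhds 0. act (k 0) (i t) = j t"
      using evp av
    proof eventually_elim
      case (elim t)
      have pd: "pdiv G P (a 0) (a t) \<in> carrier G" "pact P (a 0) (pdiv G P (a 0) (a t)) = a t"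
        using pdiv_works[OF pa elim(1)] elim(3) by auto
      \<comment> \<open>The cocycle identity for division: passing from \<open>\<sigma> x\<close> to
        \<open>a t\<close> can be done through \<open>a 0\<close>.\<close>
      have "k t = k 0 \<otimes>\<^bsub>G\<^esub> pdiv G P (a 0) (a t)"
        unfolding k_def[THEN fun_cong, of t]
        using pdiv_unique[OF \<sigma>x(1), of "k 0 \<otimes>\<^bsub>G\<^esub> pdiv G P (a 0) (a t)" "a t"] pd k0
        by (simp add: pact_mult[OF \<sigma>x(1)])
      then show ?case using act_mult[OF k0(1) pd(1) elim(2)] by (simp add: i_def j_def)
    qed
    then have "velocity N j 0 = velocity N (\<lambda>t. act (k 0) (i t)) 0"
      using velocity_cong by metis
    also have "\<dots> = tangent_action N act (k 0) (velocity N i 0)"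
      using tangent_action_velocity[OF k0(1) di] by simp
    finally have "assoc_class G P (tangent_action N act) (\<sigma> x) (velocity N j 0) =
        assoc_class G P (tangent_action N act) (a 0) (velocity N i 0)"
      using assoc_class_tangent[OF \<sigma>x(1) k0(1) diff_curve_point[OF di]] k0(2)
      by (simp add: velocity_def)
    then show ?thesis by (simp add: vj i_def)
  qed
  \<comment> \<open>A representative for the existence half: the frame stays at
    \<open>\<sigma> x\<close> and only the component in \<open>N\<close> moves.\<close>
  obtain \<epsilon> b where b: "\<epsilon> > 0" "smooth_map (interval_atlas \<epsilon>) N b" "b 0 = n" "curve_deriv (W, \<eta>) b 0 w"
    using smooth_interval_curve_exists[OF N c(2) n] .
  have db: "diff_curve N b 0" using smooth_interval_diff_curve[OF b(2), of 0] b(1) by simp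
  have bd: "curve_deriv (W, \<eta>) (\<lambda>t. act (pdiv G P (\<sigma> x) (\<sigma> x)) (b t)) 0 w"
  proof (rule curve_deriv_cong[OF b(4)])
    have "\<forall>\<^sub>F t in nhds 0. b t \<in> W" using b(4) by (simp add: curve_deriv_def)
    then show "\<forall>\<^sub>F t in nhds 0. b t = act (pdiv G P (\<sigma> x) (\<sigma> x)) (b t)"
      by eventually_elim (use W pdiv_unique[OF \<sigma>x(1) one_closed] \<sigma>x(1) in auto)
  qed
  have bv: "velocity B (\<lambda>t. assoc_class G P act (\<sigma> x) (b t)) 0 = (z, (0, w))"
    using vel[of "\<lambda>_. \<sigma> x" b w] db bd diff_curve_const[OF \<sigma>x(1)] \<sigma>x(2) b(3) by (simp add: z)
  show ?thesis
    unfolding nu_def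
  proof (rule the_equality)
    show "\<exists>\<epsilon>>0. \<exists>a b. smooth_map (interval_atlas \<epsilon>) TP a \<and> smooth_map (interval_atlas \<epsilon>) N b \<and>
       (\<forall>t\<in>{-\<epsilon><..<\<epsilon>}. \<pi> (a t) = \<pi> (a 0)) \<and>
       velocity B (\<lambda>t. assoc_class G P act (a t) (b t)) 0 = (z, (0, w)) \<and>
       assoc_class G P (tangent_action N act) (\<sigma> x) (velocity N \<gamma> 0) =
         assoc_class G P (tangent_action N act) (a 0) (velocity N (\<lambda>t. act (pdiv G P (a 0) (a t)) (b t)) 0)"
    proof (intro exI[of _ \<epsilon>] exI[of _ "\<lambda>_. \<sigma> x"] exI[of _ b] conjI)
      show "assoc_class G P (tangent_action N act) (\<sigma> x) (velocity N \<gamma> 0) =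
         assoc_class G P (tangent_action N act) (\<sigma> x) (velocity N (\<lambda>t. act (pdiv G P (\<sigma> x) (\<sigma> x)) (b t)) 0)"
        using uniq[OF diff_curve_const[OF \<sigma>x(1)] db _ bv] by simp
      show "smooth_map (interval_atlas \<epsilon>) TP (\<lambda>_. \<sigma> x)" by (rule smooth_interval_const[OF \<sigma>x(1)])
    qed (fact b(1) b(2) bv | simp)+
  next
    fix c
    assume "\<exists>\<epsilon>>0. \<exists>a b. smooth_map (interval_atlas \<epsilon>) TP a \<and> smooth_map (interval_atlas \<epsilon>) N b \<and>
       (\<forall>t\<in>{-\<epsilon><..<\<epsilon>}. \<pi> (a t) = \<pi> (a 0)) \<and>
       velocity B (\<lambda>t. assoc_class G P act (a t) (b t)) 0 = (z, (0, w)) \<and>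
       c = assoc_class G P (tangent_action N act) (a 0) (velocity N (\<lambda>t. act (pdiv G P (a 0) (a t)) (b t)) 0)"
    then obtain \<epsilon> a b where *: "\<epsilon> > 0" "smooth_map (interval_atlas \<epsilon>) TP a" "smooth_map (interval_atlas \<epsilon>) N b"
       "\<forall>t\<in>{-\<epsilon><..<\<epsilon>}. \<pi> (a t) = \<pi> (a 0)"
       "velocity B (\<lambda>t. assoc_class G P act (a t) (b t)) 0 = (z, (0, w))"
       "c = assoc_class G P (tangent_action N act) (a 0) (velocity N (\<lambda>t. act (pdiv G P (a 0) (a t)) (b t)) 0)"
      by blast
    have "diff_curve TP a 0" "diff_curve N b 0"
      using smooth_interval_diff_curve[OF *(2), of 0] smooth_interval_diff_curve[OF *(3), of 0] *(1) by auto
    moreover have "\<forall>\<^sub>F t in nhds 0. t \<in> {-\<epsilon><..<\<epsilon>}"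
      using *(1) by (intro eventually_nhds_in_open) auto
    then have "\<forall>\<^sub>F t in nhds 0. \<pi> (a t) = \<pi> (a 0)"
      by eventually_elim (use *(4) in blast)
    ultimately show "c = assoc_class G P (tangent_action N act) (\<sigma> x) (velocity N \<gamma> 0)"
      using uniq[of a b] *(5,6) by simp
  qed
qed

end

section \<open>The Darboux-Lie derivative\<close>

text \<open>The lift is known through its flow, not as a field lying over \<open>X\<close>. Each
  functor image in the flow equation covers its base map, so projecting the equation leaves the flow
  of \<open>X\<close> between two inclusions.\<close>

lemma Fproj_canonical_lift_flow:
  assumes F: "natural_bundle F S" and X: "canonical_lift F M X Y" and y: "y \<in> flow_dom (Fobj F M) Y t"
  shows "Fproj F M (flow (Fobj F M) Y t y) = flow M X t (Fproj F M y)"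
proof -
  define U U' where "U = restrict_atlas M (flow_dom M X t)" and "U' = restrict_atlas M (flow_dom M X (-t))"
  \<comment> \<open>The third morphism is the inclusion condition of \<open>canonical_lift\<close>
    at time \<open>-t\<close>.\<close>
  have mor: "Mf_morphism U M (\<lambda>x. x)" "Mf_morphism U U' (flow M X t)" "Mf_morphism U' M (\<lambda>x. x)"
    and dom: "flow_dom (Fobj F M) Y t = Fmap F U M (\<lambda>x. x) ` points (Fobj F U)"
    and fl: "\<And>z. z \<in> points (Fobj F U) \<Longrightarrow> flow (Fobj F M) Y t (Fmap F U M (\<lambda>x. x) z) =
        Fmap F U' M (\<lambda>x. x) (Fmap F U U' (flow M X t) z)"
    using X unfolding canonical_lift_def Let_def U_def U'_def by blast+
  have nat: "smooth_map (Fobj F A) (Fobj F A') (Fmap F A A' f)"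
    "z \<in> points (Fobj F A) \<Longrightarrow> Fproj F A' (Fmap F A A' f z) = f (Fproj F A z)"
    if "Mf_morphism A A' f" for A A' f z
    using F that unfolding natural_bundle_def fiberwise_diffeo_def by blast+
  obtain z where z: "z \<in> points (Fobj F U)" "y = Fmap F U M (\<lambda>x. x) z" using y dom by blast
  have "Fmap F U U' (flow M X t) z \<in> points (Fobj F U')"
    using smooth_map_points[OF nat(1)[OF mor(2)] z(1)] .
  then show ?thesis
    using z fl[OF z(1)] nat(2)[OF mor(1)] nat(2)[OF mor(2)] nat(2)[OF mor(3)] by simp
qed

section \<open>Translation and projection of integral curves\<close>

lemma (in principal) pact_chart_deriv:
  assumes "p \<in> points TP" "g \<in> carrier G"
  obtains L where "chart_deriv (chart_at TP p) (chart_at TP (pact P p g)) (\<lambda>p. pact P p g) p L"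
proof -
  note cp = chart_at_mem[OF assms(1)] and cq = chart_at_mem[OF pact_points[OF assms]]
    and cg = chart_at_mem[of g TG, simplified, OF assms(2)]
  have Q: "chart_deriv (chart_at TP p) (prod_chart (chart_at TP p) (chart_at TG g))
      (\<lambda>p. (p, g)) p (\<lambda>v. (v, 0))"
    by (rule chart_deriv_Pair[OF chart_deriv_ident[OF tops(2) cp] chart_deriv_const[OF tops(2) cp cg(2)]])
  obtain L where "chart_deriv (prod_chart (chart_at TP p) (chart_at TG g)) (chart_at TP (pact P p g))
      (\<lambda>(p, g). pact P p g) (p, g) L"
    using smooth_map_chart_deriv[OF prod_topological_atlas[OF tops(2,3)] pact_smooth
        prod_chart_mem[OF cp(1) cg(1)] cq(1), of "(p, g)"] cp(2) cg(2) cq(2)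
    by (auto simp: prod_chart_def)
  from chart_deriv_comp[OF Q this] show thesis using that by simp
qed

lemma (in principal) integral_curve_pact:
  assumes "invariant_field G P Xt" "integral_curve TP Xt J \<gamma>" "g \<in> carrier G"
  shows "integral_curve TP Xt J (\<lambda>t. pact P (\<gamma> t) g)"
proof (rule integral_curve_map[OF P_manifold assms(2)])
  fix p assume p: "p \<in> points TP"
  show "\<exists>L. chart_deriv (chart_at TP p) (chart_at TP (pact P p g)) (\<lambda>p. pact P p g) p L"
    using pact_chart_deriv[OF p assms(3)] by blast
  show "tangent_map TP TP (\<lambda>p. pact P p g) (p, Xt p) = (pact P p g, Xt (pact P p g))"
    using assms(1,3) p by (simp add: invariant_field_def)
qed (use assms(3) in simp)

lemma (in principal) integral_curve_projection:
  assumes "lies_over P M Xt X" "integral_curve TP Xt J \<gamma>"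
  shows "integral_curve M X J (\<lambda>t. \<pi> (\<gamma> t))"
proof (rule integral_curve_map[OF M assms(2) \<pi>_points])
  fix p assume p: "p \<in> points TP"
  show "\<exists>L. chart_deriv (chart_at TP p) (chart_at M (\<pi> p)) \<pi> p L"
    using smooth_map_tangent_map[OF tops(2) \<pi>_smooth p] by blast
  show "tangent_map TP M \<pi> (p, Xt p) = (\<pi> p, X (\<pi> p))"
    using assms(1) p by (simp add: lies_over_def)
qed

context associated
begin

text \<open>By invariance every right translate of \<gamma> is an integral curve on the same
  interval \<open>J\<close>, so the flow moves all representatives of a class
  simultaneously.\<close>

lemma assoc_flow_class:
  assumes Xt: "vector_field TP Xt" "invariant_field G P Xt" and J: "integral_curve TP Xt J \<gamma>" "0 \<in> J" "t \<in> J"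
  shows "assoc_flow P Xt t (assoc_class G P act (\<gamma> 0) n) = assoc_class G P act (\<gamma> t) n"
proof -
  have "flow TP Xt t (pact P (\<gamma> 0) g) = pact P (\<gamma> t) g" if "g \<in> carrier G" for g
    using flow_eq[OF P_manifold Xt(1) integral_curve_pact[OF Xt(2) J(1) that] J(2,3) refl] .
  then show ?thesis
    unfolding assoc_flow_def assoc_class_def by (force simp: image_iff)
qed

lemma id_times_form_class:
  assumes "equivariant_form G N act \<rho> \<omega>" "n \<in> points N"
  shows "id_times_form \<omega> (assoc_class G P (tangent_action N act) p (n, v)) = assoc_class G P \<rho> p (\<omega> (n, v))"
proof -
  have "\<omega> (tangent_action N act (inv\<^bsub>G\<^esub> g) (n, v)) = \<rho> (inv\<^bsub>G\<^esub> g) (\<omega> (n, v))" if "g \<in> carrier G" for g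
    using assms that by (simp add: equivariant_form_def)
  then show ?thesis
    unfolding id_times_form_def assoc_class_def by (force simp: image_iff)
qed

text \<open>Exposes the section \<sigma> behind the chart that \<open>chart_at\<close> picks at
  \<open>z\<close>; the coordinates of tangent vectors at \<open>z\<close> refer to this
  chart.\<close>

lemma assoc_bundle_chart:
  assumes "z \<in> points B"
  obtains U \<phi> W \<eta> U' \<sigma> D \<Phi> x n where
    "(U, \<phi>) \<in> M" "(W, \<eta>) \<in> N" "local_section M P U' \<sigma>" "D = (U \<inter> U') \<times> W"
    "\<Phi> = (\<lambda>(x, y). assoc_class G P act (\<sigma> x) y)"
    "chart_at B z = (\<Phi> ` D, map_prod \<phi> \<eta> \<circ> inv_into D \<Phi>)"
    "x \<in> U \<inter> U'" "n \<in> W" "z = assoc_class G P act (\<sigma> x) n"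
proof -
  note c = chart_at_mem[OF assms]
  obtain \<Phi> D \<phi> \<eta> U W U' \<sigma> where *: "chart_at B z = (\<Phi> ` D, map_prod \<phi> \<eta> \<circ> inv_into D \<Phi>)"
    "(U, \<phi>) \<in> M" "(W, \<eta>) \<in> N" "local_section M P U' \<sigma>" "D = (U \<inter> U') \<times> W"
    "\<Phi> = (\<lambda>(x, y). assoc_class G P act (\<sigma> x) y)"
    using c(1) unfolding assoc_bundle_def by blast
  obtain d where "d \<in> D" "z = \<Phi> d" using c(2) *(1) by auto
  then obtain x n where "x \<in> U \<inter> U'" "n \<in> W" "z = assoc_class G P act (\<sigma> x) n"
    using *(5,6) by auto
  then show thesis using that * by blast
qed

text \<open>Separates the bundle computation from naturality: flow lines are replaced by integral
  curves on a common interval, and the lift of \<open>X\<close> leaves its trace in the assumption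
  that \<gamma> and \<delta> have the same projection.\<close>

lemma darboux_lie_eq:
  assumes E: "manifold E" and Y: "vector_field E Y"
    and Xt: "vector_field TP Xt" "invariant_field G P Xt"
    and \<omega>: "equivariant_form G N act \<rho> \<omega>"
    and h: "bundle_map_over_id E q M G P N act h"
    and \<gamma>: "integral_curve TP Xt J \<gamma>" "0 \<in> J" and \<delta>: "integral_curve E Y J \<delta>"
    and over: "\<And>t. t \<in> J \<Longrightarrow> q (\<delta> t) = \<pi> (\<gamma> t)"
  shows "darboux_lie E Y M G P N act \<omega> Xt h (\<delta> 0) =
    assoc_class G P \<rho> (\<gamma> 0) (\<omega> (velocity N (\<lambda>t. adiv G P N act (\<gamma> t) (h (\<delta> t))) 0))"
proof -
  define y z where "y = \<delta> 0" and "z = h y"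
  note topE = manifold_topological_atlas[OF E]
  note \<gamma>D = integral_curveD[OF \<gamma>(1)] and \<delta>D = integral_curveD[OF \<delta>]
  have evJ: "\<forall>\<^sub>F t in nhds 0. t \<in> J" using \<gamma>D(1) \<gamma>(2) by (rule eventually_nhds_in_open)
  have hs: "smooth_map E B h" and hq: "\<And>y p n. y \<in> points E \<Longrightarrow> (p, n) \<in> h y \<Longrightarrow> \<pi> p = q y"
    using h unfolding bundle_map_over_id_def by blast+
  have yE: "y \<in> points E" using \<delta>D(3)[OF \<gamma>(2)] by (simp add: y_def)
  obtain U \<phi> W \<eta> U' \<sigma> D \<Phi> x n where c: "(U, \<phi>) \<in> M" "(W, \<eta>) \<in> N" and \<sigma>: "local_section M P U' \<sigma>"
    and D: "D = (U \<inter> U') \<times> W" and \<Phi>: "\<Phi> = (\<lambda>(x, y). assoc_class G P act (\<sigma> x) y)"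
    and cz: "chart_at B z = (\<Phi> ` D, map_prod \<phi> \<eta> \<circ> inv_into D \<Phi>)"
    and x: "x \<in> U \<inter> U'" and n: "n \<in> W" and z: "z = assoc_class G P act (\<sigma> x) n"
    using assoc_bundle_chart[OF smooth_map_points[OF hs yE, folded z_def]] by metis
  note s = local_sectionD[OF \<sigma>]
  have W: "W \<subseteq> points N" using chart_subset_points[OF c(2)] by auto
  \<comment> \<open>A class contains a pair whose first entry is the value of the section, so the
    condition that \<open>h\<close> covers the identity reveals the base point of the class.\<close>
  have section_mem: "(\<sigma> x', n') \<in> assoc_class G P act (\<sigma> x') n'" if "x' \<in> U'" "n' \<in> W" for x' n'
    unfolding assoc_class_def using that s(2) W by (intro CollectI exI[of _ "\<one>\<^bsub>G\<^esub>"]) auto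
  have xy: "x = q y" using hq[OF yE, of "\<sigma> x" n] section_mem x n z s(3) by (simp add: z_def)
  have \<gamma>0: "\<gamma> 0 \<in> points TP" "\<pi> (\<gamma> 0) = x" using \<gamma>D(3)[OF \<gamma>(2)] over[OF \<gamma>(2)] xy by (auto simp: y_def)
  have \<sigma>x: "\<sigma> x \<in> points TP" "\<pi> (\<sigma> x) = x" using s(2,3) x by auto
  have d\<gamma>: "diff_curve TP \<gamma> 0"
    using \<gamma>D(4)[OF \<gamma>(2)] chart_at_mem(1)[OF \<gamma>0(1)] by (auto simp: diff_curve_def)
  define k where "k = (\<lambda>t. pdiv G P (\<sigma> (\<pi> (\<gamma> t))) (\<gamma> t))"
  have k0: "k 0 \<in> carrier G" "pact P (\<sigma> x) (k 0) = \<gamma> 0"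
    using pdiv_works[OF \<sigma>x(1) \<gamma>0(1)] \<gamma>0(2) \<sigma>x(2) by (auto simp: k_def)
  define n0 where "n0 = act (inv\<^bsub>G\<^esub> (k 0)) n"
  have n0: "n0 \<in> points N" "act (k 0) n0 = n" using k0(1) n W by (auto simp: n0_def)
  have z': "z = assoc_class G P act (\<gamma> 0) n0"
    using assoc_class_pact_act[OF \<sigma>x(1) k0(1) n0(1)] k0(2) n0(2) by (simp add: z)
  have "\<pi> (\<gamma> 0) \<in> U \<inter> U'" "act (k 0) n0 \<in> W" using \<gamma>0(2) x n0(2) n by auto
  note cc = assoc_chart_curve[OF \<sigma> c D \<Phi> d\<gamma> diff_curve_const[OF n0(1)] this(1) k_def this(2)]

  \<comment> \<open>The vector \<open>(X\<^sub>N)\<^sub>z\<close> is the velocity of \<open>[\<gamma> t, n0] = [\<sigma> (\<pi> (\<gamma> t)), k t \<cdot> n0]\<close>.\<close>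
  obtain v1 where v1: "curve_deriv (W, \<eta>) (\<lambda>t. act (k t) n0) 0 v1"
    using diff_curve_chart[OF N cc(2) c(2)] n0(2) n by auto
  obtain vx where vx: "curve_deriv (U, \<phi>) (\<lambda>t. \<pi> (\<gamma> t)) 0 vx"
    using diff_curve_chart[OF M diff_curve_map[OF tops(2) \<pi>_smooth d\<gamma>] c(1)] \<gamma>0(2) x by auto
  have "curve_deriv (chart_at B z) (\<lambda>t. assoc_flow P Xt t z) 0 (vx, v1)"
  proof (rule curve_deriv_cong)
    show "\<forall>\<^sub>F t in nhds 0. assoc_class G P act (\<gamma> t) n0 = assoc_flow P Xt t z"
      using evJ by eventually_elim (simp add: z' assoc_flow_class[OF Xt \<gamma>])
    have D1: "((\<lambda>t. (\<phi> (\<pi> (\<gamma> t)), \<eta> (act (k t) n0))) has_vector_derivative (vx, v1)) (at 0)"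
      using vx v1 unfolding curve_deriv_def by (intro has_vector_derivative_Pair) (auto simp: comp_def)
    have ev: "\<forall>\<^sub>F t in nhds 0. (\<phi> (\<pi> (\<gamma> t)), \<eta> (act (k t) n0)) =
        (snd (chart_at B z) \<circ> (\<lambda>t. assoc_class G P act (\<gamma> t) n0)) t"
      using cc(3) by eventually_elim (simp add: cz)
    have "((snd (chart_at B z) \<circ> (\<lambda>t. assoc_class G P act (\<gamma> t) n0)) has_vector_derivative (vx, v1)) (at 0)"
      using D1 ev by (rule has_vector_derivative_eventually_cong)
    then show "curve_deriv (chart_at B z) (\<lambda>t. assoc_class G P act (\<gamma> t) n0) 0 (vx, v1)"
      using cc(3) by (auto simp: curve_deriv_def cz elim!: eventually_mono)
  qed
  \<comment> \<open>The velocity is taken in the chart at the time-0 point of the flow line, which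
    must therefore be identified with \<open>z\<close>.\<close>
  moreover have "assoc_flow P Xt 0 z = z" using assoc_flow_class[OF Xt \<gamma> \<gamma>(2)] by (simp add: z')
  ultimately have field: "assoc_field M G P N act Xt z = (vx, v1)"
    using velocity_eq[of B "\<lambda>t. assoc_flow P Xt t z" 0] by (simp add: assoc_field_def flow_generator_def)

  \<comment> \<open>\<open>T h (Y\<^sub>y)\<close> is the velocity of \<open>h (\<delta> t) = [\<sigma> (\<pi> (\<gamma> t)), m t]\<close>.\<close>
  obtain L where L: "chart_deriv (chart_at E y) (chart_at B z) h y L"
    "\<And>v. tangent_map E B h (y, v) = (z, L v)"
    using smooth_map_tangent_map[OF topE hs yE] unfolding z_def by metis
  have ch: "curve_deriv (chart_at B z) (\<lambda>t. h (\<delta> t)) 0 (L (Y y))"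
    using curve_deriv_comp[OF \<delta>D(4)[OF \<gamma>(2)], folded y_def, OF L(1)] .
  define m where "m = (\<lambda>t. snd (inv_into D \<Phi> (h (\<delta> t))))"
  have m: "\<forall>\<^sub>F t in nhds 0. m t \<in> W \<and> \<pi> (\<gamma> t) \<in> U \<inter> U' \<and>
      inv_into D \<Phi> (h (\<delta> t)) = (\<pi> (\<gamma> t), m t) \<and> h (\<delta> t) = assoc_class G P act (\<sigma> (\<pi> (\<gamma> t))) (m t)"
  proof -
    have "\<forall>\<^sub>F t in nhds 0. h (\<delta> t) \<in> \<Phi> ` D" using ch by (simp add: curve_deriv_def cz)
    then show ?thesis using evJ
    proof eventually_elim
      case (elim t)
      obtain x' where i: "inv_into D \<Phi> (h (\<delta> t)) = (x', m t)" unfolding m_def by (metis prod.collapse)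
      have "(x', m t) \<in> D" "h (\<delta> t) = \<Phi> (x', m t)"
        using inv_into_into[OF elim(1)] f_inv_into_f[OF elim(1)] i by auto
      then have *: "x' \<in> U \<inter> U'" "m t \<in> W" "h (\<delta> t) = assoc_class G P act (\<sigma> x') (m t)"
        by (auto simp: D \<Phi>)
      have "x' = q (\<delta> t)"
        using hq[OF \<delta>D(3)[OF elim(2)], of "\<sigma> x'" "m t"] section_mem[of x' "m t"] * s(3) by simp
      then have "x' = \<pi> (\<gamma> t)" using over[OF elim(2)] by simp
      then show ?case using * i by simp
    qed
  qed
  obtain ux u where Lu: "L (Y y) = (ux, u)" by fastforce
  have chv: "((snd (chart_at B z) \<circ> (\<lambda>t. h (\<delta> t))) has_vector_derivative (ux, u)) (at 0)"
    using ch by (simp add: curve_deriv_def Lu)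
  have "((\<lambda>t. fst ((snd (chart_at B z) \<circ> (\<lambda>t. h (\<delta> t))) t)) has_vector_derivative ux) (at 0)"
    using bounded_linear.has_vector_derivative[OF bounded_linear_fst chv] by simp
  moreover have "\<forall>\<^sub>F t in nhds 0. fst ((snd (chart_at B z) \<circ> (\<lambda>t. h (\<delta> t))) t) = (\<phi> \<circ> (\<lambda>t. \<pi> (\<gamma> t))) t"
    using m by eventually_elim (metis cz comp_apply fst_conv fst_map_prod snd_conv)
  ultimately have "((\<phi> \<circ> (\<lambda>t. \<pi> (\<gamma> t))) has_vector_derivative ux) (at 0)"
    by (rule has_vector_derivative_eventually_cong)
  \<comment> \<open>Both curves lie over \<open>\<pi> (\<gamma> t)\<close>, so their base components
    cancel and the difference is vertical.\<close>
  then have ux: "ux = vx" using vx unfolding curve_deriv_def by (auto intro: vector_derivative_unique_at)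
  have "((\<lambda>t. snd ((snd (chart_at B z) \<circ> (\<lambda>t. h (\<delta> t))) t)) has_vector_derivative u) (at 0)"
    using bounded_linear.has_vector_derivative[OF bounded_linear_snd chv] by simp
  then have u: "curve_deriv (W, \<eta>) m 0 u"
    using m by (auto simp: curve_deriv_def cz m_def comp_def snd_map_prod elim!: eventually_mono)
  have m0: "m 0 = n"
  proof (rule assoc_class_inj[OF \<sigma>x(1)])
    show "assoc_class G P act (\<sigma> x) (m 0) = assoc_class G P act (\<sigma> x) n"
      using eventually_nhds_x_imp_x[OF m] \<gamma>0(2) z by (simp add: z_def y_def)
  qed (use eventually_nhds_x_imp_x[OF m] n W in auto)

  \<comment> \<open>In the frame \<open>\<gamma> t\<close> the curve \<open>h (\<delta> t)\<close> is \<open>r t\<close>; transported to the frame \<open>\<sigma> x\<close> it is \<open>j t\<close>.\<close>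
  define r where "r = (\<lambda>t. adiv G P N act (\<gamma> t) (h (\<delta> t)))"
  have r: "\<forall>\<^sub>F t in nhds 0. act (inv\<^bsub>G\<^esub> (k t)) (m t) = r t"
    using m cc(4)
  proof eventually_elim
    case (elim t)
    have mt: "m t \<in> points N" using elim(1) W by auto
    have "h (\<delta> t) = assoc_class G P act (\<gamma> t) (act (inv\<^bsub>G\<^esub> (k t)) (m t))"
      using assoc_class_pact_act[of "\<sigma> (\<pi> (\<gamma> t))" "k t" "act (inv\<^bsub>G\<^esub> (k t)) (m t)"] elim s(2) mt by simp
    then show ?case using adiv_assoc_class[of "\<gamma> t" "act (inv\<^bsub>G\<^esub> (k t)) (m t)"] elim(2) mt by (simp add: r_def)
  qed
  have dm: "diff_curve N m 0" using u c(2) by (auto simp: diff_curve_def)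
  have dr: "diff_curve N r 0"
    by (rule diff_curve_cong[OF diff_curve_act[OF diff_curve_inv[OF cc(1)] dm] r])
  have r0: "r 0 = n0" using eventually_nhds_x_imp_x[OF r] m0 by (simp add: n0_def)
  define j where "j = (\<lambda>t. act (k 0) (r t))"
  have dj: "diff_curve N j 0"
    unfolding j_def by (rule diff_curve_act[OF diff_curve_const dr]) (use k0(1) in simp)
  have j0: "j 0 = n" by (simp add: j_def r0 n0(2))
  obtain w where w: "curve_deriv (W, \<eta>) j 0 w" using diff_curve_chart[OF N dj c(2)] j0 n by auto
  define a where "a = (\<lambda>t. k t \<otimes>\<^bsub>G\<^esub> inv\<^bsub>G\<^esub> (k 0))"
  have a: "diff_curve TG a 0" "a 0 = \<one>\<^bsub>G\<^esub>"
    unfolding a_def using diff_curve_mult[OF cc(1) diff_curve_const] k0(1) by auto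
  have act_a: "\<forall>\<^sub>F t in nhds 0. \<forall>y\<in>points N. act (a t) (act (k 0) y) = act (k t) y"
    using cc(4)
  proof eventually_elim
    case (elim t)
    then show ?case using k0(1) by (simp add: a_def m_assoc flip: act_mult)
  qed
  have "u = v1 + w"
  proof (rule curve_deriv_act_product[OF c(2) a _ _ w])
    show "curve_deriv (W, \<eta>) (\<lambda>t. act (a t) (j t)) 0 u"
    proof (rule curve_deriv_cong[OF u])
      show "\<forall>\<^sub>F t in nhds 0. m t = act (a t) (j t)"
        using act_a r m cc(4) diff_curve_eventually_points[OF topN dr]
      proof eventually_elim
        case (elim t)
        then have "act (a t) (j t) = act (k t) (act (inv\<^bsub>G\<^esub> (k t)) (m t))" by (simp add: j_def)
        also have "\<dots> = m t" using elim W by (intro act_act_inv) auto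
        finally show ?case by simp
      qed
    qed
    show "curve_deriv (W, \<eta>) (\<lambda>t. act (a t) (j 0)) 0 v1"
    proof (rule curve_deriv_cong[OF v1])
      show "\<forall>\<^sub>F t in nhds 0. act (k t) n0 = act (a t) (j 0)"
        using act_a by eventually_elim (use n0(1) in \<open>simp add: j_def r0\<close>)
    qed
  qed
  then have "lie_tilde E Y M G P N act Xt h y = (z, (0, w))"
    using L(2) field by (simp add: lie_tilde_def z_def[symmetric] Lu ux)
  then have "darboux_lie E Y M G P N act \<omega> Xt h y = id_times_form \<omega> (nu M G P N act (z, (0, w)))"
    by (simp add: darboux_lie_def)
  also have "nu M G P N act (z, (0, w)) = assoc_class G P (tangent_action N act) (\<sigma> x) (velocity N j 0)"
    using nu_vertical[OF c \<sigma> D \<Phi> x n z cz w j0] .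
  also have "velocity N j 0 = tangent_action N act (k 0) (velocity N r 0)"
    unfolding j_def using tangent_action_velocity[OF k0(1) dr] by simp
  \<comment> \<open>The factor \<open>k 0\<close> is absorbed by changing the frame from
    \<open>\<sigma> x\<close> to \<open>\<gamma> 0\<close>, still at the level of tangent vectors of
    \<open>N\<close>; equivariance of \<omega> then sends the tangent class to a class in the
    module.\<close>
  also have "assoc_class G P (tangent_action N act) (\<sigma> x) (tangent_action N act (k 0) (velocity N r 0)) =
      assoc_class G P (tangent_action N act) (\<gamma> 0) (velocity N r 0)"
    using assoc_class_tangent[OF \<sigma>x(1) k0(1), of "r 0"] k0(2) r0 n0(1) by (simp add: velocity_def)
  also have "id_times_form \<omega> \<dots> = assoc_class G P \<rho> (\<gamma> 0) (\<omega> (velocity N r 0))"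
    using id_times_form_class[OF \<omega>, of "r 0"] r0 n0(1) by (simp add: velocity_def)
  finally show ?thesis by (simp add: y_def r_def)
qed

end

theorem proposition4p4:
  fixes F :: "('a, 'e::model_space, 'b, 'f::model_space) bundle_functor"
    and S :: "('s, 'k::model_space) atlas"
    and M :: "('a, 'e) atlas"
    and G :: "('g, 'l::model_space) lie_group_data"
    and P :: "('p, 'q::model_space, 'a, 'g) principal_data"
    and N :: "('n, 'd::model_space) atlas"
    and act :: "'g \<Rightarrow> 'n \<Rightarrow> 'n"
    and \<rho> :: "'g \<Rightarrow> 'v::model_space \<Rightarrow> 'v"
    and \<omega> :: "'n \<times> 'd \<Rightarrow> 'v"
    and X :: "'a \<Rightarrow> 'e" and Xt :: "'p \<Rightarrow> 'q" and FX :: "'b \<Rightarrow> 'f"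
    and h :: "'b \<Rightarrow> ('p \<times> 'n) set"
    and x :: 'a and p :: 'p and y :: 'b
  assumes "natural_bundle F S"
    and "manifold M"
    and "lie_group G"
    and "principal_bundle M G P"
    and "manifold N" and "smooth_left_action G N act"
    and "G_module G \<rho>"
    and "one_form N \<omega>" and "equivariant_form G N act \<rho> \<omega>"
    and "vector_field (ptotal P) Xt" and "invariant_field G P Xt"
    and "vector_field M X" and "lies_over P M Xt X"
    and "canonical_lift F M X FX"
    and "bundle_map_over_id (Fobj F M) (Fproj F M) M G P N act h"
    and "x \<in> points M"
    and "p \<in> points (ptotal P)" and "pproj P p = x"
    and "y \<in> points (Fobj F M)" and "Fproj F M y = x"
  shows "darboux_lie (Fobj F M) FX M G P N act \<omega> Xt h y =
    assoc_class G P \<rho> p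
      (\<omega> (velocity N
         (\<lambda>t. adiv G P N act (flow (ptotal P) Xt t p) (h (flow (Fobj F M) FX t y))) 0))"
proof -
  interpret associated M G P N act by unfold_locales (fact assms)+
  let ?E = "Fobj F M"
  have E: "manifold ?E" using assms(1,2) by (auto simp: natural_bundle_def fiber_bundle_def)
  have FX: "vector_field ?E FX" using assms(14) by (simp add: canonical_lift_def)
  obtain d1 \<gamma> where \<gamma>: "d1 > 0" "integral_curve TP Xt {-d1<..<d1} \<gamma>" "\<gamma> 0 = p"
    using integral_curve_exists[OF P_manifold assms(10,17)] .
  obtain d2 \<delta> where \<delta>: "d2 > 0" "integral_curve ?E FX {-d2<..<d2} \<delta>" "\<delta> 0 = y"
    using integral_curve_exists[OF E FX assms(19)] .
  \<comment> \<open>The two flow lines exist on different intervals; the smaller one serves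
    both.\<close>
  define J where "J = {-min d1 d2<..<min d1 d2}"
  have J: "open J" "is_interval J" "0 \<in> J" using \<gamma>(1) \<delta>(1) by (auto simp: J_def is_interval_oo)
  have \<gamma>J: "integral_curve TP Xt J \<gamma>"
    by (rule integral_curve_subset[OF P_manifold \<gamma>(2) J(1,2)]) (auto simp: J_def)
  have \<delta>J: "integral_curve ?E FX J \<delta>"
    by (rule integral_curve_subset[OF E \<delta>(2) J(1,2)]) (auto simp: J_def)
  have \<gamma>f: "flow TP Xt t p = \<gamma> t" if "t \<in> J" for t
    using flow_eq[OF P_manifold assms(10) \<gamma>J J(3) that \<gamma>(3)] .
  have \<delta>f: "flow ?E FX t y = \<delta> t" if "t \<in> J" for t
    using flow_eq[OF E FX \<delta>J J(3) that \<delta>(3)] .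
  \<comment> \<open>Both sides are the flow line of \<open>X\<close> through \<open>x\<close>, on
    the left by naturality of the lift and on the right because \<open>Xt\<close> lies over
    \<open>X\<close>.\<close>
  have over: "Fproj F M (\<delta> t) = \<pi> (\<gamma> t)" if t: "t \<in> J" for t
  proof -
    have "Fproj F M (\<delta> t) = flow M X t x"
      using Fproj_canonical_lift_flow[OF assms(1,14) flow_domI[OF \<delta>J J(3) t \<delta>(3)]] \<delta>f[OF t] assms(20)
      by simp
    also have "\<dots> = \<pi> (\<gamma> t)"
      using flow_eq[OF assms(2,12) integral_curve_projection[OF assms(13) \<gamma>J] J(3) t] \<gamma>(3) assms(18) by simp
    finally show ?thesis .
  qed
  \<comment> \<open>The flows are identified with the integral curves on \<open>J\<close> only,
    which suffices since a velocity depends on the germ of the curve.\<close>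
  have ev: "\<forall>\<^sub>F t in nhds 0. adiv G P N act (\<gamma> t) (h (\<delta> t)) =
      adiv G P N act (flow TP Xt t p) (h (flow ?E FX t y))"
    using eventually_nhds_in_open[OF J(1,3)] by eventually_elim (simp add: \<gamma>f \<delta>f)
  have "velocity N (\<lambda>t. adiv G P N act (\<gamma> t) (h (\<delta> t))) 0 =
      velocity N (\<lambda>t. adiv G P N act (flow TP Xt t p) (h (flow ?E FX t y))) 0"
    by (rule velocity_cong[OF ev])
  then show ?thesis
    using darboux_lie_eq[OF E FX assms(10,11,9,15) \<gamma>J J(3) \<delta>J over] \<gamma>(3) \<delta>(3) by simp
qed

end
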